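(* Let $N\geq 5$ be an integer, let $0<\alpha<2$, and put $2^{**}_{\alpha}=\frac{2N}{N-4+2\alpha}$. Then $\mathcal{D}^{2,2}_{\alpha}(\mathbb{R}^N)$ embeds continuously into $L^{2^{**}_{\alpha}}(\mathbb{R}^N)$; that is, there exists a constant $S_{N,\alpha}>0$ such that $$\int_{\mathbb{R}^N} |\mathrm{div}(|x|^\alpha\nabla u)|^2 \,\mathrm{d}x \geq S_{N,\alpha} \left(\int_{\mathbb{R}^N}|u|^{2^{**}_{\alpha}} \,\mathrm{d}x\right)^{\frac{2}{2^{**}_{\alpha}}}\quad\text{for all } u\in \mathcal{D}^{2,2}_{\alpha}(\mathbb{R}^N).$$
   Context: $\mathcal{D}^{2,2}_\alpha(\mathbb{R}^N)$ is the completion of $\{u\in C^\infty_c(\mathbb{R}^N): \int_{\mathbb{R}^N} |\mathrm{div}(|x|^\alpha\nabla u)|^2 \,\mathrm{d}x<\infty\}$ with respect to the inner product $\langle u,v\rangle_\alpha=\int_{\mathbb{R}^N} \mathrm{div}(|x|^\alpha\nabla u)\,\mathrm{div}(|x|^\alpha\nabla v)\, \mathrm{d}x$. No symmetry of $u$ is assumed. *)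

theory Defs
  imports "HOL-Analysis.Analysis"
begin

primrec continuously_diff :: "nat \<Rightarrow> ('a::euclidean_space \<Rightarrow> real) \<Rightarrow> bool" where
  "continuously_diff 0 f \<longleftrightarrow> continuous_on UNIV f"
| "continuously_diff (Suc k) f \<longleftrightarrow>
     f differentiable_on UNIV \<and>
     (\<forall>v. continuously_diff k (\<lambda>x. frechet_derivative f (at x) v))"

definition smooth_compact_support :: "('a::euclidean_space \<Rightarrow> real) set" where
  "smooth_compact_support =
     {u. (\<forall>k. continuously_diff k u) \<and> compact (closure {x. u x \<noteq> 0})}"

definition grad :: "('a::euclidean_space \<Rightarrow> real) \<Rightarrow> 'a \<Rightarrow> 'a" where
  "grad u x = (\<Sum>b\<in>Basis. frechet_derivative u (at x) b *\<^sub>R b)"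

definition divergence :: "('a::euclidean_space \<Rightarrow> 'a) \<Rightarrow> 'a \<Rightarrow> real" where
  "divergence F x = (\<Sum>b\<in>Basis. frechet_derivative F (at x) b \<bullet> b)"

text \<open>For smooth \<open>u\<close> the weighted field below is differentiable off the origin, which is a
  null set. At the origin the derivative need not exist; the arbitrary value taken there is
  irrelevant because this function is only ever integrated.\<close>

definition wdiv :: "real \<Rightarrow> ('a::euclidean_space \<Rightarrow> real) \<Rightarrow> 'a \<Rightarrow> real" where
  "wdiv \<alpha> u = divergence (\<lambda>x. (norm x powr \<alpha>) *\<^sub>R grad u x)"

definition test_space :: "real \<Rightarrow> ('a::euclidean_space \<Rightarrow> real) set" where
  "test_space \<alpha> =
     {u \<in> smooth_compact_support. integrable lborel (\<lambda>x. \<bar>wdiv \<alpha> u x\<bar>\<^sup>2)}"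

definition test_inner :: "real \<Rightarrow> ('a::euclidean_space \<Rightarrow> real) \<Rightarrow> ('a \<Rightarrow> real) \<Rightarrow> real" where
  "test_inner \<alpha> u v = (\<integral>x. wdiv \<alpha> u x * wdiv \<alpha> v x \<partial>lborel)"

definition test_dist :: "real \<Rightarrow> ('a::euclidean_space \<Rightarrow> real) \<Rightarrow> ('a \<Rightarrow> real) \<Rightarrow> real" where
  "test_dist \<alpha> u v = sqrt (test_inner \<alpha> (\<lambda>x. u x - v x) (\<lambda>x. u x - v x))"

text \<open>The completion is the usual one: Cauchy sequences of test functions modulo sequences
  at distance tending to zero.\<close>

definition cauchy_seqs :: "real \<Rightarrow> (nat \<Rightarrow> 'a::euclidean_space \<Rightarrow> real) set" where
  "cauchy_seqs \<alpha> =
     {\<phi>. (\<forall>n. \<phi> n \<in> test_space \<alpha>) \<and>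
         (\<forall>e>0. \<exists>M. \<forall>m\<ge>M. \<forall>n\<ge>M. test_dist \<alpha> (\<phi> m) (\<phi> n) < e)}"

definition cauchy_rel ::
  "real \<Rightarrow> ((nat \<Rightarrow> 'a::euclidean_space \<Rightarrow> real) \<times> (nat \<Rightarrow> 'a \<Rightarrow> real)) set" where
  "cauchy_rel \<alpha> =
     {(\<phi>, \<psi>). \<phi> \<in> cauchy_seqs \<alpha> \<and> \<psi> \<in> cauchy_seqs \<alpha> \<and>
              (\<lambda>n. test_dist \<alpha> (\<phi> n) (\<psi> n)) \<longlonglongrightarrow> 0}"

definition D22 :: "real \<Rightarrow> (nat \<Rightarrow> 'a::euclidean_space \<Rightarrow> real) set set" where
  "D22 \<alpha> = cauchy_seqs \<alpha> // cauchy_rel \<alpha>"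

definition D22_of :: "real \<Rightarrow> ('a::euclidean_space \<Rightarrow> real) \<Rightarrow> (nat \<Rightarrow> 'a \<Rightarrow> real) set" where
  "D22_of \<alpha> u = cauchy_rel \<alpha> `` {\<lambda>n. u}"

definition D22_add ::
  "real \<Rightarrow> (nat \<Rightarrow> 'a::euclidean_space \<Rightarrow> real) set \<Rightarrow> (nat \<Rightarrow> 'a \<Rightarrow> real) set
     \<Rightarrow> (nat \<Rightarrow> 'a \<Rightarrow> real) set" where
  "D22_add \<alpha> U V = (\<Union>\<phi>\<in>U. \<Union>\<psi>\<in>V. cauchy_rel \<alpha> `` {\<lambda>n x. \<phi> n x + \<psi> n x})"

definition D22_scale ::
  "real \<Rightarrow> real \<Rightarrow> (nat \<Rightarrow> 'a::euclidean_space \<Rightarrow> real) set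
     \<Rightarrow> (nat \<Rightarrow> 'a \<Rightarrow> real) set" where
  "D22_scale \<alpha> c U = (\<Union>\<phi>\<in>U. cauchy_rel \<alpha> `` {\<lambda>n x. c * \<phi> n x})"

text \<open>Elements of \<open>L\<^sup>p\<close> are handled through representatives, compared almost everywhere.\<close>

definition Lp :: "real \<Rightarrow> ('a::euclidean_space \<Rightarrow> real) set" where
  "Lp p = {f \<in> borel_measurable lborel. integrable lborel (\<lambda>x. \<bar>f x\<bar> powr p)}"

text \<open>For \<open>U\<close> in the completion, \<open>D22_div \<alpha> U\<close> is the value of
  \<open>div (|x|\<^sup>\<alpha> \<nabla>u)\<close> under the unique continuous extension of this operator, from test
  functions to the completion, with values in \<open>L\<^sup>2\<close>; it is determined up to a null set.\<close>

definition D22_div ::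
  "real \<Rightarrow> (nat \<Rightarrow> 'a::euclidean_space \<Rightarrow> real) set \<Rightarrow> 'a \<Rightarrow> real" where
  "D22_div \<alpha> U =
     (SOME g. g \<in> Lp 2 \<and>
        (\<forall>\<phi>\<in>U. (\<lambda>n. \<integral>x. \<bar>wdiv \<alpha> (\<phi> n) x - g x\<bar>\<^sup>2 \<partial>lborel) \<longlonglongrightarrow> 0))"

definition crit_exp :: "nat \<Rightarrow> real \<Rightarrow> real" where
  "crit_exp N \<alpha> = 2 * real N / (real N - 4 + 2 * \<alpha>)"

text \<open>An injective linear map from the completion to \<open>L\<^sup>p\<close> that is the identity on test
  functions. Its continuity is the norm inequality, which is kept separate.\<close>

definition linear_embedding ::
  "real \<Rightarrow> real \<Rightarrow> ((nat \<Rightarrow> 'a::euclidean_space \<Rightarrow> real) set \<Rightarrow> 'a \<Rightarrow> real) \<Rightarrow> bool" where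
  "linear_embedding \<alpha> p T \<longleftrightarrow>
     (\<forall>U\<in>D22 \<alpha>. T U \<in> Lp p) \<and>
     (\<forall>u\<in>test_space \<alpha>. AE x in lborel. T (D22_of \<alpha> u) x = u x) \<and>
     (\<forall>U\<in>D22 \<alpha>. \<forall>V\<in>D22 \<alpha>. AE x in lborel. T (D22_add \<alpha> U V) x = T U x + T V x) \<and>
     (\<forall>c. \<forall>U\<in>D22 \<alpha>. AE x in lborel. T (D22_scale \<alpha> c U) x = c * T U x) \<and>
     (\<forall>U\<in>D22 \<alpha>. \<forall>V\<in>D22 \<alpha>. (AE x in lborel. T U x = T V x) \<longrightarrow> U = V)"

end

theory Submission
  imports Defs
begin

text \<open>
  Write \<open>w = div(|x|\<^sup>\<alpha> \<nabla>u)\<close>, \<open>m(l) = |{u > l}|\<close> and \<open>W(l)\<close> for the integral of \<open>|w|\<close> over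
  \<open>{u > l}\<close>. Testing \<open>w\<close> with a smooth step of \<open>u\<close> between the levels \<open>l\<close> and \<open>2l\<close> bounds the
  weighted Dirichlet energy between these levels by \<open>l W(l)\<close>. As the integral of \<open>|x|\<^sup>-\<^sup>\<alpha>\<close> over a
  set \<open>F\<close> is at most \<open>K |F|\<close> to the power \<open>1 - \<alpha>/N\<close>, Cauchy-Schwarz turns this into an \<open>L\<^sup>1\<close> bound for
  the gradient of the step. Comparing the step with its translates by vectors of a ball of volume
  \<open>2 m(l)\<close> yields \<open>l m(2l)\<^sup>2 \<le> C m(l) W(l)\<close> with an additional factor \<open>m(l)\<close> to the power
  \<open>\<theta> = (2 - \<alpha>)/N\<close>. After multiplication with a power of \<open>l\<close>, integration over \<open>l\<close> (layer cake) and
  AM-GM, the powers match exactly if \<open>1/p = 1/2 - \<theta>\<close>, which is the critical exponent.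

  The extension to the completion is injective because the operator is closable: if \<open>\<eta>\<^sub>n\<close> tends to
  \<open>0\<close> in \<open>L\<^sup>p\<close> and its images \<open>w\<^sub>n\<close> are Cauchy in \<open>L\<^sup>2\<close>, integration by parts against \<open>w\<^sub>m\<close> cut off
  near the origin, which is an admissible test function, shows that the limit of \<open>w\<^sub>n\<close> vanishes.
\<close>

section \<open>Functions of class \<open>C\<^sup>k\<close> on open sets\<close>

text \<open>The weight degenerates at the origin and need not be differentiable there, so
  \<open>wdiv\<close> is controlled only off 0 and every integration by parts has to keep away from
  that point. No second derivative of u is estimated: w is tested once with a function of u, and the
  first-order energy obtained in this way is all that enters. The price is that the levels l and 2l
  do not match. After integration over l this mismatch is a factor 2 to the power -p, which fixes
  the weights in AM-GM. The surplus m(l)^\<theta> is removed by Chebyshev's inequality in terms of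
  the full integral X of the p-th power, not level by level. The resulting inequality is therefore
  nonlinear in X, and it closes because X is finite in advance for test functions, so that a part of
  X may be absorbed and a power of X cancelled. As the value of S is left open, p-th powers of norms
  and a triangle inequality with a constant replace norms throughout.\<close>

abbreviation (input) dir_deriv :: "('a::real_normed_vector \<Rightarrow> real) \<Rightarrow> 'a \<Rightarrow> 'a \<Rightarrow> real" where
  "dir_deriv f v x \<equiv> frechet_derivative f (at x) v"

text \<open>A version of \<open>continuously_diff\<close> relative to a set, since powers of |x| are
  smooth only off the origin. Derivatives are taken at x rather than within the set, so on open sets
  the notion is local and pieces can be glued by \<open>Ck_on_Un\<close>.\<close>

primrec Ck_on :: "nat \<Rightarrow> 'a::real_normed_vector set \<Rightarrow> ('a \<Rightarrow> real) \<Rightarrow> bool" where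
  "Ck_on 0 S f \<longleftrightarrow> continuous_on S f"
| "Ck_on (Suc k) S f \<longleftrightarrow>
     (\<forall>x\<in>S. f differentiable (at x)) \<and> (\<forall>v. Ck_on k S (dir_deriv f v))"

lemma dir_deriv_eq: "(f has_derivative f') (at x) \<Longrightarrow> dir_deriv f v x = f' v"
  using frechet_derivative_at by metis

lemma continuously_diff_imp_Ck_on: "continuously_diff k f \<Longrightarrow> Ck_on k UNIV f"
  by (induction k arbitrary: f) (auto simp: differentiable_on_def)

lemma Ck_on_imp_continuously_diff: "Ck_on k UNIV f \<Longrightarrow> continuously_diff k f"
  by (induction k arbitrary: f) (auto simp: differentiable_on_def)

lemma Ck_on_subset: "Ck_on k S f \<Longrightarrow> T \<subseteq> S \<Longrightarrow> Ck_on k T f"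
  by (induction k arbitrary: f) (auto intro: continuous_on_subset)

lemma Ck_on_cong:
  assumes "open S" "Ck_on k S f" "\<And>x. x \<in> S \<Longrightarrow> f x = g x"
  shows "Ck_on k S g"
  using assms(2,3)
proof (induction k arbitrary: f g)
  case 0
  then show ?case by (simp cong: continuous_on_cong)
next
  case (Suc k)
  have d: "(g has_derivative frechet_derivative f (at x)) (at x)" if "x \<in> S" for x
    using that Suc.prems assms(1) has_derivative_transform_within_open[of f _ x UNIV S g]
    by (auto simp: frechet_derivative_works)
  have "Ck_on k S (dir_deriv g v)" for v
    by (rule Suc.IH[of "dir_deriv f v"]) (use Suc.prems in \<open>auto simp: dir_deriv_eq[OF d]\<close>)
  then show ?case using d by (auto simp: differentiable_def)
qed

lemma Ck_on_SucI:
  assumes "open S" "\<And>x. x \<in> S \<Longrightarrow> (f has_derivative f' x) (at x)" "\<And>v. Ck_on k S (\<lambda>x. f' x v)"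
  shows "Ck_on (Suc k) S f"
proof -
  have "Ck_on k S (dir_deriv f v)" for v
    by (rule Ck_on_cong[OF assms(1) assms(3)[of v]]) (simp add: dir_deriv_eq[OF assms(2)])
  then show ?thesis using assms(2) by (auto simp: differentiable_def)
qed

lemma Ck_on_Un:
  assumes "open S" "open T" "Ck_on k S f" "Ck_on k T f"
  shows "Ck_on k (S \<union> T) f"
  using assms(3,4) by (induction k arbitrary: f) (auto intro: continuous_on_open_Un assms(1,2))

lemma Ck_on_has_derivative:
  "Ck_on (Suc k) S f \<Longrightarrow> x \<in> S \<Longrightarrow> (f has_derivative frechet_derivative f (at x)) (at x)"
  by (simp add: frechet_derivative_works)

lemma Ck_on_Suc_imp: "Ck_on (Suc k) S f \<Longrightarrow> Ck_on k S f"
proof (induction k arbitrary: f)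
  case 0
  then show ?case
    by (simp add: continuous_at_imp_continuous_on differentiable_imp_continuous_within)
next
  case (Suc k)
  then show ?case by (metis Ck_on.simps(2))
qed

lemma Ck_on_mono: "Ck_on k S f \<Longrightarrow> j \<le> k \<Longrightarrow> Ck_on j S f"
proof (induction k)
  case (Suc k)
  then show ?case using Ck_on_Suc_imp le_Suc_eq by blast
qed simp

lemma Ck_on_imp_continuous_on: "Ck_on k S f \<Longrightarrow> continuous_on S f"
  using Ck_on_mono[of k S f 0] by simp

lemma Ck_on_dir_deriv: "Ck_on (Suc k) S f \<Longrightarrow> Ck_on k S (dir_deriv f v)"
  by simp

lemma Ck_on_const: "open S \<Longrightarrow> Ck_on k S (\<lambda>x. c)"
proof (induction k arbitrary: c)
  case (Suc k)
  show ?case by (rule Ck_on_SucI[OF Suc.prems has_derivative_const]) (use Suc in simp)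
qed simp

lemma Ck_on_add:
  assumes "open S" "Ck_on k S f" "Ck_on k S g"
  shows "Ck_on k S (\<lambda>x. f x + g x)"
  using assms(2,3)
proof (induction k arbitrary: f g)
  case (Suc k)
  show ?case
    by (rule Ck_on_SucI[OF assms(1) has_derivative_add[OF Ck_on_has_derivative Ck_on_has_derivative]])
      (use Suc in \<open>auto\<close>)
qed (auto intro: continuous_intros)

lemma Ck_on_mult:
  assumes "open S" "Ck_on k S f" "Ck_on k S g"
  shows "Ck_on k S (\<lambda>x. f x * g x)"
  using assms(2,3)
proof (induction k arbitrary: f g)
  case (Suc k)
  have "Ck_on k S f" "Ck_on k S g" using Suc.prems by (auto intro: Ck_on_Suc_imp simp del: Ck_on.simps)
  then show ?case
    by (intro Ck_on_SucI[OF assms(1) has_derivative_mult[OF Ck_on_has_derivative Ck_on_has_derivative]])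
      (use Suc in \<open>auto intro: Ck_on_add assms(1)\<close>)
qed (auto intro: continuous_intros)

lemma Ck_on_sum:
  assumes "open S" "finite I" "\<And>i. i \<in> I \<Longrightarrow> Ck_on k S (f i)"
  shows "Ck_on k S (\<lambda>x. \<Sum>i\<in>I. f i x)"
  using assms(2,3) by (induction I) (auto intro: Ck_on_add Ck_on_const assms(1))

lemma Ck_on_scale: "open S \<Longrightarrow> Ck_on k S f \<Longrightarrow> Ck_on k S (\<lambda>x. c * f x)"
  by (intro Ck_on_mult Ck_on_const)

lemma Ck_on_diff:
  assumes "open S" "Ck_on k S f" "Ck_on k S g"
  shows "Ck_on k S (\<lambda>x. f x - g x)"
  using Ck_on_add[OF assms(1,2) Ck_on_scale[OF assms(1,3), of "-1"]] by simp

lemma Ck_on_inner_left: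
  fixes S :: "'a::real_inner set"
  assumes "open S" shows "Ck_on k S (\<lambda>x. x \<bullet> v)"
proof (cases k)
  case (Suc j)
  then show ?thesis
    by (auto intro!: Ck_on_SucI[OF assms bounded_linear.has_derivative[OF bounded_linear_inner_left has_derivative_ident]]
        Ck_on_const assms simp del: Ck_on.simps(2))
qed (auto intro: continuous_intros)

lemma Ck_on_norm_square:
  fixes S :: "'a::euclidean_space set"
  assumes "open S" shows "Ck_on k S (\<lambda>x. x \<bullet> x)"
  by (subst euclidean_inner) (intro Ck_on_sum Ck_on_mult Ck_on_inner_left assms finite_Basis)

text \<open>In one real variable the derivative of h in direction v is v times the one in direction
  1. Each directional derivative of the composition is thus a product of one of f with h' composed
  with f; the induction runs on h', while f loses one order by \<open>Ck_on_Suc_imp\<close>.\<close>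

lemma Ck_on_compose:
  fixes h :: "real \<Rightarrow> real"
  assumes "open S" "open T" "Ck_on k T h" "Ck_on k S f" "\<And>x. x \<in> S \<Longrightarrow> f x \<in> T"
  shows "Ck_on k S (\<lambda>x. h (f x))"
  using assms(3,4)
proof (induction k arbitrary: h)
  case 0
  then show ?case using assms(5) continuous_on_compose2[of T h S f] by auto
next
  case (Suc k)
  have lin: "dir_deriv h v y = v * dir_deriv h 1 y" if "y \<in> T" for v y
    using linear_scale[OF linear_frechet_derivative, of h "at y" v 1] Suc.prems(1) that by auto
  have d: "((\<lambda>x. h (f x)) has_derivative (\<lambda>v. dir_deriv h (dir_deriv f v x) (f x))) (at x)" if "x \<in> S" for x
    using has_derivative_compose[OF Ck_on_has_derivative[OF Suc.prems(2) that] Ck_on_has_derivative[OF Suc.prems(1) assms(5)[OF that]]]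
    by simp
  have ck: "Ck_on k S (\<lambda>x. dir_deriv h 1 (f x))"
    by (rule Suc.IH) (use Suc.prems in \<open>auto intro: Ck_on_Suc_imp simp del: Ck_on.simps(2) simp: Ck_on.simps(2)[of k T h]\<close>)
  have "Ck_on k S (\<lambda>x. dir_deriv h (dir_deriv f v x) (f x))" for v
    by (rule Ck_on_cong[OF assms(1), of _ "\<lambda>x. dir_deriv f v x * dir_deriv h 1 (f x)"])
      (use Suc.prems ck assms in \<open>auto intro!: Ck_on_mult simp: lin[symmetric]\<close>)
  then show ?case by (intro Ck_on_SucI[OF assms(1) d])
qed

lemma Ck_on_SucI_real:
  fixes h :: "real \<Rightarrow> real"
  assumes "open T" "\<And>t. t \<in> T \<Longrightarrow> (h has_real_derivative h' t) (at t)" "Ck_on k T h'"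
  shows "Ck_on (Suc k) T h"
proof (rule Ck_on_SucI[OF assms(1)])
  show "(h has_derivative (\<lambda>v. v * h' x)) (at x)" if "x \<in> T" for x
    using assms(2)[OF that] by (simp add: has_field_derivative_def mult_commute_abs)
  show "Ck_on k T (\<lambda>x. v * h' x)" for v by (intro Ck_on_scale assms)
qed

lemma Ck_on_powr: "Ck_on k {0<..} (\<lambda>t::real. t powr b)"
proof (induction k arbitrary: b)
  case 0
  then show ?case by (auto intro!: continuous_intros)
next
  case (Suc k)
  show ?case
    by (rule Ck_on_SucI_real[where h' = "\<lambda>t. b * t powr (b - 1)"])
      (auto intro!: Ck_on_scale Suc derivative_eq_intros)
qed

lemma Ck_on_norm_powr: "Ck_on k (- {0}) (\<lambda>x::'a::euclidean_space. norm x powr a)"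
proof (rule Ck_on_cong)
  show "Ck_on k (- {0}) (\<lambda>x::'a. (x \<bullet> x) powr (a / 2))"
    by (rule Ck_on_compose[where T = "{0<..}"]) (auto intro: Ck_on_powr Ck_on_norm_square)
  show "(x \<bullet> x) powr (a / 2) = norm x powr a" if "x \<in> - {0}" for x :: 'a
    using powr_powr[of "norm x" 2 "a/2"] that by (simp add: dot_square_norm powr_realpow)
qed auto

section \<open>Truncated powers and a twice differentiable step\<close>

lemma DERIV_max_0_power:
  "((\<lambda>t::real. max 0 t ^ Suc (Suc n)) has_real_derivative real (Suc (Suc n)) * max 0 t ^ Suc n) (at t)"
proof -
  consider "t > 0" | "t < 0" | "t = 0" by linarith
  then show ?thesis
  proof cases
    case 1
    have "((\<lambda>t::real. t ^ Suc (Suc n)) has_real_derivative real (Suc (Suc n)) * t ^ Suc n) (at t)"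
      using DERIV_pow[of "Suc (Suc n)" t UNIV] by (simp del: power_Suc)
    then have "((\<lambda>t::real. t ^ Suc (Suc n)) has_real_derivative real (Suc (Suc n)) * max 0 t ^ Suc n) (at t)"
      using 1 by (simp del: power_Suc)
    then show ?thesis
      by (rule has_field_derivative_transform_within_open[where S = "{0<..}"])
        (use 1 in \<open>auto simp del: power_Suc\<close>)
  next
    case 2
    have "((\<lambda>_::real. 0) has_real_derivative real (Suc (Suc n)) * max 0 t ^ Suc n) (at t)"
      using 2 by (simp add: max_def)
    then show ?thesis
      by (rule has_field_derivative_transform_within_open[where S = "{..<0}"])
        (use 2 in \<open>auto simp: max_def\<close>)
  next
    case 3
    \<comment> \<open>At the kink the difference quotient itself is at most a positive power of
      |h|.\<close>
    have "((\<lambda>h::real. max 0 h ^ Suc (Suc n) / h) \<longlongrightarrow> 0) (at 0)"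
    proof (rule Lim_null_comparison)
      have "((\<lambda>h::real. \<bar>h\<bar> ^ Suc n) \<longlongrightarrow> \<bar>0\<bar> ^ Suc n) (at 0)" by (intro tendsto_intros)
      then show "((\<lambda>h::real. \<bar>h\<bar> ^ Suc n) \<longlongrightarrow> 0) (at 0)" by simp
      show "\<forall>\<^sub>F h::real in at 0. norm (max 0 h ^ Suc (Suc n) / h) \<le> \<bar>h\<bar> ^ Suc n"
        by (rule always_eventually) (auto simp: max_def field_simps mult_nonpos_nonneg)
    qed
    then show ?thesis using 3 by (simp add: DERIV_def)
  qed
qed

lemma Ck_on_max_0_power: "Ck_on k UNIV (\<lambda>t::real. max 0 t ^ Suc k)"
proof (induction k)
  case (Suc k)
  show ?case
    by (rule Ck_on_SucI_real[OF open_UNIV DERIV_max_0_power]) (rule Ck_on_scale[OF open_UNIV Suc])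
qed (auto intro!: continuous_intros)

text \<open>Composing two truncated cubes gives a \<open>C\<^sup>2\<close> step without any gluing.\<close>

definition smooth_step :: "real \<Rightarrow> real" where
  "smooth_step t = 1 - max 0 (1 - max 0 t ^ 3) ^ 3"

definition smooth_step' :: "real \<Rightarrow> real" where
  "smooth_step' t = 9 * max 0 (1 - max 0 t ^ 3) ^ 2 * max 0 t ^ 2"

lemma DERIV_smooth_step: "(smooth_step has_real_derivative smooth_step' t) (at t)"
proof -
  have d: "((\<lambda>t::real. max 0 t ^ 3) has_real_derivative 3 * max 0 t ^ 2) (at t)" for t
    using DERIV_max_0_power[of 1 t] by (simp add: numeral_eq_Suc)
  have "((\<lambda>t. 1 - max 0 (1 - max 0 t ^ 3) ^ 3) has_real_derivative
      0 - (3 * max 0 (1 - max 0 t ^ 3) ^ 2) * (0 - 3 * max 0 t ^ 2)) (at t)"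
    by (intro DERIV_diff DERIV_const DERIV_chain2[OF d] d)
  then show ?thesis by (simp add: smooth_step_def[abs_def] smooth_step'_def algebra_simps)
qed

lemma Ck_on_smooth_step: "Ck_on 2 UNIV smooth_step"
proof -
  have p: "Ck_on 2 UNIV (\<lambda>t::real. max 0 t ^ 3)"
    using Ck_on_max_0_power[of 2] by (simp add: numeral_eq_Suc del: Ck_on.simps(2))
  have 1: "Ck_on 2 UNIV (\<lambda>t::real. 1 - max 0 t ^ 3)"
    by (intro Ck_on_diff Ck_on_const p) auto
  show ?thesis unfolding smooth_step_def[abs_def]
    by (intro Ck_on_diff Ck_on_const Ck_on_compose[OF _ _ p 1]) auto
qed

lemma smooth_step_bounds: "0 \<le> smooth_step t" "smooth_step t \<le> 1"
proof -
  have "max 0 (1 - max 0 t ^ 3) ^ 3 \<le> 1 ^ 3" by (rule power_mono) auto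
  then show "0 \<le> smooth_step t" by (simp add: smooth_step_def)
qed (simp add: smooth_step_def)

lemma smooth_step_eq_0: "t \<le> 0 \<Longrightarrow> smooth_step t = 0"
  by (simp add: smooth_step_def max_def)

lemma smooth_step_eq_1:
  assumes "1 \<le> t" shows "smooth_step t = 1"
proof -
  have "max 0 t = t" "max 0 (1 - t ^ 3) = 0" using assms one_le_power[OF assms, of 3] by auto
  then show ?thesis unfolding smooth_step_def by simp
qed

lemma smooth_step'_nonneg: "0 \<le> smooth_step' t"
  by (simp add: smooth_step'_def)

lemma smooth_step'_eq_0:
  assumes "t \<le> 0 \<or> 1 \<le> t" shows "smooth_step' t = 0"
proof (cases "t \<le> 0")
  case False
  then have "1 \<le> t" using assms by simp
  then have "max 0 t = t" "max 0 (1 - t ^ 3) = 0" using one_le_power[of t 3] by auto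
  then show ?thesis unfolding smooth_step'_def by simp
qed (simp add: smooth_step'_def)

text \<open>On the unit interval both squares are at most 1. The bound 9 returns as its root 3 in
  the Cauchy-Schwarz splitting of \<open>level_decay\<close> and in 36 = 9 * 4 in the gradient bound
  for \<open>cutoff\<close>.\<close>

lemma smooth_step'_le: "smooth_step' t \<le> 9"
proof (cases "t \<le> 0 \<or> 1 \<le> t")
  case False
  have "max 0 (1 - max 0 t ^ 3) ^ 2 \<le> 1 ^ 2" by (rule power_mono) auto
  moreover have "max 0 t ^ 2 \<le> 1 ^ 2" by (rule power_mono) (use False in auto)
  ultimately have "max 0 (1 - max 0 t ^ 3) ^ 2 * max 0 t ^ 2 \<le> 1 * 1"
    by (intro mult_mono) auto
  then show ?thesis by (simp add: smooth_step'_def)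
qed (simp add: smooth_step'_eq_0)

lemma continuous_on_smooth_step': "continuous_on S smooth_step'"
  unfolding smooth_step'_def[abs_def] by (intro continuous_intros)

section \<open>Translations, level sets and the weight\<close>

lemma nn_integral_lborel_translate:
  fixes f :: "'a::euclidean_space \<Rightarrow> ennreal"
  assumes "f \<in> borel_measurable borel"
  shows "(\<integral>\<^sup>+x. f (x + a) \<partial>lborel) = (\<integral>\<^sup>+x. f x \<partial>lborel)"
  using nn_integral_distr[of "(+) a" lborel borel f] assms by (simp add: lborel_distr_plus add.commute)

lemma integral_lborel_translate:
  fixes f :: "'a::euclidean_space \<Rightarrow> real"
  assumes "f \<in> borel_measurable borel"
  shows "(\<integral>x. f (x + a) \<partial>lborel) = (\<integral>x. f x \<partial>lborel)"
  using integral_distr[of "(+) a" lborel borel f] assms by (simp add: lborel_distr_plus add.commute)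

lemma integrable_continuous_bounded_support:
  fixes f :: "'a::euclidean_space \<Rightarrow> real"
  assumes "continuous_on UNIV f" "\<And>x. R \<le> norm x \<Longrightarrow> f x = 0"
  shows "integrable lborel f"
proof -
  have "integrable lborel (\<lambda>x. indicator (cball 0 R) x *\<^sub>R f x)"
    using borel_integrable_compact[OF compact_cball continuous_on_subset[OF assms(1)]] by auto
  moreover have "indicator (cball 0 R) x *\<^sub>R f x = f x" for x
    using assms(2)[of x] by (cases "norm x \<le> R") (auto simp: indicator_def)
  ultimately show ?thesis by (simp only:)
qed

lemma bounded_continuous_bounded_support:
  fixes f :: "'a::euclidean_space \<Rightarrow> real"
  assumes "continuous_on UNIV f" "\<And>x. R \<le> norm x \<Longrightarrow> f x = 0"
  obtains M where "0 < M" "\<And>x. \<bar>f x\<bar> \<le> M"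
proof -
  have "bounded (f ` cball 0 R)"
    by (intro compact_imp_bounded compact_continuous_image continuous_on_subset[OF assms(1)]) auto
  then obtain M where M: "0 < M" "\<And>x. x \<in> cball 0 R \<Longrightarrow> \<bar>f x\<bar> \<le> M"
    unfolding bounded_pos by auto
  have "\<bar>f x\<bar> \<le> M" for x
    using M assms(2)[of x] by (cases "norm x \<le> R") auto
  then show thesis using M(1) that by blast
qed

section \<open>Derivatives along lines and integration over the whole space\<close>

lemma dir_deriv_scale:
  "f differentiable (at x) \<Longrightarrow> dir_deriv f (c *\<^sub>R v) x = c * dir_deriv f v x"
  by (metis linear_frechet_derivative linear_scale real_scaleR_def)

lemma dir_deriv_eq_0_on_open:
  assumes "open S" "\<And>y. y \<in> S \<Longrightarrow> f y = 0" "x \<in> S"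
  shows "dir_deriv f v x = 0"
proof -
  have "(f has_derivative (\<lambda>_. 0)) (at x)"
    using assms(2) by (intro has_derivative_transform_within_open[OF has_derivative_const[of 0] assms(1,3)]) simp
  then show ?thesis by (simp add: dir_deriv_eq)
qed

lemma open_norm_greater: "open {x::'a::euclidean_space. R < norm x}"
  by (intro open_Collect_less continuous_intros)

lemma dir_deriv_eq_0_outside:
  fixes f :: "'a::euclidean_space \<Rightarrow> real"
  shows "(\<And>x. R < norm x \<Longrightarrow> f x = 0) \<Longrightarrow> R < norm x \<Longrightarrow> dir_deriv f v x = 0"
  by (rule dir_deriv_eq_0_on_open[OF open_norm_greater]) auto

lemma DERIV_along_line:
  assumes "Ck_on (Suc k) UNIV f"
  shows "((\<lambda>t. f (x + t *\<^sub>R v)) has_real_derivative dir_deriv f v (x + t *\<^sub>R v)) (at t)"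
proof -
  have "((\<lambda>t. x + t *\<^sub>R v) has_derivative (\<lambda>s. s *\<^sub>R v)) (at t)"
    by (auto intro!: derivative_eq_intros)
  from has_derivative_compose[OF this Ck_on_has_derivative[OF assms]]
  have "((\<lambda>t. f (x + t *\<^sub>R v)) has_derivative (\<lambda>s. dir_deriv f (s *\<^sub>R v) (x + t *\<^sub>R v))) (at t)"
    by simp
  then show ?thesis
    using assms by (simp add: has_field_derivative_def dir_deriv_scale mult.commute[of _ "dir_deriv f v _"])
qed

lemma Ck_on_1_dir_deriv_continuous:
  "Ck_on (Suc k) S f \<Longrightarrow> continuous_on S (dir_deriv f v)"
  by (rule Ck_on_imp_continuous_on[OF Ck_on_dir_deriv])

text \<open>Differentiating the translation invariance of Lebesgue measure replaces a Fubini argument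
  in the coordinate directions.\<close>

lemma integral_dir_deriv_eq_0:
  fixes f :: "'a::euclidean_space \<Rightarrow> real"
  assumes f: "Ck_on 1 UNIV f" and supp: "\<And>x. R \<le> norm x \<Longrightarrow> f x = 0"
  shows "(\<integral>x. dir_deriv f v x \<partial>lborel) = 0"
proof -
  have f1: "Ck_on (Suc 0) UNIV f" using f by simp
  note contD = Ck_on_1_dir_deriv_continuous[OF f1, of v]
  have contf: "continuous_on UNIV f" using f Ck_on_imp_continuous_on by blast
  have [measurable]: "f \<in> borel_measurable borel" "dir_deriv f v \<in> borel_measurable borel"
    using contf contD by (auto intro: borel_measurable_continuous_onI)
  \<comment> \<open>Vanishing passes from f to its derivative on open sets. Enlarging the radius by
    1 turns the open exterior into the closed one that the boundedness lemma expects.\<close>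
  have "dir_deriv f v x = 0" if "R + 1 \<le> norm x" for x
    by (rule dir_deriv_eq_0_outside[of R]) (use supp that in auto)
  then obtain M where M: "0 < M" "\<And>x. \<bar>dir_deriv f v x\<bar> \<le> M"
    using bounded_continuous_bounded_support[OF contD] by metis
  define q where "q n x = real (Suc n) * (f (x + inverse (real (Suc n)) *\<^sub>R v) - f x)" for n x
  have [measurable]: "q n \<in> borel_measurable borel" for n
    unfolding q_def by measurable
  \<comment> \<open>By the mean value theorem each difference quotient is a value of the derivative,
    hence bounded by M for all n at once. The increments are at most as long as v, which fixes the
    support of the dominating function \<open>?w\<close>.\<close>
  have q_eq: "\<exists>s. q n x = dir_deriv f v (x + s *\<^sub>R v)" for n x
  proof -
    obtain s where "f (x + inverse (real (Suc n)) *\<^sub>R v) - f (x + 0 *\<^sub>R v)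
        = (inverse (real (Suc n)) - 0) * dir_deriv f v (x + s *\<^sub>R v)"
      using MVT2[OF _ DERIV_along_line[OF f1], of 0 "inverse (real (Suc n))"] by auto
    then show ?thesis by (auto simp: q_def intro!: exI[of _ s])
  qed
  let ?w = "\<lambda>x::'a. M * indicator (cball 0 (R + norm v)) x"
  have bound: "norm (q n x) \<le> ?w x" for n x
  proof (cases "norm x \<le> R + norm v")
    case True
    then show ?thesis using q_eq[of n x] M(2) by auto
  next
    case False
    have "norm (inverse (real (Suc n)) *\<^sub>R v) \<le> 1 * norm v"
      unfolding norm_scaleR by (intro mult_right_mono) (auto simp: field_simps)
    with False have "R \<le> norm (x + inverse (real (Suc n)) *\<^sub>R v)"
      using norm_triangle_ineq2[of x "- (inverse (real (Suc n)) *\<^sub>R v)"] by simp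
    moreover have "R \<le> norm x" using False norm_ge_zero[of v] by linarith
    ultimately show ?thesis using False supp by (simp add: q_def)
  qed
  have lim: "(\<lambda>n. q n x) \<longlonglongrightarrow> dir_deriv f v x" for x
  proof -
    have "((\<lambda>h. (f (x + h *\<^sub>R v) - f x) / h) \<longlongrightarrow> dir_deriv f v x) (at 0)"
      using DERIV_along_line[OF f1, of x v 0] by (simp add: DERIV_def)
    moreover have "filterlim (\<lambda>n. inverse (real (Suc n))) (at 0) sequentially"
      using LIMSEQ_inverse_real_of_nat by (simp add: filterlim_at del: of_nat_Suc)
    ultimately have "(\<lambda>n. (f (x + inverse (real (Suc n)) *\<^sub>R v) - f x) / inverse (real (Suc n))) \<longlonglongrightarrow> dir_deriv f v x"
      by (rule filterlim_compose)
    then show ?thesis by (simp add: q_def field_simps)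
  qed
  have "(\<integral>x. q n x \<partial>lborel) = 0" for n
  proof -
    have "integrable lborel f" by (rule integrable_continuous_bounded_support[OF contf supp])
    moreover have "integrable lborel (\<lambda>x. f (x + inverse (real (Suc n)) *\<^sub>R v))"
    proof (rule integrable_continuous_bounded_support[where R = "R + norm (inverse (real (Suc n)) *\<^sub>R v)"])
      show "continuous_on UNIV (\<lambda>x. f (x + inverse (real (Suc n)) *\<^sub>R v))"
        by (rule continuous_on_compose2[OF contf]) (auto intro!: continuous_intros)
      fix x :: 'a assume "R + norm (inverse (real (Suc n)) *\<^sub>R v) \<le> norm x"
      then show "f (x + inverse (real (Suc n)) *\<^sub>R v) = 0"
        using norm_triangle_ineq2[of x "- (inverse (real (Suc n)) *\<^sub>R v)"] by (intro supp) simp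
    qed
    ultimately show ?thesis
      unfolding q_def using integral_lborel_translate[of f] by (simp add: Bochner_Integration.integral_diff)
  qed
  moreover have "(\<lambda>n. \<integral>x. q n x \<partial>lborel) \<longlonglongrightarrow> (\<integral>x. dir_deriv f v x \<partial>lborel)"
  proof (rule integral_dominated_convergence[where w = ?w])
    show "integrable lborel ?w"
      using emeasure_lborel_cball_finite by (intro integrable_mult_right integrable_real_indicator) auto
    show "AE x in lborel. norm (q n x) \<le> ?w x" for n using bound by (intro AE_I2)
  qed (auto intro!: lim)
  ultimately show ?thesis by (simp add: LIMSEQ_const_iff)
qed

text \<open>The increment is at most the integral of |D_h f| along the segment from x to x + h.
  After exchanging the integrals, each inner integral over x equals the right-hand side by
  translation invariance.\<close>

lemma nn_integral_displacement_le:
  fixes f :: "'a::euclidean_space \<Rightarrow> real"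
  assumes f: "Ck_on 1 UNIV f"
  shows "(\<integral>\<^sup>+x. ennreal \<bar>f (x + h) - f x\<bar> \<partial>lborel) \<le> (\<integral>\<^sup>+x. ennreal \<bar>dir_deriv f h x\<bar> \<partial>lborel)"
proof -
  have f1: "Ck_on (Suc 0) UNIV f" using f by simp
  note contD = Ck_on_1_dir_deriv_continuous[OF f1, of h]
  have [measurable]: "dir_deriv f h \<in> borel_measurable borel"
    using contD by (auto intro: borel_measurable_continuous_onI)
  let ?g = "\<lambda>x t. ennreal \<bar>dir_deriv f h (x + t *\<^sub>R h) * indicator {0..1} t\<bar>"
  have "ennreal \<bar>f (x + h) - f x\<bar> \<le> (\<integral>\<^sup>+t. ?g x t \<partial>lborel)" for x
  proof -
    have c: "continuous_on UNIV (\<lambda>t. dir_deriv f h (x + t *\<^sub>R h))"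
      by (rule continuous_on_compose2[OF contD]) (auto intro!: continuous_intros)
    have "has_bochner_integral lborel (\<lambda>t. dir_deriv f h (x + t *\<^sub>R h) * indicator {0..1} t)
        (f (x + 1 *\<^sub>R h) - f (x + 0 *\<^sub>R h))"
      by (rule has_bochner_integral_FTC_Icc_real[OF _ DERIV_along_line[OF f1]])
        (use c in \<open>auto simp: continuous_on_eq_continuous_at\<close>)
    then show ?thesis
      using integral_norm_bound_ennreal[of lborel "\<lambda>t. dir_deriv f h (x + t *\<^sub>R h) * indicator {0..1} t"]
      by (simp add: has_bochner_integral_iff)
  qed
  then have "(\<integral>\<^sup>+x. ennreal \<bar>f (x + h) - f x\<bar> \<partial>lborel) \<le> (\<integral>\<^sup>+x. \<integral>\<^sup>+t. ?g x t \<partial>lborel \<partial>lborel)"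
    by (intro nn_integral_mono) auto
  also have "\<dots> = (\<integral>\<^sup>+t. \<integral>\<^sup>+x. ?g x t \<partial>lborel \<partial>lborel)"
    by (rule lborel_pair.Fubini'[symmetric]) measurable
  also have "\<dots> = (\<integral>\<^sup>+t. (\<integral>\<^sup>+x. ennreal \<bar>dir_deriv f h x\<bar> \<partial>lborel) * indicator {0..1::real} t \<partial>lborel)"
  proof (rule nn_integral_cong)
    fix t :: real
    show "(\<integral>\<^sup>+x. ?g x t \<partial>lborel) = (\<integral>\<^sup>+x. ennreal \<bar>dir_deriv f h x\<bar> \<partial>lborel) * indicator {0..1} t"
      using nn_integral_lborel_translate[of "\<lambda>x. ennreal \<bar>dir_deriv f h x\<bar>" "t *\<^sub>R h"]
      by (auto simp: indicator_def)
  qed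
  also have "\<dots> = (\<integral>\<^sup>+x. ennreal \<bar>dir_deriv f h x\<bar> \<partial>lborel)"
    by (subst nn_integral_cmult) auto
  finally show ?thesis .
qed

text \<open>The displacement |f(x + h) - f(x)| is integrated over x and over h in the ball. For
  fixed x in E half of the ball contributes M; for fixed h the integral over x is bounded by
  \<open>nn_integral_displacement_le\<close>. The volume of the ball cancels and only its radius r
  remains.\<close>

lemma level_set_isoperimetric:
  fixes f :: "'a::euclidean_space \<Rightarrow> real"
  assumes f: "Ck_on 1 UNIV f" "\<And>x. 0 \<le> f x" "\<And>x. f x \<le> M" "0 < M"
    and F: "F \<in> sets borel" "\<And>x. f x \<noteq> 0 \<Longrightarrow> x \<in> F"
    and E: "E \<in> sets borel" "\<And>x. x \<in> E \<Longrightarrow> f x = M"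
    and r: "0 < r" "2 * emeasure lborel F \<le> emeasure lborel (ball (0::'a) r)"
    and g: "g \<in> borel_measurable borel" "\<And>x. 0 \<le> g x" "\<And>x h. \<bar>dir_deriv f h x\<bar> \<le> norm h * g x"
  shows "ennreal (M / 2) * emeasure lborel E \<le> ennreal r * (\<integral>\<^sup>+x. g x \<partial>lborel)"
proof -
  let ?B = "ball (0::'a) r"
  have contf: "continuous_on UNIV f" using f Ck_on_imp_continuous_on by blast
  note [measurable] = borel_measurable_continuous_onI[OF contf] F(1) E(1) g(1)
  have [measurable]: "?B \<in> sets borel" by simp
  have B: "emeasure lborel ?B \<noteq> 0" "emeasure lborel ?B < \<infinity>"
    using r(1) emeasure_lborel_ball_finite unit_ball_vol_pos[of "real DIM('a)"]
    by (auto simp: emeasure_ball simp del: unit_ball_vol_pos)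
  obtain b where b: "emeasure lborel ?B = ennreal b" "0 \<le> b"
    using B(2) by (cases "emeasure lborel ?B") auto
  have b2: "emeasure lborel ?B / 2 = ennreal (b / 2)"
    using divide_ennreal[OF b(2), of 2] b(1) by simp
  have F_half: "emeasure lborel F \<le> emeasure lborel ?B / 2"
  proof -
    have "2 * emeasure lborel F / 2 \<le> emeasure lborel ?B / 2" by (rule divide_right_mono_ennreal[OF r(2)])
    then show ?thesis by (simp add: mult.commute[of 2] mult_divide_eq_ennreal)
  qed
  \<comment> \<open>At least half of all translates of a point of \<open>E\<close> leave \<open>F\<close>, where \<open>f\<close> drops from \<open>M\<close> to \<open>0\<close>.\<close>
  have lower: "ennreal (M / 2) * emeasure lborel ?B \<le> (\<integral>\<^sup>+h. ennreal \<bar>f (x + h) - f x\<bar> * indicator ?B h \<partial>lborel)"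
    if x: "x \<in> E" for x
  proof -
    let ?A = "?B - {h. h + x \<in> F}"
    have [measurable]: "{h. h + x \<in> F} \<in> sets borel"
      using measurable_sets[of "\<lambda>h. h + x" borel borel F] by (simp add: vimage_def)
    have "emeasure lborel {h. h + x \<in> F} = (\<integral>\<^sup>+h. indicator F (h + x) \<partial>lborel)"
      using nn_integral_indicator[of "{h. h + x \<in> F}" lborel]
      unfolding indicator_def by simp
    also have "\<dots> = emeasure lborel F"
      by (subst nn_integral_lborel_translate) auto
    finally have eF: "emeasure lborel {h. h + x \<in> F} = emeasure lborel F" .
    have "emeasure lborel ?B \<le> emeasure lborel (?A \<union> {h. h + x \<in> F})"
      by (intro emeasure_mono) auto
    also have "\<dots> \<le> emeasure lborel ?A + emeasure lborel {h. h + x \<in> F}"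
      by (intro emeasure_subadditive) auto
    also have "\<dots> \<le> emeasure lborel ?A + emeasure lborel ?B / 2"
      unfolding eF by (intro add_left_mono F_half)
    finally have half: "emeasure lborel ?B / 2 \<le> emeasure lborel ?A"
      unfolding b2 unfolding b(1)
    proof (cases "emeasure lborel ?A")
      case (real a)
      assume "ennreal b \<le> emeasure lborel ?A + ennreal (b / 2)"
      then have "b \<le> a + b / 2" using real b(2) by (simp flip: ennreal_plus)
      then show "ennreal (b / 2) \<le> emeasure lborel ?A" using real by (simp add: ennreal_leI)
    qed simp
    have "ennreal (M / 2) * emeasure lborel ?B = ennreal M * (emeasure lborel ?B / 2)"
      unfolding b2 unfolding b(1) using f(4) b(2) by (simp flip: ennreal_mult)
    also have "\<dots> \<le> ennreal M * emeasure lborel ?A"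
      by (intro mult_left_mono half) simp
    also have "\<dots> = (\<integral>\<^sup>+h. ennreal M * indicator ?A h \<partial>lborel)"
      by (subst nn_integral_cmult_indicator) auto
    also have "\<dots> \<le> (\<integral>\<^sup>+h. ennreal \<bar>f (x + h) - f x\<bar> * indicator ?B h \<partial>lborel)"
    proof (rule nn_integral_mono)
      fix h
      show "ennreal M * indicator ?A h \<le> ennreal \<bar>f (x + h) - f x\<bar> * indicator ?B h"
      proof (cases "h \<in> ?A")
        case True
        then have "f (x + h) = 0" using F(2)[of "x + h"] by (auto simp: add.commute)
        then show ?thesis using True E(2)[OF x] f(4) by simp
      qed simp
    qed
    finally show ?thesis .
  qed
  have "(ennreal (M / 2) * emeasure lborel E) * emeasure lborel ?B
      = (\<integral>\<^sup>+x. ennreal (M / 2) * emeasure lborel ?B * indicator E x \<partial>lborel)"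
    by (subst nn_integral_cmult_indicator) (auto simp: mult_ac)
  also have "\<dots> \<le> (\<integral>\<^sup>+x. \<integral>\<^sup>+h. ennreal \<bar>f (x + h) - f x\<bar> * indicator ?B h \<partial>lborel \<partial>lborel)"
    by (intro nn_integral_mono) (use lower in \<open>auto simp: indicator_def\<close>)
  also have "\<dots> = (\<integral>\<^sup>+h. \<integral>\<^sup>+x. ennreal \<bar>f (x + h) - f x\<bar> * indicator ?B h \<partial>lborel \<partial>lborel)"
    by (rule lborel_pair.Fubini'[symmetric]) measurable
  also have "\<dots> \<le> (\<integral>\<^sup>+h. ennreal r * (\<integral>\<^sup>+x. g x \<partial>lborel) * indicator ?B h \<partial>lborel)"
  proof (rule nn_integral_mono)
    fix h :: 'a
    have "(\<integral>\<^sup>+x. ennreal \<bar>f (x + h) - f x\<bar> \<partial>lborel) \<le> ennreal r * (\<integral>\<^sup>+x. g x \<partial>lborel)" if "h \<in> ?B"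
    proof -
      have "(\<integral>\<^sup>+x. ennreal \<bar>f (x + h) - f x\<bar> \<partial>lborel) \<le> (\<integral>\<^sup>+x. ennreal \<bar>dir_deriv f h x\<bar> \<partial>lborel)"
        by (rule nn_integral_displacement_le[OF f(1)])
      also have "\<dots> \<le> (\<integral>\<^sup>+x. ennreal r * ennreal (g x) \<partial>lborel)"
      proof (rule nn_integral_mono)
        fix x
        have "\<bar>dir_deriv f h x\<bar> \<le> r * g x"
          using g(3)[of x h] mult_right_mono[of "norm h" r "g x"] g(2)[of x] that by auto
        then show "ennreal \<bar>dir_deriv f h x\<bar> \<le> ennreal r * ennreal (g x)"
          using r(1) g(2) by (simp flip: ennreal_mult)
      qed
      finally show ?thesis by (subst (asm) nn_integral_cmult) auto
    qed
    then show "(\<integral>\<^sup>+x. ennreal \<bar>f (x + h) - f x\<bar> * indicator ?B h \<partial>lborel)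
        \<le> ennreal r * (\<integral>\<^sup>+x. g x \<partial>lborel) * indicator ?B h"
      by (auto simp: indicator_def)
  qed
  also have "\<dots> = ennreal r * (\<integral>\<^sup>+x. g x \<partial>lborel) * emeasure lborel ?B"
    by (subst nn_integral_cmult_indicator) auto
  finally show ?thesis
    using B by (simp add: ennreal_mult_le_mult_iff mult.commute[of _ "emeasure lborel ?B"])
qed

text \<open>F is split by a ball of comparable volume. Outside it the weight is at most its value on
  the boundary; inside, dyadic shells give a geometric series, convergent because \<alpha> is below
  the dimension. Both parts scale like the same power of |F|.\<close>

lemma nn_integral_norm_powr_le:
  fixes \<alpha> :: real
  assumes "0 < \<alpha>" "\<alpha> < DIM('a::euclidean_space)"
  obtains K where "0 < K" "\<And>F::'a set. F \<in> sets borel \<Longrightarrow> emeasure lborel F < \<infinity> \<Longrightarrow>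
     (\<integral>\<^sup>+x. ennreal (norm x powr (- \<alpha>)) * indicator F x \<partial>lborel)
       \<le> ennreal (K * measure lborel F powr (1 - \<alpha> / DIM('a)))"
proof -
  let ?N = "real DIM('a)"
  define q where "q = 2 powr (\<alpha> - ?N)"
  have q: "0 < q" "q < 1" unfolding q_def using assms by (auto simp: powr_less_one)
  define V where "V = unit_ball_vol ?N"
  have V: "0 < V" by (simp add: V_def)
  define K1 where "K1 = 2 powr \<alpha> * V * (1 / (1 - q))"
  have K1: "0 < K1" using q V by (simp add: K1_def)
  have ballint: "(\<integral>\<^sup>+x. ennreal (norm x powr (- \<alpha>)) * indicator (ball (0::'a) R) x \<partial>lborel)
      \<le> ennreal (K1 * R powr (?N - \<alpha>))" if R: "0 < R" for R
  proof -
    \<comment> \<open>On the shell between the radii R / 2^(j+1) and R / 2^j the weight is at most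
      its value at the inner radius. Using the indicator of the whole ball instead of the shell
      costs only a constant.\<close>
    let ?h = "\<lambda>j x. ennreal ((R * (1/2) ^ Suc j) powr (- \<alpha>)) * indicator (cball (0::'a) (R * (1/2) ^ j)) x"
    have meas: "(\<lambda>x. ?h j x) \<in> borel_measurable lborel" for j
      by (intro borel_measurable_times_ennreal borel_measurable_const borel_measurable_indicator) simp
    have "(\<integral>\<^sup>+x. ennreal (norm x powr (- \<alpha>)) * indicator (ball (0::'a) R) x \<partial>lborel)
        \<le> (\<integral>\<^sup>+x. (\<Sum>j. ?h j x) \<partial>lborel)"
    proof (rule nn_integral_mono)
      fix x :: 'a
      show "ennreal (norm x powr (- \<alpha>)) * indicator (ball (0::'a) R) x \<le> (\<Sum>j. ?h j x)"
      \<comment> \<open>At the origin \<open>powr\<close> has base 0 and returns 0, so the singular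
        point contributes nothing to the left side.\<close>
      proof (cases "x \<noteq> 0 \<and> norm x < R")
        case True
        have ex: "\<exists>n. R * (1/2) ^ n < norm x"
          using real_arch_pow_inv[of "norm x / R" "1/2"] R True by (auto simp: field_simps)
        \<comment> \<open>The least n is positive because |x| < R, and its predecessor j is the
          index of the shell containing x.\<close>
        define n where "n = (LEAST n. R * (1/2) ^ n < norm x)"
        have n: "R * (1/2) ^ n < norm x" unfolding n_def by (rule LeastI_ex[OF ex])
        then obtain j where j: "n = Suc j" using True by (cases n) auto
        have "\<not> R * (1/2) ^ j < norm x" using not_less_Least[of j "\<lambda>n. R * (1/2) ^ n < norm x"] j n_def by auto
        then have "ennreal (norm x powr (- \<alpha>)) \<le> ?h j x"
          using n j R assms by (auto simp: intro!: ennreal_leI powr_mono2')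
        also have "\<dots> \<le> (\<Sum>j. ?h j x)"
        proof -
          define H where "H j = ?h j x" for j
          have "H j \<le> suminf H" using sum_le_suminf[of H "{j}"] by simp
          then show ?thesis by (simp add: H_def[abs_def])
        qed
        finally show ?thesis using True by simp
      qed (auto simp: indicator_def)
    qed
    also have "\<dots> = (\<Sum>j. \<integral>\<^sup>+x. ?h j x \<partial>lborel)" by (rule nn_integral_suminf[OF meas])
    also have "\<dots> = (\<Sum>j. ennreal (2 powr \<alpha> * V * R powr (?N - \<alpha>) * q ^ j))"
    proof (rule suminf_cong)
      fix j
      have half_power: "(1/2::real) ^ k = 2 powr (- real k)" for k
        by (simp add: powr_minus powr_realpow power_divide inverse_eq_divide)
      have R': "R * (1/2) ^ Suc j = R * 2 powr (- real (Suc j))" "R * (1/2) ^ j = R * 2 powr (- real j)"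
        by (simp_all only: half_power)
      have "(\<integral>\<^sup>+x. ?h j x \<partial>lborel)
          = ennreal ((R * (1/2) ^ Suc j) powr (- \<alpha>)) * ennreal (V * (R * (1/2) ^ j) ^ DIM('a))"
        using R by (subst nn_integral_cmult_indicator) (auto simp: emeasure_cball V_def)
      also have "\<dots> = ennreal ((R * 2 powr (- real (Suc j))) powr (- \<alpha>) * (V * (R * 2 powr (- real j)) powr ?N))"
        unfolding R' using R V by (subst powr_realpow) (simp_all add: ennreal_mult del: of_nat_Suc)
      also have "(R * 2 powr (- real (Suc j))) powr (- \<alpha>) * (V * (R * 2 powr (- real j)) powr ?N)
          = V * (R powr (- \<alpha>) * R powr ?N) * (2 powr (\<alpha> * real (Suc j)) * 2 powr (- real j * ?N))"
        using R by (simp add: powr_mult powr_powr algebra_simps)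
      also have "\<dots> = V * R powr (?N - \<alpha>) * 2 powr (\<alpha> + (\<alpha> - ?N) * real j)"
        by (simp add: powr_add[symmetric] algebra_simps)
      also have "\<dots> = 2 powr \<alpha> * V * R powr (?N - \<alpha>) * q ^ j"
        using powr_power[of 2 "\<alpha> - ?N" j] unfolding q_def by (simp add: powr_add mult.commute)
      finally show "(\<integral>\<^sup>+x. ?h j x \<partial>lborel) = ennreal (2 powr \<alpha> * V * R powr (?N - \<alpha>) * q ^ j)" .
    qed
    also have "\<dots> = ennreal (2 powr \<alpha> * V * R powr (?N - \<alpha>) * (1 / (1 - q)))"
      using q V by (intro suminf_ennreal_eq sums_mult geometric_sums) auto
    also have "2 powr \<alpha> * V * R powr (?N - \<alpha>) * (1 / (1 - q)) = K1 * R powr (?N - \<alpha>)"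
      by (simp add: K1_def)
    finally show ?thesis .
  qed
  show thesis
  proof (rule that[of "K1 + 1"])
    fix F :: "'a set" assume [measurable]: "F \<in> sets borel" and fin: "emeasure lborel F < \<infinity>"
    let ?m = "measure lborel F"
    have em: "emeasure lborel F = ennreal ?m" using fin by (simp add: emeasure_eq_ennreal_measure)
    show "(\<integral>\<^sup>+x. ennreal (norm x powr (- \<alpha>)) * indicator F x \<partial>lborel)
       \<le> ennreal ((K1 + 1) * ?m powr (1 - \<alpha> / ?N))"
    proof (cases "?m = 0")
      case True
      then have "AE x in lborel. x \<notin> F" using em by (intro AE_not_in) (simp add: null_sets_def)
      then have "(\<integral>\<^sup>+x. ennreal (norm x powr (- \<alpha>)) * indicator F x \<partial>lborel) = (\<integral>\<^sup>+x. 0 \<partial>(lborel::'a measure))"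
        by (intro nn_integral_cong_AE) (auto simp: indicator_def)
      then show ?thesis by simp
    next
      case False
      then have m: "0 < ?m" using measure_nonneg[of lborel F] by linarith
      \<comment> \<open>For this radius R to the power N - \<alpha> coincides with |F| times R to
        the power -\<alpha>, so the two parts add up to the constant K1 + 1.\<close>
      define R where "R = ?m powr (1 / ?N)"
      have [measurable]: "ball (0::'a) R \<in> sets borel" by simp
      have R: "0 < R" using m by (simp add: R_def)
      have "(\<integral>\<^sup>+x. ennreal (norm x powr (- \<alpha>)) * indicator F x \<partial>lborel)
          \<le> (\<integral>\<^sup>+x. ennreal (norm x powr (- \<alpha>)) * indicator (ball (0::'a) R) x
              + ennreal (R powr (- \<alpha>)) * indicator F x \<partial>lborel)"
        using R assms by (intro nn_integral_mono) (auto simp: indicator_def intro!: ennreal_leI powr_mono2')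
      also have "\<dots> = (\<integral>\<^sup>+x. ennreal (norm x powr (- \<alpha>)) * indicator (ball (0::'a) R) x \<partial>lborel)
           + ennreal (R powr (- \<alpha>)) * emeasure lborel F"
        by (subst nn_integral_add) (auto simp: nn_integral_cmult_indicator)
      also have "\<dots> \<le> ennreal (K1 * R powr (?N - \<alpha>)) + ennreal (R powr (- \<alpha>)) * ennreal ?m"
        using ballint[OF R] by (auto simp: em intro!: add_mono)
      also have "\<dots> = ennreal (K1 * R powr (?N - \<alpha>) + R powr (- \<alpha>) * ?m)"
        using K1 by (simp add: ennreal_mult ennreal_plus)
      also have "R powr (?N - \<alpha>) = ?m powr (1 - \<alpha> / ?N)"
        by (simp add: R_def powr_powr diff_divide_distrib)
      also have "R powr (- \<alpha>) * ?m = ?m powr (1 - \<alpha> / ?N)"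
        using m powr_mult_base[of ?m "- \<alpha> / ?N"] by (simp add: R_def powr_powr mult.commute)
      finally show ?thesis by (simp add: algebra_simps)
    qed
  qed (use K1 in simp)
qed

section \<open>The weighted divergence\<close>

lemma smooth_compact_support_iff:
  "u \<in> smooth_compact_support \<longleftrightarrow>
     (\<forall>k. Ck_on k UNIV u) \<and> (\<exists>R>0. \<forall>x. R \<le> norm x \<longrightarrow> u x = 0)"
proof -
  have "compact (closure {x. u x \<noteq> 0}) \<longleftrightarrow> (\<exists>R>0. \<forall>x. R \<le> norm x \<longrightarrow> u x = 0)"
  proof
    assume "compact (closure {x. u x \<noteq> 0})"
    then obtain R where R: "0 < R" "\<And>x. u x \<noteq> 0 \<Longrightarrow> norm x \<le> R"
      by (auto simp: bounded_pos)
    then have "u x = 0" if "R + 1 \<le> norm x" for x using that R(2)[of x] by fastforce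
    then show "\<exists>R>0. \<forall>x. R \<le> norm x \<longrightarrow> u x = 0" using R(1) by (intro exI[of _ "R + 1"]) auto
  next
    assume "\<exists>R>0. \<forall>x. R \<le> norm x \<longrightarrow> u x = 0"
    then have "bounded {x. u x \<noteq> 0}"
      unfolding bounded_iff by (metis (mono_tags, lifting) linear mem_Collect_eq)
    then show "compact (closure {x. u x \<noteq> 0})" by simp
  qed
  then show ?thesis
    unfolding smooth_compact_support_def
    using continuously_diff_imp_Ck_on Ck_on_imp_continuously_diff by blast
qed

lemma Ck_on_weighted_partial:
  fixes u :: "'a::euclidean_space \<Rightarrow> real"
  assumes "Ck_on (Suc k) (- {0}) u"
  shows "Ck_on k (- {0}) (\<lambda>y. norm y powr \<alpha> * dir_deriv u b y)"
  using assms by (intro Ck_on_mult Ck_on_norm_powr) auto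

text \<open>Off the origin the weighted field is a sum of differentiable coefficients times basis
  vectors, so its divergence is taken coefficient by coefficient. At 0 this reasoning breaks down,
  which is why later identities for \<open>wdiv\<close> hold almost everywhere.\<close>

lemma wdiv_eq:
  fixes u :: "'a::euclidean_space \<Rightarrow> real"
  assumes "Ck_on (Suc (Suc k)) (- {0}) u" "x \<noteq> 0"
  shows "wdiv \<alpha> u x = (\<Sum>b\<in>Basis. dir_deriv (\<lambda>y. norm y powr \<alpha> * dir_deriv u b y) b x)"
proof -
  define c where "c b y = norm y powr \<alpha> * dir_deriv u b y" for b y
  have c: "(c b has_derivative frechet_derivative (c b) (at x)) (at x)" for b
    unfolding c_def
    by (rule Ck_on_has_derivative[OF Ck_on_weighted_partial[OF assms(1)]]) (use assms(2) in auto)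
  have cb: "((\<lambda>y. c b y *\<^sub>R b) has_derivative (\<lambda>v. dir_deriv (c b) v x *\<^sub>R b)) (at x)" for b
    using has_derivative_scaleR_left[OF c[of b], of b] by simp
  have "((\<lambda>y. \<Sum>b\<in>Basis. c b y *\<^sub>R b) has_derivative
      (\<lambda>v. \<Sum>b\<in>Basis. dir_deriv (c b) v x *\<^sub>R b)) (at x)"
    by (rule has_derivative_sum[OF cb])
  moreover have "(\<lambda>y. norm y powr \<alpha> *\<^sub>R grad u y) = (\<lambda>y. \<Sum>b\<in>Basis. c b y *\<^sub>R b)"
    by (simp add: grad_def scaleR_sum_right c_def)
  ultimately have "frechet_derivative (\<lambda>y. norm y powr \<alpha> *\<^sub>R grad u y) (at x)
      = (\<lambda>v. \<Sum>b\<in>Basis. dir_deriv (c b) v x *\<^sub>R b)"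
    by (intro frechet_derivative_at[symmetric]) simp
  then show ?thesis by (simp add: wdiv_def divergence_def inner_sum_left_Basis c_def[abs_def])
qed

lemma Ck_on_wdiv:
  fixes u :: "'a::euclidean_space \<Rightarrow> real"
  assumes "Ck_on (Suc (Suc k)) (- {0}) u"
  shows "Ck_on k (- {0}) (wdiv \<alpha> u)"
proof (rule Ck_on_cong)
  show "Ck_on k (- {0}) (\<lambda>x. \<Sum>b\<in>Basis. dir_deriv (\<lambda>y. norm y powr \<alpha> * dir_deriv u b y) b x)"
    by (intro Ck_on_sum Ck_on_dir_deriv Ck_on_weighted_partial assms) auto
qed (use wdiv_eq[OF assms] in auto)

text \<open>Changing a function at one point preserves Borel measurability. This makes
  \<open>wdiv\<close> measurable whatever value it takes at the origin.\<close>

lemma borel_measurable_continuous_off_0: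
  fixes f :: "'a::euclidean_space \<Rightarrow> real"
  assumes "continuous_on (- {0}) f"
  shows "f \<in> borel_measurable borel"
proof -
  have "(\<lambda>x. indicator (- {0}) x *\<^sub>R f x) \<in> borel_measurable borel"
    by (rule borel_measurable_continuous_on_indicator[OF _ assms]) auto
  then have "(\<lambda>x. if x = 0 then f 0 else indicator (- {0}) x *\<^sub>R f x) \<in> borel_measurable borel"
    by measurable
  also have "(\<lambda>x. if x = 0 then f 0 else indicator (- {0}) x *\<^sub>R f x) = f"
    by auto
  finally show ?thesis .
qed

lemma borel_measurable_wdiv:
  "Ck_on (Suc (Suc k)) (- {0}) u \<Longrightarrow> wdiv \<alpha> u \<in> borel_measurable borel"
  using Ck_on_wdiv Ck_on_imp_continuous_on borel_measurable_continuous_off_0 by blast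

text \<open>A field that vanishes on a neighbourhood of x is differentiable at x, and this includes
  the origin. It provides the values of \<open>wdiv\<close> near 0 for truncated functions and
  outside supports.\<close>

lemma wdiv_eq_0_on_open:
  fixes u :: "'a::euclidean_space \<Rightarrow> real"
  assumes "open S" "\<And>y. y \<in> S \<Longrightarrow> u y = 0" "x \<in> S"
  shows "wdiv \<alpha> u x = 0"
proof -
  have "grad u y = 0" if "y \<in> S" for y
    using dir_deriv_eq_0_on_open[OF assms(1,2) that] by (simp add: grad_def)
  then have "((\<lambda>x. norm x powr \<alpha> *\<^sub>R grad u x) has_derivative (\<lambda>_. 0)) (at x)"
    by (intro has_derivative_transform_within_open[OF has_derivative_const[of 0] assms(1,3)]) simp
  then have "frechet_derivative (\<lambda>x. norm x powr \<alpha> *\<^sub>R grad u x) (at x) = (\<lambda>_. 0)"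
    by (rule frechet_derivative_at[symmetric])
  then show ?thesis by (simp add: wdiv_def divergence_def)
qed

abbreviation (input) div_energy :: "real \<Rightarrow> ('a::euclidean_space \<Rightarrow> real) \<Rightarrow> real" where
  "div_energy \<alpha> u \<equiv> \<integral>x. (wdiv \<alpha> u x)\<^sup>2 \<partial>lborel"

lemma test_space_iff:
  "u \<in> test_space \<alpha> \<longleftrightarrow> (\<forall>k. Ck_on k UNIV u) \<and> (\<exists>R>0. \<forall>x. R \<le> norm x \<longrightarrow> u x = 0) \<and>
     integrable lborel (\<lambda>x. (wdiv \<alpha> u x)\<^sup>2)"
  by (auto simp: test_space_def smooth_compact_support_iff)

lemma borel_measurable_test_space:
  assumes "u \<in> test_space \<alpha>"
  shows "u \<in> borel_measurable borel" "wdiv \<beta> u \<in> borel_measurable borel"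
proof -
  have u: "Ck_on (Suc (Suc 0)) UNIV u" using assms by (simp add: test_space_iff del: Ck_on.simps)
  show "u \<in> borel_measurable borel"
    by (rule borel_measurable_continuous_onI[OF Ck_on_imp_continuous_on[OF u]])
  show "wdiv \<beta> u \<in> borel_measurable borel"
    by (rule borel_measurable_wdiv[OF Ck_on_subset[OF u]]) simp
qed

section \<open>Gradients and the divergence theorem off the origin\<close>

lemma norm_grad_square: "(norm (grad u x))\<^sup>2 = (\<Sum>b\<in>Basis. (dir_deriv u b x)\<^sup>2)"
proof -
  have "grad u x \<bullet> b = dir_deriv u b x" if "b \<in> Basis" for b
    using that by (simp add: grad_def inner_sum_left_Basis)
  then show ?thesis
    unfolding power2_norm_eq_inner by (subst euclidean_inner) (simp add: power2_eq_square)
qed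

lemma dir_deriv_eq_grad_inner:
  fixes u :: "'a::euclidean_space \<Rightarrow> real"
  assumes "u differentiable (at x)"
  shows "dir_deriv u v x = grad u x \<bullet> v"
proof -
  have "dir_deriv u v x = dir_deriv u (\<Sum>b\<in>Basis. (v \<bullet> b) *\<^sub>R b) x"
    by (simp add: euclidean_representation)
  also have "\<dots> = (\<Sum>b\<in>Basis. (v \<bullet> b) * dir_deriv u b x)"
    using linear_frechet_derivative[OF assms] by (simp add: linear_sum linear_scale)
  finally show ?thesis
    by (simp add: grad_def inner_sum_left inner_commute[of v] mult.commute)
qed

text \<open>Off the origin the integrand is the divergence of \<zeta> times the weighted gradient of
  u. Vanishing near 0 is demanded of the product of \<zeta> with the derivatives of u, so that
  either factor may provide it; \<open>wdiv_symmetric\<close> uses both cases.\<close>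

lemma integral_div_eq_0:
  fixes u \<zeta> :: "'a::euclidean_space \<Rightarrow> real"
  assumes \<zeta>: "Ck_on 1 (- {0}) \<zeta>" and u: "Ck_on 2 (- {0}) u"
    and \<epsilon>: "0 < \<epsilon>" "\<And>x b. norm x < \<epsilon> \<Longrightarrow> \<zeta> x * dir_deriv u b x = 0"
    and R: "\<And>x. R \<le> norm x \<Longrightarrow> \<zeta> x = 0"
  shows "(\<integral>x. \<zeta> x * wdiv \<alpha> u x + norm x powr \<alpha> * (\<Sum>b\<in>Basis. dir_deriv \<zeta> b x * dir_deriv u b x) \<partial>lborel) = 0"
proof -
  let ?c = "\<lambda>b y. norm y powr \<alpha> * dir_deriv u b y"
  let ?F = "\<lambda>b y. \<zeta> y * ?c b y"
  have u2: "Ck_on (Suc (Suc 0)) (- {0}) u" using u by (simp only: numeral_2_eq_2)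
  have \<zeta>1: "Ck_on (Suc 0) (- {0}) \<zeta>" using \<zeta> by simp
  have c: "Ck_on (Suc 0) (- {0}) (?c b)" for b by (rule Ck_on_weighted_partial[OF u2])
  have F: "Ck_on 1 UNIV (?F b)" for b
  proof -
    have "Ck_on 1 (- {0}) (?F b)" using Ck_on_mult[OF _ \<zeta>1 c[of b]] by (simp del: Ck_on.simps add: open_Compl)
    moreover have "Ck_on 1 (ball 0 \<epsilon>) (?F b)"
      by (rule Ck_on_cong[OF _ Ck_on_const[of _ _ 0]]) (use \<epsilon>(2) in \<open>auto simp: mult.left_commute\<close>)
    ultimately have "Ck_on 1 (- {0} \<union> ball 0 \<epsilon>) (?F b)" by (intro Ck_on_Un) auto
    moreover have "- {0} \<union> ball (0::'a) \<epsilon> = UNIV" using \<epsilon>(1) by auto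
    ultimately show ?thesis by simp
  qed
  have int: "integrable lborel (dir_deriv (?F b) b)" for b
  proof (rule integrable_continuous_bounded_support)
    show "continuous_on UNIV (dir_deriv (?F b) b)"
      using Ck_on_1_dir_deriv_continuous[of 0 UNIV "?F b"] F by simp
    show "dir_deriv (?F b) b x = 0" if "R + 1 \<le> norm x" for x
      by (rule dir_deriv_eq_0_outside[of R]) (use R that in auto)
  qed
  have "(\<integral>x. (\<Sum>b\<in>Basis. dir_deriv (?F b) b x) \<partial>lborel) = (\<Sum>b\<in>Basis. \<integral>x. dir_deriv (?F b) b x \<partial>lborel)"
    using int by (intro Bochner_Integration.integral_sum) auto
  also have "\<dots> = 0"
    using integral_dir_deriv_eq_0[OF F] R by (intro sum.neutral) auto
  finally have "(\<integral>x. (\<Sum>b\<in>Basis. dir_deriv (?F b) b x) \<partial>lborel) = 0" .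
  moreover have "(\<Sum>b\<in>Basis. dir_deriv (?F b) b x)
      = \<zeta> x * wdiv \<alpha> u x + norm x powr \<alpha> * (\<Sum>b\<in>Basis. dir_deriv \<zeta> b x * dir_deriv u b x)"
    if "x \<noteq> 0" for x
  proof -
    have "dir_deriv (?F b) b x = \<zeta> x * dir_deriv (?c b) b x + dir_deriv \<zeta> b x * ?c b x" for b
      by (rule dir_deriv_eq[OF has_derivative_mult[OF Ck_on_has_derivative[OF \<zeta>1] Ck_on_has_derivative[OF c]]])
        (use that in auto)
    then show ?thesis
      by (simp add: wdiv_eq[OF u2 that] sum.distrib sum_distrib_left mult_ac)
  qed
  moreover have "AE x in lborel. x \<noteq> (0::'a)"
    using AE_lborel_singleton by auto
  ultimately show ?thesis
    by (subst (asm) integral_cong_AE[where g = "\<lambda>x. \<zeta> x * wdiv \<alpha> u x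
          + norm x powr \<alpha> * (\<Sum>b\<in>Basis. dir_deriv \<zeta> b x * dir_deriv u b x)"])
      (use int in \<open>auto intro!: borel_measurable_continuous_off_0 continuous_intros
          Ck_on_imp_continuous_on[OF Ck_on_wdiv[OF u2]] Ck_on_imp_continuous_on[OF \<zeta>1]
          Ck_on_1_dir_deriv_continuous[OF \<zeta>1] Ck_on_1_dir_deriv_continuous[OF u2]\<close>)
qed

text \<open>The argument is the squared norm because that is smooth at 0 too, so the function is of
  class C^2 on the whole space. For positive \<delta> it vanishes where |x| \<le> \<delta> and is 1
  from sqrt 2 times \<delta> on.\<close>

definition cutoff :: "real \<Rightarrow> 'a::euclidean_space \<Rightarrow> real" where
  "cutoff \<delta> x = smooth_step (x \<bullet> x / \<delta>\<^sup>2 - 1)"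

lemma Ck_on_cutoff: "Ck_on 2 UNIV (cutoff \<delta>)"
proof -
  have "Ck_on 2 UNIV (\<lambda>x::'a. (1 / \<delta>\<^sup>2) * (x \<bullet> x) - 1)"
    by (intro Ck_on_diff Ck_on_scale Ck_on_const Ck_on_norm_square) auto
  from Ck_on_compose[OF _ _ Ck_on_smooth_step this] show ?thesis
    by (simp add: cutoff_def[abs_def])
qed

lemma cutoff_bounds: "0 \<le> cutoff \<delta> x" "cutoff \<delta> x \<le> 1"
  by (simp_all add: cutoff_def smooth_step_bounds)

lemma cutoff_eq_0:
  assumes "0 < \<delta>" "norm x \<le> \<delta>" shows "cutoff \<delta> x = 0"
proof -
  have "x \<bullet> x \<le> \<delta>\<^sup>2" using assms by (simp add: dot_square_norm power_mono)
  then show ?thesis using assms by (simp add: cutoff_def smooth_step_eq_0)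
qed

lemma cutoff_eq_1:
  assumes "0 < \<delta>" "2 * \<delta> \<le> norm x" shows "cutoff \<delta> x = 1"
proof -
  have "(2 * \<delta>)\<^sup>2 \<le> x \<bullet> x"
    using power_mono[OF assms(2), of 2] assms(1) by (simp add: dot_square_norm)
  then have "2 * \<delta>\<^sup>2 \<le> x \<bullet> x"
      by (rule order_trans[rotated]) (simp add: power_mult_distrib)
  then show ?thesis using assms by (auto simp: cutoff_def field_simps intro!: smooth_step_eq_1)
qed

text \<open>The factor 36 is made of 9 from the slope of the step, 2 from differentiating the square
  and 2 from the radius 2\<delta>, beyond which the slope is 0.\<close>

lemma dir_deriv_cutoff_bound:
  assumes \<delta>: "0 < \<delta>"
  shows "\<bar>dir_deriv (cutoff \<delta>) v x\<bar> \<le> 36 * norm v / \<delta> * indicator (cball 0 (2 * \<delta>)) x"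
proof -
  have "((\<lambda>x::'a. (x \<bullet> x) * inverse (\<delta>\<^sup>2) - 1) has_derivative (\<lambda>v. (2 * (x \<bullet> v)) * inverse (\<delta>\<^sup>2))) (at x)"
    by (rule derivative_eq_intros refl)+ (simp add: inner_commute algebra_simps)
  then have "((\<lambda>x::'a. x \<bullet> x / \<delta>\<^sup>2 - 1) has_derivative (\<lambda>v. (2 * (x \<bullet> v)) / \<delta>\<^sup>2)) (at x)"
    by (simp only: divide_inverse)
  from has_derivative_compose[OF this DERIV_smooth_step[THEN has_field_derivative_imp_has_derivative]]
  have d: "dir_deriv (cutoff \<delta>) v x = smooth_step' (x \<bullet> x / \<delta>\<^sup>2 - 1) * (2 * (x \<bullet> v) / \<delta>\<^sup>2)" for v
    unfolding cutoff_def[abs_def] by (rule dir_deriv_eq)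
  show ?thesis
  proof (cases "norm x \<le> 2 * \<delta>")
    case True
    have "\<bar>dir_deriv (cutoff \<delta>) v x\<bar> \<le> 9 * (2 * (2 * \<delta> * norm v) / \<delta>\<^sup>2)"
      unfolding d abs_mult
    proof (intro mult_mono)
      show "\<bar>smooth_step' (x \<bullet> x / \<delta>\<^sup>2 - 1)\<bar> \<le> 9"
        using smooth_step'_nonneg smooth_step'_le by (simp add: abs_of_nonneg)
      have "\<bar>x \<bullet> v\<bar> \<le> 2 * \<delta> * norm v"
        using Cauchy_Schwarz_ineq2[of x v] mult_right_mono[OF True, of "norm v"] by simp
      then show "\<bar>2 * (x \<bullet> v) / \<delta>\<^sup>2\<bar> \<le> 2 * (2 * \<delta> * norm v) / \<delta>\<^sup>2"
        by (simp add: abs_mult divide_right_mono)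
    qed auto
    also have "\<dots> = 36 * norm v / \<delta>" using \<delta> by (simp add: power2_eq_square)
    finally show ?thesis using True by simp
  next
    case False
    then have "(2 * \<delta>)\<^sup>2 \<le> x \<bullet> x"
      using power_mono[of "2 * \<delta>" "norm x" 2] \<delta> by (simp add: dot_square_norm)
    then have "2 * \<delta>\<^sup>2 \<le> x \<bullet> x"
      by (rule order_trans[rotated]) (simp add: power_mult_distrib)
    then have "1 \<le> x \<bullet> x / \<delta>\<^sup>2 - 1" using \<delta> by (simp add: field_simps)
    then show ?thesis using d smooth_step'_eq_0 \<delta> by auto
  qed
qed

lemma cutoff_tendsto_1:
  assumes "x \<noteq> 0"
  shows "(\<lambda>n. cutoff (inverse (real (Suc n))) x) \<longlonglongrightarrow> 1"
proof (rule tendsto_eventually)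
  have "eventually (\<lambda>n. inverse (real (Suc n)) < norm x / 2) sequentially"
    using LIMSEQ_inverse_real_of_nat assms by (intro order_tendstoD) auto
  then show "eventually (\<lambda>n. cutoff (inverse (real (Suc n))) x = 1) sequentially"
    by eventually_elim (rule cutoff_eq_1, auto)
qed

lemma integrable_indicator_cball: "integrable lborel (indicator (cball (a::'a::euclidean_space) r) :: 'a \<Rightarrow> real)"
  using emeasure_lborel_cball_finite by (intro integrable_real_indicator) auto

text \<open>On the supporting ball |w| \<le> 1 + w^2, so square integrability of w yields
  integrability there.\<close>

lemma integrable_bounded_support_mult_L2:
  fixes g w :: "'a::euclidean_space \<Rightarrow> real"
  assumes [measurable]: "g \<in> borel_measurable borel" "w \<in> borel_measurable borel"
    and w: "integrable lborel (\<lambda>x. (w x)\<^sup>2)"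
    and g: "\<And>x. \<bar>g x\<bar> \<le> M" "\<And>x. R < norm x \<Longrightarrow> g x = 0"
  shows "integrable lborel (\<lambda>x. g x * w x)"
proof (rule Bochner_Integration.integrable_bound)
  show "integrable lborel (\<lambda>x. M * (indicator (cball 0 R) x + (w x)\<^sup>2))"
    by (intro integrable_mult_right Bochner_Integration.integrable_add integrable_indicator_cball w)
  have M: "0 \<le> M" using g(1)[of 0] by linarith
  show "AE x in lborel. norm (g x * w x) \<le> norm (M * (indicator (cball 0 R) x + (w x)\<^sup>2))"
  proof (rule AE_I2)
    fix x
    show "norm (g x * w x) \<le> norm (M * (indicator (cball 0 R) x + (w x)\<^sup>2))"
    proof (cases "norm x \<le> R")
      case True
      have "0 \<le> (\<bar>w x\<bar> - 1)\<^sup>2" by simp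
      then have "\<bar>w x\<bar> \<le> 1 + (w x)\<^sup>2" using abs_ge_zero[of "w x"] by (simp add: power2_diff)
      then have "\<bar>g x\<bar> * \<bar>w x\<bar> \<le> M * (1 + (w x)\<^sup>2)"
        using g(1)[of x] M by (intro mult_mono) auto
      then show ?thesis using True M by (simp add: abs_mult)
    qed (use g(2) in simp)
  qed
qed measurable

text \<open>For positive l this rises from 0 at height l to l at height 2l. The factor l in front
  makes the slope bound 9 independent of l.\<close>

definition level_step :: "real \<Rightarrow> real \<Rightarrow> real" where
  "level_step l s = l * smooth_step (s / l - 1)"

definition level_step' :: "real \<Rightarrow> real \<Rightarrow> real" where
  "level_step' l s = smooth_step' (s / l - 1)"

lemma DERIV_level_step: "0 < l \<Longrightarrow> (level_step l has_real_derivative level_step' l s) (at s)"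
  unfolding level_step_def[abs_def] level_step'_def
  by (auto intro!: derivative_eq_intros DERIV_chain2[OF DERIV_smooth_step])

lemma Ck_on_level_step:
  assumes "0 < l" shows "Ck_on 1 UNIV (level_step l)"
proof -
  have "Ck_on (Suc 0) UNIV (level_step l)"
    by (rule Ck_on_SucI_real[OF open_UNIV DERIV_level_step[OF assms]])
      (use assms in \<open>auto simp: level_step'_def[abs_def]
        intro!: continuous_on_compose2[OF continuous_on_smooth_step'[of UNIV]] continuous_intros\<close>)
  then show ?thesis by simp
qed

lemma level_step_bounds: "0 < l \<Longrightarrow> 0 \<le> level_step l s" "0 < l \<Longrightarrow> level_step l s \<le> l"
  by (simp_all add: level_step_def smooth_step_bounds mult_left_le)

lemma level_step_eq_0: "0 < l \<Longrightarrow> s \<le> l \<Longrightarrow> level_step l s = 0"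
  by (simp add: level_step_def smooth_step_eq_0)

lemma level_step_eq_l: "0 < l \<Longrightarrow> 2 * l \<le> s \<Longrightarrow> level_step l s = l"
  by (simp add: level_step_def smooth_step_eq_1 field_simps)

lemma level_step'_bounds: "0 \<le> level_step' l s" "level_step' l s \<le> 9"
  by (simp_all add: level_step'_def smooth_step'_nonneg smooth_step'_le)

lemma level_step'_eq_0: "0 < l \<Longrightarrow> s \<le> l \<Longrightarrow> level_step' l s = 0"
  by (simp add: level_step'_def smooth_step'_eq_0)

lemma continuous_on_level_step': "0 < l \<Longrightarrow> continuous_on UNIV (level_step' l)"
  unfolding level_step'_def[abs_def]
  by (intro continuous_on_compose2[OF continuous_on_smooth_step'[of UNIV]] continuous_intros) auto

lemma dir_deriv_level_step:
  assumes "Ck_on (Suc k) S u" "0 < l" "x \<in> S"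
  shows "dir_deriv (\<lambda>x. level_step l (u x)) v x = level_step' l (u x) * dir_deriv u v x"
  using has_derivative_compose[OF Ck_on_has_derivative[OF assms(1,3)]
      DERIV_level_step[OF assms(2), THEN has_field_derivative_imp_has_derivative]]
  by (rule dir_deriv_eq)

text \<open>The cutoff is needed because the weight is not differentiable at the origin. Its gradient
  contributes at most a multiple of \<open>\<delta>\<^sup>-\<^sup>1\<close> times the volume of a ball of radius \<open>2\<delta>\<close>, which tends to
  \<open>0\<close> in dimension at least two.\<close>

lemma energy_estimate:
  fixes u :: "'a::euclidean_space \<Rightarrow> real"
  assumes u: "Ck_on 2 UNIV u" "\<And>x. R \<le> norm x \<Longrightarrow> u x = 0"
    and w: "integrable lborel (\<lambda>x. (wdiv \<alpha> u x)\<^sup>2)"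
    and \<alpha>: "0 \<le> \<alpha>" and dim: "2 \<le> DIM('a)" and l: "0 < l"
  shows "(\<integral>\<^sup>+x. ennreal (norm x powr \<alpha> * level_step' l (u x) * (norm (grad u x))\<^sup>2) \<partial>lborel)
      \<le> (\<integral>\<^sup>+x. ennreal (level_step l (u x) * \<bar>wdiv \<alpha> u x\<bar>) \<partial>lborel)"
proof -
  let ?w = "wdiv \<alpha> u" and ?G = "\<lambda>x. level_step l (u x)" and ?G' = "\<lambda>x. level_step' l (u x)"
  define \<delta> where "\<delta> n = inverse (real (Suc n))" for n
  have \<delta>: "0 < \<delta> n" for n by (simp add: \<delta>_def)
  define \<psi> :: "nat \<Rightarrow> 'a \<Rightarrow> real" where "\<psi> n = cutoff (\<delta> n)" for n
  have u2: "Ck_on (Suc (Suc 0)) UNIV u" using u(1) by (simp only: numeral_2_eq_2)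
  have u1: "Ck_on (Suc 0) UNIV u" by (rule Ck_on_Suc_imp[OF u2])
  have u0: "Ck_on (Suc (Suc 0)) (- {0}) u" using u2 Ck_on_subset by blast
  note contu = Ck_on_imp_continuous_on[OF u1] and contD = Ck_on_1_dir_deriv_continuous[OF u2]
  have contG: "continuous_on UNIV ?G"
    by (rule continuous_on_compose2[OF Ck_on_imp_continuous_on[OF Ck_on_level_step[OF l]] contu]) auto
  have contG': "continuous_on UNIV ?G'"
    by (rule continuous_on_compose2[OF continuous_on_level_step'[OF l] contu]) auto
  have [measurable]: "?w \<in> borel_measurable borel" by (rule borel_measurable_wdiv[OF u0])
  have [measurable]: "?G \<in> borel_measurable borel" "?G' \<in> borel_measurable borel"
      "dir_deriv u b \<in> borel_measurable borel" for b
    using contG contG' contD by (auto intro!: borel_measurable_continuous_onI)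
  have [measurable]: "\<psi> n \<in> borel_measurable borel" "dir_deriv (\<psi> n) b \<in> borel_measurable borel" for n b
    unfolding \<psi>_def
    using Ck_on_imp_continuous_on[OF Ck_on_cutoff]
      Ck_on_1_dir_deriv_continuous[OF Ck_on_cutoff[unfolded numeral_2_eq_2]]
    by (auto intro!: borel_measurable_continuous_onI)
  have Gout: "?G x = 0" "?G' x = 0" if "R \<le> norm x" for x
    using u(2)[OF that] l by (simp_all add: level_step_eq_0 level_step'_eq_0)
  have GM: "\<bar>?G x\<bar> \<le> l" for x using level_step_bounds[OF l] by (simp add: abs_of_nonneg)
  have \<psi>_bd: "0 \<le> \<psi> n x" "\<psi> n x \<le> 1" for n x by (simp_all add: \<psi>_def cutoff_bounds)

  have Dout: "dir_deriv u b x = 0" if "R + 1 \<le> norm x" for x b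
    by (rule dir_deriv_eq_0_outside[of R]) (use u(2) that in auto)
  have "\<exists>M>0. \<forall>x. \<bar>dir_deriv u b x\<bar> \<le> M" for b
    using bounded_continuous_bounded_support[OF contD Dout] by metis
  then obtain MD where MD: "\<And>b. 0 < MD b" "\<And>b x. \<bar>dir_deriv u b x\<bar> \<le> MD b" by metis
  define P where "P = max R 1 powr \<alpha>"
  have P: "norm x powr \<alpha> \<le> P" if "norm x \<le> R" for x :: 'a
    unfolding P_def using that \<alpha> by (intro powr_mono2) auto
  have P0: "0 \<le> P" by (simp add: P_def)

  have intGw: "integrable lborel (\<lambda>x. ?G x * ?w x)"
    by (rule integrable_bounded_support_mult_L2[OF _ _ w GM, where R = R]) (use Gout in auto)
  define e where "e x = norm x powr \<alpha> * ?G' x * (norm (grad u x))\<^sup>2" for x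
  have e_eq: "e x = norm x powr \<alpha> * ?G' x * (\<Sum>b\<in>Basis. (dir_deriv u b x)\<^sup>2)" for x
    by (simp add: e_def norm_grad_square)
  have e0: "0 \<le> e x" for x by (simp add: e_def level_step'_bounds)
  have [measurable]: "e \<in> borel_measurable borel" unfolding e_eq[abs_def] by measurable
  have inte: "integrable lborel e"
  proof (rule Bochner_Integration.integrable_bound)
    show "integrable lborel (\<lambda>x::'a. P * 9 * (\<Sum>b\<in>Basis. (MD (b::'a))\<^sup>2) * indicator (cball 0 R) x)"
      by (intro integrable_mult_right integrable_indicator_cball)
    show "AE x in lborel. norm (e x) \<le> norm (P * 9 * (\<Sum>b\<in>Basis. (MD (b::'a))\<^sup>2) * indicator (cball 0 R) x)"
    proof (rule AE_I2)
      fix x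
      show "norm (e x) \<le> norm (P * 9 * (\<Sum>b\<in>Basis. (MD (b::'a))\<^sup>2) * indicator (cball 0 R) x)"
      proof (cases "norm x \<le> R")
        case True
        have "e x \<le> P * 9 * (\<Sum>b\<in>Basis. (MD (b::'a))\<^sup>2)"
          unfolding e_eq
          by (intro mult_mono sum_mono P True level_step'_bounds mult_nonneg_nonneg sum_nonneg P0
                power2_le_iff_abs_le[THEN iffD2]) (use MD in \<open>auto intro: less_imp_le\<close>)
        then show ?thesis using True e0[of x] by simp
      qed (use Gout in \<open>simp add: e_def\<close>)
    qed
  qed measurable

  \<comment> \<open>The term of the product rule in which the derivative falls on the cutoff;
    \<open>e\<close> collects the one in which it falls on the level step.\<close>
  define C where "C n x = norm x powr \<alpha> * (\<Sum>b\<in>Basis. dir_deriv (\<psi> n) b x * ?G x * dir_deriv u b x)" for n x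
  have [measurable]: "C n \<in> borel_measurable borel" for n unfolding C_def[abs_def] by measurable
  define K where "K = P * (\<Sum>b\<in>(Basis::'a set). 36 * l * MD b)"
  have K: "0 \<le> K" unfolding K_def using P0 l MD(1) by (intro mult_nonneg_nonneg sum_nonneg) (auto intro: less_imp_le)
  have C_bd: "\<bar>C n x\<bar> \<le> K / \<delta> n * indicator (cball 0 (2 * \<delta> n)) x" for n x
  proof (cases "norm x \<le> R \<and> norm x \<le> 2 * \<delta> n")
    case True
    have "\<bar>C n x\<bar> \<le> P * (\<Sum>b\<in>(Basis::'a set). 36 * 1 / \<delta> n * l * MD b)"
      unfolding C_def abs_mult
    proof (intro mult_mono order_trans[OF sum_abs] sum_mono)
      show "\<bar>norm x powr \<alpha>\<bar> \<le> P" using P True by simp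
      fix b :: 'a assume b: "b \<in> Basis"
      have "\<bar>dir_deriv (\<psi> n) b x\<bar> \<le> 36 * 1 / \<delta> n"
        using dir_deriv_cutoff_bound[OF \<delta>, of n x b] True b by (simp add: \<psi>_def)
      then show "\<bar>dir_deriv (\<psi> n) b x * ?G x * dir_deriv u b x\<bar> \<le> 36 * 1 / \<delta> n * l * MD b"
        unfolding abs_mult using GM[of x] MD(1)[of b] MD(2)[of b x] MD(2)[of x b] l \<delta>[of n]
        by (intro mult_mono) (auto intro: less_imp_le)
    qed (use P0 in auto)
    also have "\<dots> = K / \<delta> n" by (simp add: K_def sum_divide_distrib sum_distrib_left mult_ac)
    finally show ?thesis using True by simp
  next
    case False
    then consider "R < norm x" | "2 * \<delta> n < norm x" by linarith
    then have "C n x = 0"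
    proof cases
      case 1 then show ?thesis using Gout by (simp add: C_def)
    next
      case 2
      then have "dir_deriv (\<psi> n) b x = 0" for b
        using dir_deriv_cutoff_bound[OF \<delta>, of n x b] by (simp add: \<psi>_def)
      then show ?thesis by (simp add: C_def)
    qed
    then show ?thesis using K \<delta>[of n] by simp
  qed
  have "norm (C n x) \<le> norm (K / \<delta> n * indicator (cball 0 (2 * \<delta> n)) x)" for n x
    using order_trans[OF C_bd abs_ge_self] by simp
  then have intC: "integrable lborel (C n)" for n
    by (intro Bochner_Integration.integrable_bound[OF
          integrable_mult_right[OF integrable_indicator_cball[of 0 "2 * \<delta> n"], of "K / \<delta> n"]] AE_I2) auto
  have limC: "(\<lambda>n. \<integral>x. C n x \<partial>lborel) \<longlonglongrightarrow> 0"
  proof (rule Lim_null_comparison)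
    define V where "V = unit_ball_vol (real DIM('a))"
    show "\<forall>\<^sub>F n in sequentially. norm (\<integral>x. C n x \<partial>lborel) \<le> K * V * 2 ^ DIM('a) * \<delta> n ^ (DIM('a) - 1)"
    proof (rule always_eventually, rule allI)
      fix n
      have "norm (\<integral>x. C n x \<partial>lborel) \<le> (\<integral>x. norm (C n x) \<partial>lborel)"
        by (rule integral_norm_bound)
      also have "\<dots> \<le> (\<integral>x. K / \<delta> n * indicator (cball (0::'a) (2 * \<delta> n)) x \<partial>lborel)"
        using C_bd
        by (intro integral_mono integrable_norm intC integrable_mult_right integrable_indicator_cball) auto
      also have "\<dots> = K / \<delta> n * (V * (2 * \<delta> n) ^ DIM('a))"
        using \<delta>[of n] by (simp add: content_cball V_def)
      also have "(2 * \<delta> n) ^ DIM('a) = 2 ^ DIM('a) * (\<delta> n * \<delta> n ^ (DIM('a) - 1))"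
        by (simp add: power_mult_distrib flip: power_Suc)
      also have "K / \<delta> n * (V * (2 ^ DIM('a) * (\<delta> n * \<delta> n ^ (DIM('a) - 1)))) = K * V * 2 ^ DIM('a) * \<delta> n ^ (DIM('a) - 1)"
        using \<delta>[of n] by simp
      finally show "norm (\<integral>x. C n x \<partial>lborel) \<le> K * V * 2 ^ DIM('a) * \<delta> n ^ (DIM('a) - 1)" .
    qed
    have "(\<lambda>n. K * V * 2 ^ DIM('a) * \<delta> n ^ (DIM('a) - 1)) \<longlonglongrightarrow> K * V * 2 ^ DIM('a) * 0 ^ (DIM('a) - 1)"
      unfolding \<delta>_def by (intro tendsto_intros LIMSEQ_inverse_real_of_nat)
    then show "(\<lambda>n. K * V * 2 ^ DIM('a) * \<delta> n ^ (DIM('a) - 1)) \<longlonglongrightarrow> 0"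
      using dim by (simp add: power_0_left)
  qed

  have lim\<psi>: "AE x in lborel. (\<lambda>n. \<psi> n x * f x) \<longlonglongrightarrow> f x" for f :: "'a \<Rightarrow> real"
    using AE_lborel_singleton[of "0::'a"]
  proof eventually_elim
    case (elim x)
    from tendsto_mult[OF cutoff_tendsto_1[OF this] tendsto_const[of "f x"]]
    show ?case by (simp add: \<psi>_def \<delta>_def)
  qed
  have lime: "(\<lambda>n. \<integral>x. \<psi> n x * f x \<partial>lborel) \<longlonglongrightarrow> (\<integral>x. f x \<partial>lborel)"
    and int\<psi>: "integrable lborel (\<lambda>x. \<psi> n x * f x)" if f: "integrable lborel f" for f n
  proof -
    have [measurable]: "f \<in> borel_measurable borel" using f by auto
    have b: "norm (\<psi> n x * f x) \<le> norm (f x)" for n x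
      using \<psi>_bd[of n x] mult_right_mono[of "\<psi> n x" 1 "\<bar>f x\<bar>"] by (simp add: abs_mult)
    show "(\<lambda>n. \<integral>x. \<psi> n x * f x \<partial>lborel) \<longlonglongrightarrow> (\<integral>x. f x \<partial>lborel)"
      by (rule integral_dominated_convergence[where w = "\<lambda>x. norm (f x)"])
        (use f lim\<psi> b in auto)
    show "integrable lborel (\<lambda>x. \<psi> n x * f x)"
      by (rule Bochner_Integration.integrable_bound[OF f]) (use b in auto)
  qed

  \<comment> \<open>The divergence identity with test function \<open>\<psi> n\<close> times the
    level step of u, which vanishes near the origin. Letting n grow removes the cutoff.\<close>
  have main: "(\<integral>x. \<psi> n x * (?G x * ?w x) \<partial>lborel) + (\<integral>x. C n x \<partial>lborel) + (\<integral>x. \<psi> n x * e x \<partial>lborel) = 0" for n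
  proof -
    define \<zeta> where "\<zeta> x = \<psi> n x * ?G x" for x
    have \<psi>1: "Ck_on (Suc 0) UNIV (\<psi> n)"
      unfolding \<psi>_def by (rule Ck_on_mono[OF Ck_on_cutoff]) simp
    have G1: "Ck_on (Suc 0) UNIV ?G"
      by (rule Ck_on_compose[OF _ _ Ck_on_level_step[OF l, simplified One_nat_def] u1]) auto
    have \<zeta>1: "Ck_on 1 UNIV \<zeta>"
      unfolding \<zeta>_def[abs_def] One_nat_def by (intro Ck_on_mult \<psi>1 G1) auto
    have d\<zeta>: "dir_deriv \<zeta> b x = dir_deriv (\<psi> n) b x * ?G x + \<psi> n x * (?G' x * dir_deriv u b x)" for b x
      using dir_deriv_eq[OF has_derivative_mult[OF Ck_on_has_derivative[OF \<psi>1 UNIV_I] Ck_on_has_derivative[OF G1 UNIV_I]]]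
      unfolding \<zeta>_def[abs_def] by (simp add: dir_deriv_level_step[OF u1 l])
    have "(\<integral>x. \<zeta> x * ?w x + norm x powr \<alpha> * (\<Sum>b\<in>Basis. dir_deriv \<zeta> b x * dir_deriv u b x) \<partial>lborel) = 0"
    proof (rule integral_div_eq_0)
      show "Ck_on 1 (- {0}) \<zeta>" "Ck_on 2 (- {0}) u" using \<zeta>1 u(1) Ck_on_subset by blast+
      show "\<zeta> x * dir_deriv u b x = 0" if "norm x < \<delta> n" for x b
        using cutoff_eq_0[OF \<delta>, of x n] that by (simp add: \<zeta>_def \<psi>_def)
    qed (use \<delta> Gout in \<open>auto simp: \<zeta>_def\<close>)
    also have "(\<lambda>x. \<zeta> x * ?w x + norm x powr \<alpha> * (\<Sum>b\<in>Basis. dir_deriv \<zeta> b x * dir_deriv u b x))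
        = (\<lambda>x. \<psi> n x * (?G x * ?w x) + C n x + \<psi> n x * e x)"
      by (simp add: \<zeta>_def d\<zeta> C_def e_eq algebra_simps sum.distrib sum_distrib_left power2_eq_square)
    finally show ?thesis
      using int\<psi>[OF intGw, of n] int\<psi>[OF inte, of n] intC[of n] by simp
  qed
  have "(\<lambda>n. (\<integral>x. \<psi> n x * (?G x * ?w x) \<partial>lborel) + (\<integral>x. C n x \<partial>lborel) + (\<integral>x. \<psi> n x * e x \<partial>lborel))
      \<longlonglongrightarrow> (\<integral>x. ?G x * ?w x \<partial>lborel) + 0 + (\<integral>x. e x \<partial>lborel)"
    by (intro tendsto_add lime intGw inte limC)
  \<comment> \<open>In the limit the energy is minus the pairing of the level step with w. Taking
    absolute values leaves the integral that \<open>level_decay\<close> bounds by l W(l).\<close>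
  then have "(\<integral>x. ?G x * ?w x \<partial>lborel) + (\<integral>x. e x \<partial>lborel) = 0"
    unfolding main by (simp add: LIMSEQ_const_iff)
  then have "(\<integral>x. e x \<partial>lborel) \<le> \<bar>\<integral>x. ?G x * ?w x \<partial>lborel\<bar>" by linarith
  also have "\<dots> \<le> (\<integral>x. \<bar>?G x * ?w x\<bar> \<partial>lborel)" by (rule integral_abs_bound)
  finally have "(\<integral>x. e x \<partial>lborel) \<le> (\<integral>x. ?G x * \<bar>?w x\<bar> \<partial>lborel)"
    using level_step_bounds[OF l] by (simp add: abs_mult abs_of_nonneg)
  moreover have "integrable lborel (\<lambda>x. ?G x * \<bar>?w x\<bar>)"
    using integrable_abs[OF intGw] level_step_bounds[OF l] by (simp add: abs_mult abs_of_nonneg)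
  ultimately show ?thesis
    unfolding e_def[symmetric]
    using inte e0 level_step_bounds[OF l]
    by (subst (1 2) nn_integral_eq_integral) (auto intro!: ennreal_leI)
qed

section \<open>The Sobolev inequality for test functions\<close>

text \<open>The isoperimetric bound controls l m(2l) by r times the L^1 norm of the gradient of the
  step, where r^N is proportional to m(l). After squaring, r^2 contributes the power 2/N of m(l),
  the weight integral the power 1 - \<alpha>/N, and the energy the factor l W(l), so that one l
  cancels.\<close>

lemma level_decay:
  fixes \<alpha> :: real
  assumes \<alpha>: "0 < \<alpha>" "\<alpha> < 2" and dim: "2 \<le> DIM('a::euclidean_space)"
  obtains C where "0 < C"
    "\<And>(u :: 'a \<Rightarrow> real) l. u \<in> test_space \<alpha> \<Longrightarrow> 0 < l \<Longrightarrow>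
       l * (measure lborel {x. 2 * l < u x})\<^sup>2
         \<le> C * measure lborel {x. l < u x} powr (1 + (2 - \<alpha>) / DIM('a))
             * (\<integral>x. indicator {x. l < u x} x * \<bar>wdiv \<alpha> u x\<bar> \<partial>lborel)"
proof -
  let ?N = "real DIM('a)"
  have "\<alpha> < ?N" using \<alpha> dim by linarith
  then obtain K where K: "0 < K" "\<And>F::'a set. F \<in> sets borel \<Longrightarrow> emeasure lborel F < \<infinity> \<Longrightarrow>
     (\<integral>\<^sup>+x. ennreal (norm x powr (- \<alpha>)) * indicator F x \<partial>lborel)
       \<le> ennreal (K * measure lborel F powr (1 - \<alpha> / ?N))"
    using nn_integral_norm_powr_le[OF \<alpha>(1)] by blast
  define V where "V = unit_ball_vol ?N"
  have V: "0 < V" by (simp add: V_def)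
  \<comment> \<open>36 = 4 * 9, with 4 from squaring l / 2 and 9 from squaring the 3 in
    \<open>?f1\<close>. The last factor is the one in r^2.\<close>
  define C where "C = 36 * K * (2 / V) powr (2 / ?N)"
  have "0 < C" using K(1) V by (simp add: C_def)
  moreover
  have "l * (measure lborel {x. 2 * l < u x})\<^sup>2
         \<le> C * measure lborel {x. l < u x} powr (1 + (2 - \<alpha>) / ?N)
             * (\<integral>x. indicator {x. l < u x} x * \<bar>wdiv \<alpha> u x\<bar> \<partial>lborel)"
    if u: "u \<in> test_space \<alpha>" and l: "0 < l" for u :: "'a \<Rightarrow> real" and l
  proof -
    obtain R where R: "\<And>x. R \<le> norm x \<Longrightarrow> u x = 0" using u by (auto simp: test_space_iff)
    have w: "integrable lborel (\<lambda>x. (wdiv \<alpha> u x)\<^sup>2)" and uk: "Ck_on k UNIV u" for k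
      using u by (auto simp: test_space_iff)
    note u1 = uk[of "Suc 0"] and [measurable] = borel_measurable_test_space[OF u]
    define F where "F = {x. l < u x}"
    define E where "E = {x. 2 * l < u x}"
    define W where "W = (\<integral>x. indicator F x * \<bar>wdiv \<alpha> u x\<bar> \<partial>lborel)"
    define m where "m = measure lborel F"
    have contD: "continuous_on UNIV (dir_deriv u b)" for b by (rule Ck_on_1_dir_deriv_continuous[OF u1])
    have "continuous_on UNIV (grad u)"
      unfolding grad_def[abs_def] by (intro continuous_intros contD)
    then have [measurable]: "grad u \<in> borel_measurable borel" by (rule borel_measurable_continuous_onI)
    have [measurable]: "level_step' l \<in> borel_measurable borel"
      by (rule borel_measurable_continuous_onI[OF continuous_on_level_step'[OF l]])
    have Fb[measurable]: "F \<in> sets borel" and Eb[measurable]: "E \<in> sets borel"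
      unfolding F_def E_def by measurable
    have FR: "norm x < R" if "x \<in> F" for x
      using that R[of x] l by (cases "norm x < R") (auto simp: F_def)
    have "emeasure lborel F \<le> emeasure lborel (cball (0::'a) R)"
      by (intro emeasure_mono) (use FR in \<open>force+\<close>)
    then have Ffin: "emeasure lborel F < \<infinity>"
      using emeasure_lborel_cball_finite by (rule order.strict_trans1)
    have EF: "E \<subseteq> F" using l by (auto simp: E_def F_def)
    have emF: "emeasure lborel F = ennreal m"
      using Ffin by (simp add: m_def emeasure_eq_ennreal_measure)
    have emE: "emeasure lborel E = ennreal (measure lborel E)"
      using emeasure_mono[OF EF, of lborel] Ffin by (auto intro!: emeasure_eq_ennreal_measure simp: top_unique)
    have intW: "integrable lborel (\<lambda>x. indicator F x * wdiv \<alpha> u x)"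
      by (rule integrable_bounded_support_mult_L2[OF _ _ w, where M = 1 and R = R])
        (use FR in \<open>force simp: indicator_def\<close>)+
    then have intW': "integrable lborel (\<lambda>x. indicator F x * \<bar>wdiv \<alpha> u x\<bar>)"
      using integrable_abs[OF intW] by (simp add: abs_mult)
    have W0: "0 \<le> W" unfolding W_def by (intro Bochner_Integration.integral_nonneg) auto
    have "l * (measure lborel E)\<^sup>2 \<le> C * m powr (1 + (2 - \<alpha>) / ?N) * W"
    \<comment> \<open>For a null superlevel set the radius r below would be 0, so this case is
      treated apart.\<close>
    proof (cases "m = 0")
      case True
      then have "emeasure lborel E = 0" using emeasure_mono[OF EF, of lborel] emF by simp
      then show ?thesis using True by (simp add: measure_def)
    next
      case False
      moreover have "0 \<le> m" by (simp add: m_def)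
      ultimately have m: "0 < m" by simp
      \<comment> \<open>Chosen so that the ball of radius r has exactly twice the volume of
        F.\<close>
      define r where "r = (2 / V) powr (1 / ?N) * m powr (1 / ?N)"
      have r: "0 < r" using V m by (simp add: r_def)
      have "r ^ DIM('a) = r powr ?N" using r by (simp add: powr_realpow)
      also have "\<dots> = 2 / V * m" using V m by (simp add: r_def powr_mult powr_powr)
      finally have rN: "V * r ^ DIM('a) = 2 * m" using V by simp
      have r2: "r\<^sup>2 = (2 / V) powr (2 / ?N) * m powr (2 / ?N)"
        using V m by (simp add: r_def power_mult_distrib powr_power)
      let ?g = "\<lambda>x. level_step' l (u x) * norm (grad u x)"
      have iso: "ennreal (l / 2) * emeasure lborel E \<le> ennreal r * (\<integral>\<^sup>+x. ?g x \<partial>lborel)"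
      proof (rule level_set_isoperimetric[where f = "\<lambda>x. level_step l (u x)" and F = F])
        show "Ck_on 1 UNIV (\<lambda>x. level_step l (u x))"
          by (rule Ck_on_compose[OF _ _ Ck_on_level_step[OF l]]) (use u1 in auto)
        show "x \<in> F" if "level_step l (u x) \<noteq> 0" for x
          using that level_step_eq_0[OF l, of "u x"] by (force simp: F_def)
        show "level_step l (u x) = l" if "x \<in> E" for x
          using that level_step_eq_l[OF l, of "u x"] by (simp add: E_def)
        show "2 * emeasure lborel F \<le> emeasure lborel (ball (0::'a) r)"
        proof -
          have "2 * emeasure lborel F = ennreal (2 * m)" using m by (simp add: emF ennreal_mult)
          also have "\<dots> = emeasure lborel (ball (0::'a) r)"
            using r by (simp add: emeasure_ball flip: rN V_def)
          finally show ?thesis by simp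
        qed
        fix x h
        have "dir_deriv (\<lambda>x. level_step l (u x)) h x = level_step' l (u x) * (grad u x \<bullet> h)"
          using dir_deriv_level_step[OF u1 l, of x h] dir_deriv_eq_grad_inner[of u x h] u1 by simp
        also have "\<bar>\<dots>\<bar> \<le> level_step' l (u x) * (norm (grad u x) * norm h)"
          using level_step'_bounds[of l "u x"] Cauchy_Schwarz_ineq2[of "grad u x" h]
          by (simp add: abs_mult mult_left_mono)
        finally show "\<bar>dir_deriv (\<lambda>x. level_step l (u x)) h x\<bar> \<le> norm h * ?g x" by (simp add: mult_ac)
      qed (use l r level_step_bounds[OF l] level_step'_bounds in auto)
      \<comment> \<open>Cauchy-Schwarz against the weight: \<open>?f1\<close> carries its inverse
        root, \<open>?f2\<close> is the root of the energy density. The density contains the slope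
        only to the first power, so the other root of the slope is estimated by 3.\<close>
      let ?f1 = "\<lambda>x. ennreal (3 * norm x powr (- \<alpha> / 2)) * indicator F x"
      let ?f2 = "\<lambda>x. ennreal (norm x powr (\<alpha> / 2) * sqrt (level_step' l (u x)) * norm (grad u x))"
      have "(\<integral>\<^sup>+x. ?g x \<partial>lborel) \<le> (\<integral>\<^sup>+x. ?f1 x * ?f2 x \<partial>lborel)"
      proof (rule nn_integral_mono_AE)
        show "AE x in lborel. ennreal (?g x) \<le> ?f1 x * ?f2 x"
          using AE_lborel_singleton[of "0::'a"]
        proof eventually_elim
          case (elim x)
          let ?G = "level_step' l (u x)"
          show ?case
          proof (cases "x \<in> F")
            case True
            have "?G = sqrt ?G * sqrt ?G" using level_step'_bounds by simp
            also have "\<dots> \<le> 3 * sqrt ?G"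
              using level_step'_bounds[of l "u x"] real_sqrt_le_mono[of ?G 9] by (intro mult_right_mono) auto
            finally have "?g x \<le> 3 * sqrt ?G * norm (grad u x)" by (intro mult_right_mono) auto
            also have "\<dots> = (3 * norm x powr (- \<alpha> / 2)) * (norm x powr (\<alpha> / 2) * sqrt ?G * norm (grad u x))"
              using elim by (simp add: powr_minus field_simps)
            finally show ?thesis
              using True level_step'_bounds by (simp add: ennreal_leI flip: ennreal_mult)
          next
            case False
            then show ?thesis using level_step'_eq_0[OF l, of "u x"] by (simp add: F_def)
          qed
        qed
      qed
      then have "(\<integral>\<^sup>+x. ?g x \<partial>lborel)\<^sup>2 \<le> (\<integral>\<^sup>+x. ?f1 x * ?f2 x \<partial>lborel)\<^sup>2"
        by (intro power_mono) auto
      also have "\<dots> \<le> (\<integral>\<^sup>+x. (?f1 x)\<^sup>2 \<partial>lborel) * (\<integral>\<^sup>+x. (?f2 x)\<^sup>2 \<partial>lborel)"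
        by (rule Cauchy_Schwarz_nn_integral) measurable
      also have "(\<integral>\<^sup>+x. (?f1 x)\<^sup>2 \<partial>lborel) = (\<integral>\<^sup>+x. 9 * (ennreal (norm x powr (- \<alpha>)) * indicator F x) \<partial>lborel)"
      proof (rule nn_integral_cong)
        fix x :: 'a
        have "(norm x powr (- (\<alpha> / 2)))\<^sup>2 = norm x powr (- \<alpha>)"
          by (cases "x = 0") (simp_all add: powr_power)
        then show "(?f1 x)\<^sup>2 = 9 * (ennreal (norm x powr (- \<alpha>)) * indicator F x)"
          by (auto simp: indicator_def ennreal_power power_mult_distrib ennreal_mult')
      qed
      also have "\<dots> = 9 * (\<integral>\<^sup>+x. ennreal (norm x powr (- \<alpha>)) * indicator F x \<partial>lborel)"
        by (rule nn_integral_cmult) measurable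
      also have "\<dots> \<le> 9 * ennreal (K * m powr (1 - \<alpha> / ?N))"
        using K(2)[OF Fb Ffin] by (intro mult_left_mono) (auto simp: m_def)
      also have "(\<integral>\<^sup>+x. (?f2 x)\<^sup>2 \<partial>lborel)
          = (\<integral>\<^sup>+x. ennreal (norm x powr \<alpha> * level_step' l (u x) * (norm (grad u x))\<^sup>2) \<partial>lborel)"
      proof (rule nn_integral_cong)
        fix x :: 'a
        have "(norm x powr (\<alpha> / 2))\<^sup>2 = norm x powr \<alpha>"
          by (cases "x = 0") (simp_all add: powr_power)
        then show "(?f2 x)\<^sup>2 = ennreal (norm x powr \<alpha> * level_step' l (u x) * (norm (grad u x))\<^sup>2)"
          using level_step'_bounds by (simp add: ennreal_power power_mult_distrib)
      qed
      also have "\<dots> \<le> (\<integral>\<^sup>+x. ennreal (level_step l (u x) * \<bar>wdiv \<alpha> u x\<bar>) \<partial>lborel)"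
        by (rule energy_estimate[where R = R]) (use uk R w \<alpha> dim l in auto)
      also have "\<dots> \<le> (\<integral>\<^sup>+x. ennreal l * ennreal (indicator F x * \<bar>wdiv \<alpha> u x\<bar>) \<partial>lborel)"
      proof (rule nn_integral_mono)
        fix x :: 'a
        have "level_step l (u x) * \<bar>wdiv \<alpha> u x\<bar> \<le> l * (indicator F x * \<bar>wdiv \<alpha> u x\<bar>)"
          using level_step_bounds[OF l, of "u x"] level_step_eq_0[OF l, of "u x"]
          by (auto simp: indicator_def F_def intro!: mult_right_mono)
        then show "ennreal (level_step l (u x) * \<bar>wdiv \<alpha> u x\<bar>)
            \<le> ennreal l * ennreal (indicator F x * \<bar>wdiv \<alpha> u x\<bar>)"
          using l by (simp add: ennreal_leI flip: ennreal_mult)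
      qed
      also have "\<dots> = ennreal l * ennreal W"
        unfolding W_def using intW' by (subst nn_integral_cmult) (auto simp: nn_integral_eq_integral)
      finally have g2: "(\<integral>\<^sup>+x. ?g x \<partial>lborel)\<^sup>2
          \<le> 9 * ennreal (K * m powr (1 - \<alpha> / ?N)) * (ennreal l * ennreal W)"
        by (simp add: mult_left_mono mult_right_mono)
      have "ennreal ((l / 2 * measure lborel E)\<^sup>2) = (ennreal (l / 2) * emeasure lborel E)\<^sup>2"
        using l by (simp add: emE ennreal_power flip: ennreal_mult)
      also have "\<dots> \<le> (ennreal r * (\<integral>\<^sup>+x. ?g x \<partial>lborel))\<^sup>2"
        by (intro power_mono iso) auto
      also have "\<dots> = ennreal (r\<^sup>2) * (\<integral>\<^sup>+x. ?g x \<partial>lborel)\<^sup>2"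
        using r by (simp add: power_mult_distrib ennreal_power)
      also have "\<dots> \<le> ennreal (r\<^sup>2) * (9 * ennreal (K * m powr (1 - \<alpha> / ?N)) * (ennreal l * ennreal W))"
        by (intro mult_left_mono g2) auto
      also have "\<dots> = ennreal (r\<^sup>2 * (9 * (K * m powr (1 - \<alpha> / ?N)) * (l * W)))"
        using K(1) l W0 by (simp add: ennreal_mult)
      finally have "(l / 2 * measure lborel E)\<^sup>2 \<le> r\<^sup>2 * (9 * (K * m powr (1 - \<alpha> / ?N)) * (l * W))"
        using K(1) l W0 by (subst (asm) ennreal_le_iff) auto
      also have "\<dots> = 9 * K * (2 / V) powr (2 / ?N) * (m powr (2 / ?N) * m powr (1 - \<alpha> / ?N)) * l * W"
        by (simp add: r2 mult_ac)
      also have "m powr (2 / ?N) * m powr (1 - \<alpha> / ?N) = m powr (1 + (2 - \<alpha>) / ?N)"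
      proof -
        have "2 / ?N + (1 - \<alpha> / ?N) = 1 + (2 - \<alpha>) / ?N" by (simp add: diff_divide_distrib)
        then show ?thesis by (metis powr_add)
      qed
      finally have "l * (l * (measure lborel E)\<^sup>2) \<le> l * (C * m powr (1 + (2 - \<alpha>) / ?N) * W)"
        by (simp add: C_def power_mult_distrib power2_eq_square field_simps)
      then show ?thesis using l by (simp only: mult_le_cancel_left_pos)
    qed
    then show ?thesis by (simp add: E_def F_def m_def W_def)
  qed
  ultimately show thesis using that by blast
qed

section \<open>Layer cake integrals and the critical exponent\<close>

lemma nn_integral_powr_indicator:
  fixes a s :: real
  assumes "0 < a"
  shows "(\<integral>\<^sup>+t. ennreal (t powr (a - 1) * indicator {t. 0 < t \<and> t < s} t) \<partial>lborel)
      = ennreal (max 0 s powr a / a)"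
proof -
  have "((\<lambda>t. t powr (a - 1)) has_integral max 0 s powr (a - 1 + 1) / (a - 1 + 1)) {0..max 0 s}"
    using assms by (intro has_integral_powr_from_0) auto
  then have "((\<lambda>t. t powr (a - 1)) has_integral max 0 s powr a / a) {0<..<max 0 s}"
    by (subst has_integral_Icc_iff_Ioo[symmetric]) simp
  then have "((\<lambda>t. t powr (a - 1) * indicator {0<..<max 0 s} t) has_integral max 0 s powr a / a) UNIV"
    by (subst (asm) has_integral_restrict_UNIV[symmetric]) (simp add: indicator_def of_bool_def if_distrib[of "(*) _"] cong: if_cong)
  then have "(\<integral>\<^sup>+t. ennreal (t powr (a - 1) * indicator {0<..<max 0 s} t) \<partial>lborel) = ennreal (max 0 s powr a / a)"
    by (intro nn_integral_has_integral_lborel) auto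
  moreover have "{t. 0 < t \<and> t < s} = {0<..<max 0 s}" by auto
  ultimately show ?thesis by simp
qed

text \<open>Tonelli, with the integral over the levels evaluated at each x. The choice h = 1 serves
  the measures of superlevel sets, h = |w| serves W.\<close>

lemma layer_cake:
  fixes f h :: "'a::euclidean_space \<Rightarrow> real" and a :: real
  assumes [measurable]: "f \<in> borel_measurable borel" "h \<in> borel_measurable borel"
    and "\<And>x. 0 \<le> h x" "0 < a"
  shows "(\<integral>\<^sup>+t. ennreal (indicator {0<..} t * t powr (a - 1))
            * (\<integral>\<^sup>+x. ennreal (indicator {x. t < f x} x * h x) \<partial>lborel) \<partial>lborel)
      = (\<integral>\<^sup>+x. ennreal (max 0 (f x) powr a / a * h x) \<partial>lborel)"
proof -
  have "(\<integral>\<^sup>+t. ennreal (indicator {0<..} t * t powr (a - 1))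
            * (\<integral>\<^sup>+x. ennreal (indicator {x. t < f x} x * h x) \<partial>lborel) \<partial>lborel)
      = (\<integral>\<^sup>+t. \<integral>\<^sup>+x. ennreal (indicator {0<..} t * t powr (a - 1))
            * ennreal (indicator {x. t < f x} x * h x) \<partial>lborel \<partial>lborel)"
    by (intro nn_integral_cong nn_integral_cmult[symmetric]) measurable
  also have "\<dots> = (\<integral>\<^sup>+x. \<integral>\<^sup>+t. ennreal (indicator {0<..} t * t powr (a - 1))
            * ennreal (indicator {x. t < f x} x * h x) \<partial>lborel \<partial>lborel)"
    by (rule lborel_pair.Fubini'[symmetric]) (unfold indicator_def mem_Collect_eq, measurable)
  also have "\<dots> = (\<integral>\<^sup>+x. ennreal (max 0 (f x) powr a / a * h x) \<partial>lborel)"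
  proof (rule nn_integral_cong)
    fix x
    have "(\<integral>\<^sup>+t. ennreal (indicator {0<..} t * t powr (a - 1)) * ennreal (indicator {x. t < f x} x * h x) \<partial>lborel)
        = (\<integral>\<^sup>+t. ennreal (t powr (a - 1) * indicator {t. 0 < t \<and> t < f x} t) * ennreal (h x) \<partial>lborel)"
      by (intro nn_integral_cong) (auto simp: indicator_def)
    also have "\<dots> = ennreal (max 0 (f x) powr a / a) * ennreal (h x)"
      by (subst nn_integral_multc) (auto simp: nn_integral_powr_indicator[OF \<open>0 < a\<close>])
    also have "\<dots> = ennreal (max 0 (f x) powr a / a * h x)"
      by (rule ennreal_mult''[symmetric, OF assms(3)])
    finally show "(\<integral>\<^sup>+t. ennreal (indicator {0<..} t * t powr (a - 1))
            * ennreal (indicator {x. t < f x} x * h x) \<partial>lborel) = ennreal (max 0 (f x) powr a / a * h x)" .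
  qed
  finally show ?thesis .
qed

lemma Cauchy_Schwarz_integral_le:
  fixes f g :: "'a \<Rightarrow> real"
  assumes [measurable]: "f \<in> borel_measurable M" "g \<in> borel_measurable M"
    and f: "integrable M (\<lambda>x. (f x)\<^sup>2)" and g: "integrable M (\<lambda>x. (g x)\<^sup>2)"
  shows "(\<integral>x. \<bar>f x * g x\<bar> \<partial>M) \<le> sqrt (\<integral>x. (f x)\<^sup>2 \<partial>M) * sqrt (\<integral>x. (g x)\<^sup>2 \<partial>M)"
    and "integrable M (\<lambda>x. f x * g x)"
proof -
  have fg: "norm (f x * g x) \<le> norm ((f x)\<^sup>2 + (g x)\<^sup>2)" for x
  proof -
    have "0 \<le> \<bar>f x\<bar> * \<bar>g x\<bar>" "2 * (\<bar>f x\<bar> * \<bar>g x\<bar>) \<le> (f x)\<^sup>2 + (g x)\<^sup>2"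
      using sum_squares_bound[of "\<bar>f x\<bar>" "\<bar>g x\<bar>"] by (simp_all add: mult.assoc)
    then show ?thesis by (simp only: real_norm_def abs_mult)
  qed
  show i: "integrable M (\<lambda>x. f x * g x)"
    by (rule Bochner_Integration.integrable_bound[OF Bochner_Integration.integrable_add[OF f g]])
      (use fg in auto)
  have "ennreal ((\<integral>x. \<bar>f x * g x\<bar> \<partial>M)\<^sup>2) = (\<integral>\<^sup>+x. ennreal \<bar>f x\<bar> * ennreal \<bar>g x\<bar> \<partial>M)\<^sup>2"
    using integrable_abs[OF i]
    by (simp add: nn_integral_eq_integral ennreal_power abs_mult flip: ennreal_mult)
  also have "\<dots> \<le> (\<integral>\<^sup>+x. (ennreal \<bar>f x\<bar>)\<^sup>2 \<partial>M) * (\<integral>\<^sup>+x. (ennreal \<bar>g x\<bar>)\<^sup>2 \<partial>M)"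
    by (rule Cauchy_Schwarz_nn_integral) measurable
  also have "\<dots> = ennreal (\<integral>x. (f x)\<^sup>2 \<partial>M) * ennreal (\<integral>x. (g x)\<^sup>2 \<partial>M)"
    using f g by (simp add: ennreal_power nn_integral_eq_integral)
  also have "\<dots> = ennreal ((\<integral>x. (f x)\<^sup>2 \<partial>M) * (\<integral>x. (g x)\<^sup>2 \<partial>M))"
    by (simp add: ennreal_mult)
  finally have "(\<integral>x. \<bar>f x * g x\<bar> \<partial>M)\<^sup>2 \<le> (\<integral>x. (f x)\<^sup>2 \<partial>M) * (\<integral>x. (g x)\<^sup>2 \<partial>M)"
    by (subst (asm) ennreal_le_iff) auto
  then show "(\<integral>x. \<bar>f x * g x\<bar> \<partial>M) \<le> sqrt (\<integral>x. (f x)\<^sup>2 \<partial>M) * sqrt (\<integral>x. (g x)\<^sup>2 \<partial>M)"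
    by (simp add: real_le_rsqrt flip: real_sqrt_mult)
qed

text \<open>The third identity is the second one multiplied by p. In
  \<open>sobolev_positive_part\<close> the third makes the powers of l agree, and the second makes
  the powers of X cancel at the end.\<close>

lemma crit_exp_facts:
  fixes \<alpha> p :: real and N :: nat
  assumes "5 \<le> N" "0 < \<alpha>" "\<alpha> < 2" "p = crit_exp N \<alpha>"
  shows "2 < p" "1 / p = 1 / 2 - (2 - \<alpha>) / N" "p * ((2 - \<alpha>) / N) + 1 = p / 2"
proof -
  have d: "0 < real N - 4 + 2 * \<alpha>" "0 < real N" using assms by auto
  have p: "p = 2 * real N / (real N - 4 + 2 * \<alpha>)" using assms(4) by (simp add: crit_exp_def)
  show p2: "2 < p" unfolding p using d assms by (simp add: field_simps)
  show inv: "1 / p = 1 / 2 - (2 - \<alpha>) / N" unfolding p using d by (simp add: field_simps)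
  have "1 = p * (1 / p)" using p2 by simp
  also have "\<dots> = p / 2 - p * ((2 - \<alpha>) / N)" by (simp only: inv right_diff_distrib)
  finally show "p * ((2 - \<alpha>) / N) + 1 = p / 2" by simp
qed

text \<open>The integral X of the p-th power of the positive part is finite because u is continuous
  with compact support, so half of a term can be absorbed and a power of X divided out. Chebyshev
  trades the surplus m(l)^\<theta> for X^\<theta>, and Cauchy-Schwarz bounds Y by the root of X
  times the norm of w.\<close>

lemma sobolev_positive_part:
  fixes \<alpha> p :: real
  assumes dim: "5 \<le> DIM('a::euclidean_space)" and \<alpha>: "0 < \<alpha>" "\<alpha> < 2" and p: "p = crit_exp DIM('a) \<alpha>"
  obtains C where "0 < C"
    "\<And>u :: 'a \<Rightarrow> real. u \<in> test_space \<alpha> \<Longrightarrow>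
       (\<integral>x. max 0 (u x) powr p \<partial>lborel) powr (1 / p) \<le> C * sqrt (div_energy \<alpha> u)"
proof -
  define \<theta> where "\<theta> = (2 - \<alpha>) / DIM('a)"
  note pf = crit_exp_facts[OF dim \<alpha> p, folded \<theta>_def]
  have dim2: "2 \<le> DIM('a)" using dim by simp
  obtain C where C: "0 < C" and decay: "\<And>(u :: 'a \<Rightarrow> real) l. u \<in> test_space \<alpha> \<Longrightarrow> 0 < l \<Longrightarrow>
       l * (measure lborel {x. 2 * l < u x})\<^sup>2
         \<le> C * measure lborel {x. l < u x} powr (1 + \<theta>)
             * (\<integral>x. indicator {x. l < u x} x * \<bar>wdiv \<alpha> u x\<bar> \<partial>lborel)"
    by (rule level_decay[OF \<alpha> dim2, folded \<theta>_def]) (rule that; blast)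
  \<comment> \<open>Passing from level 2l to level l in the integral over l costs exactly this
    factor. With the same number as weight in AM-GM, the first term on the right becomes half of the
    left side and is absorbed.\<close>
  define s :: real where "s = 2 powr (- p)"
  have s: "0 < s" by (simp add: s_def)
  define C' where "C' = 2 * C / s\<^sup>2"
  have C': "0 < C'" using C s by (simp add: C'_def)
  have "(\<integral>x. max 0 (u x) powr p \<partial>lborel) powr (1 / p) \<le> C' * sqrt (div_energy \<alpha> u)"
    if u: "u \<in> test_space \<alpha>" for u :: "'a \<Rightarrow> real"
  proof -
    obtain R where R: "\<And>x. R \<le> norm x \<Longrightarrow> u x = 0" using u by (auto simp: test_space_iff)
    have w: "integrable lborel (\<lambda>x. (wdiv \<alpha> u x)\<^sup>2)" and uk: "Ck_on k UNIV u" for k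
      using u by (auto simp: test_space_iff)
    note [measurable] = borel_measurable_test_space[OF u] and contu = Ck_on_imp_continuous_on[OF uk]
    let ?w = "wdiv \<alpha> u"
    define m where "m l = measure lborel {x. l < u x}" for l
    define W where "W l = (\<integral>x. indicator {x. l < u x} x * \<bar>?w x\<bar> \<partial>lborel)" for l
    define X where "X = (\<integral>x. max 0 (u x) powr p \<partial>lborel)"
    define Y where "Y = (\<integral>x. max 0 (u x) powr (p / 2) * \<bar>?w x\<bar> \<partial>lborel)"
    have contpow: "continuous_on UNIV (\<lambda>x. max 0 (u x) powr q)" if "0 < q" for q
      using that by (intro continuous_on_powr' continuous_intros contu) auto
    have uout: "max 0 (u x) powr q = 0" if "R \<le> norm x" for x q using R[OF that] by simp
    have intX: "integrable lborel (\<lambda>x. max 0 (u x) powr p)"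
      by (rule integrable_continuous_bounded_support[OF contpow uout]) (use pf in auto)
    obtain MU where MU: "\<And>x. \<bar>max 0 (u x) powr (p / 2)\<bar> \<le> MU"
    proof (rule bounded_continuous_bounded_support)
      show "continuous_on UNIV (\<lambda>x. max 0 (u x) powr (p / 2))" using contpow pf by simp
      show "max 0 (u x) powr (p / 2) = 0" if "R \<le> norm x" for x by (rule uout[OF that])
    qed (use that in blast)
    have intY: "integrable lborel (\<lambda>x. max 0 (u x) powr (p / 2) * ?w x)"
      by (rule integrable_bounded_support_mult_L2[OF _ _ w MU, where R = R]) (use R in auto)
    have intY': "integrable lborel (\<lambda>x. max 0 (u x) powr (p / 2) * \<bar>?w x\<bar>)"
      using integrable_abs[OF intY] by (simp add: abs_mult)
    have X0: "0 \<le> X" and Y0: "0 \<le> Y"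
      unfolding X_def Y_def by (intro Bochner_Integration.integral_nonneg; simp)+
    have sq: "(max 0 (u x) powr (p / 2))\<^sup>2 = max 0 (u x) powr p" for x
      by (cases "max 0 (u x) = 0") (simp_all add: powr_power)
    have YX: "Y \<le> sqrt X * sqrt (\<integral>x. (?w x)\<^sup>2 \<partial>lborel)"
      using Cauchy_Schwarz_integral_le(1)[of "\<lambda>x. max 0 (u x) powr (p / 2)" lborel ?w] intX w
      by (simp add: sq X_def Y_def abs_mult)
    have fin: "emeasure lborel {x. l < u x} < \<infinity>" if "0 < l" for l
    proof -
      have "norm x \<le> R" if "l < u x" for x
        using that R[of x] \<open>0 < l\<close> by (cases "R \<le> norm x") auto
      then have "emeasure lborel {x. l < u x} \<le> emeasure lborel (cball (0::'a) R)"
        by (intro emeasure_mono) auto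
      then show ?thesis using emeasure_lborel_cball_finite by (rule order.strict_trans1)
    qed
    have em: "(\<integral>\<^sup>+x. ennreal (indicator {x. l < u x} x * 1) \<partial>lborel) = ennreal (m l)" if "0 < l" for l
    proof -
      have "(\<integral>\<^sup>+x. ennreal (indicator {x. l < u x} x * 1) \<partial>lborel) = emeasure lborel {x. l < u x}"
        by (simp add: ennreal_indicator)
      then show ?thesis using fin[OF that] by (simp add: m_def emeasure_eq_ennreal_measure)
    qed
    have intW: "integrable lborel (\<lambda>x. indicator {x. l < u x} x * \<bar>?w x\<bar>)" if "0 < l" for l
    proof -
      have "integrable lborel (\<lambda>x. indicator {x. l < u x} x * ?w x)"
        by (rule integrable_bounded_support_mult_L2[OF _ _ w, where M = 1 and R = R])
          (use R that in \<open>auto simp: indicator_def\<close>)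
      from integrable_abs[OF this] show ?thesis by (simp add: abs_mult)
    qed
    have eW: "(\<integral>\<^sup>+x. ennreal (indicator {x. l < u x} x * \<bar>?w x\<bar>) \<partial>lborel) = ennreal (W l)" if "0 < l" for l
      using intW[OF that] by (simp add: W_def nn_integral_eq_integral)
    have m0: "0 \<le> m l" and W0: "0 \<le> W l" for l
      unfolding m_def W_def by (auto intro!: Bochner_Integration.integral_nonneg)
    have chebyshev: "m l * l powr p \<le> X" if l: "0 < l" for l
    proof -
      have "m l * l powr p = (\<integral>x. l powr p * indicator {x. l < u x} x \<partial>lborel)"
        by (simp add: m_def)
      also have "\<dots> \<le> X"
        unfolding X_def
      proof (rule integral_mono[OF _ intX])
        show "integrable lborel (\<lambda>x. l powr p * indicator {x. l < u x} x)"
          using fin[OF l] by (intro integrable_mult_right integrable_real_indicator) auto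
        show "l powr p * indicator {x. l < u x} x \<le> max 0 (u x) powr p" for x
          using l pf by (auto simp: indicator_def intro!: powr_mono2)
      qed
      finally show ?thesis .
    qed
    \<comment> \<open>The companion weight: s * c is the constant C X^\<theta> that appears under
      the root in \<open>key\<close>.\<close>
    define c where "c = C * X powr \<theta> / s"
    have c0: "0 \<le> c" using C s by (simp add: c_def)
    \<comment> \<open>The square of the left side is bounded by a product of the densities for X and
      Y; the geometric mean with weights s and c is then replaced by the arithmetic one.\<close>
    have key: "l powr (p - 1) * m (2 * l) \<le> (s * (l powr (p - 1) * m l) + c * (l powr (p / 2 - 1) * W l)) / 2"
      if l: "0 < l" for l
    proof -
      have "m l \<le> X * l powr (- p)"
        using chebyshev[OF l] l by (simp add: powr_minus field_simps)
      then have "m l powr \<theta> \<le> (X * l powr (- p)) powr \<theta>"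
        using m0 \<alpha> by (intro powr_mono2) (auto simp: \<theta>_def)
      also have "\<dots> = X powr \<theta> * l powr (- p * \<theta>)"
        using X0 by (simp add: powr_mult powr_powr)
      finally have "m l powr (1 + \<theta>) \<le> m l * (X powr \<theta> * l powr (- p * \<theta>))"
        using m0[of l] by (cases "m l = 0") (auto simp: powr_add intro!: mult_left_mono)
      then have "C * m l powr (1 + \<theta>) * W l \<le> C * (m l * (X powr \<theta> * l powr (- p * \<theta>))) * W l"
        using C W0 by (intro mult_right_mono mult_left_mono) auto
      with decay[OF u l] have d: "l * (m (2 * l))\<^sup>2 \<le> C * (m l * (X powr \<theta> * l powr (- p * \<theta>))) * W l"
        by (simp add: m_def W_def)
      have n: "0 \<le> s * (l powr (p - 1) * m l)" "0 \<le> c * (l powr (p / 2 - 1) * W l)"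
        using s c0 m0 W0 by auto
      \<comment> \<open>One power of l is reserved for the left side of \<open>level_decay\<close>.
        The identity p * \<theta> + 1 = p / 2 splits the remaining power into those of the densities
        for X and Y.\<close>
      have e1: "2 * p - 2 = (2 * p - 3) + 1" and e2: "(2 * p - 3) + - p * \<theta> = (p - 1) + (p / 2 - 1)"
        using pf(3) by (simp_all add: algebra_simps)
      have "(l powr (p - 1) * m (2 * l))\<^sup>2 = l powr (2 * p - 2) * (m (2 * l))\<^sup>2"
        using l by (simp add: power_mult_distrib powr_power)
      also have "\<dots> = l powr (2 * p - 3) * (l * (m (2 * l))\<^sup>2)"
        using l by (subst e1, subst powr_add) simp
      also have "\<dots> \<le> l powr (2 * p - 3) * (C * (m l * (X powr \<theta> * l powr (- p * \<theta>))) * W l)"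
        by (intro mult_left_mono d) simp
      also have "\<dots> = C * X powr \<theta> * (l powr (2 * p - 3) * l powr (- p * \<theta>)) * m l * W l"
        by (simp add: mult_ac)
      also have "l powr (2 * p - 3) * l powr (- p * \<theta>) = l powr (p - 1) * l powr (p / 2 - 1)"
        by (simp only: powr_add[symmetric] e2)
      also have "C * X powr \<theta> * (l powr (p - 1) * l powr (p / 2 - 1)) * m l * W l
          = (s * (l powr (p - 1) * m l)) * (c * (l powr (p / 2 - 1) * W l))"
        using s by (simp add: c_def mult_ac)
      finally have "l powr (p - 1) * m (2 * l)
          \<le> sqrt ((s * (l powr (p - 1) * m l)) * (c * (l powr (p / 2 - 1) * W l)))"
        by (rule real_le_rsqrt)
      also have "\<dots> \<le> (s * (l powr (p - 1) * m l) + c * (l powr (p / 2 - 1) * W l)) / 2"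
        by (rule arith_geo_mean_sqrt[OF n])
      finally show ?thesis .
    qed
    define A where "A l = ennreal (indicator {0<..} l * l powr (p - 1))
        * (\<integral>\<^sup>+x. ennreal (indicator {x. l < u x} x * 1) \<partial>lborel)" for l
    \<comment> \<open>The set where u exceeds 2l is written as the one where u / 2 exceeds l, so
      that the layer cake formula applies to u / 2.\<close>
    define A2 where "A2 l = ennreal (indicator {0<..} l * l powr (p - 1))
        * (\<integral>\<^sup>+x. ennreal (indicator {x. l < u x / 2} x * 1) \<partial>lborel)" for l
    define B where "B l = ennreal (indicator {0<..} l * l powr (p / 2 - 1))
        * (\<integral>\<^sup>+x. ennreal (indicator {x. l < u x} x * \<bar>?w x\<bar>) \<partial>lborel)" for l
    have [measurable]: "A \<in> borel_measurable borel" "B \<in> borel_measurable borel"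
      unfolding A_def[abs_def] B_def[abs_def] indicator_def mem_Collect_eq by measurable
    have "(\<integral>\<^sup>+l. A l \<partial>lborel) = (\<integral>\<^sup>+x. ennreal (max 0 (u x) powr p / p * 1) \<partial>lborel)"
      unfolding A_def by (rule layer_cake) (use pf in auto)
    also have "\<dots> = ennreal (X / p)"
      using intX pf by (simp add: X_def nn_integral_eq_integral)
    finally have intA: "(\<integral>\<^sup>+l. A l \<partial>lborel) = ennreal (X / p)" .
    have "(\<integral>\<^sup>+l. A2 l \<partial>lborel) = (\<integral>\<^sup>+x. ennreal (max 0 (u x / 2) powr p / p * 1) \<partial>lborel)"
      unfolding A2_def by (rule layer_cake) (use pf in auto)
    also have "\<dots> = (\<integral>\<^sup>+x. ennreal (s / p * max 0 (u x) powr p) \<partial>lborel)"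
    proof (rule nn_integral_cong)
      fix x
      have "max 0 (u x / 2) = max 0 (u x) / 2" by (simp add: max_def)
      then have "max 0 (u x / 2) powr p = (max 0 (u x) / 2) powr p" by (simp only:)
      also have "\<dots> = s * max 0 (u x) powr p"
        by (simp add: powr_divide s_def powr_minus field_simps)
      finally have "max 0 (u x / 2) powr p = s * max 0 (u x) powr p" .
      then show "ennreal (max 0 (u x / 2) powr p / p * 1) = ennreal (s / p * max 0 (u x) powr p)" by simp
    qed
    also have "\<dots> = ennreal (s * X / p)"
      using intX pf s by (simp add: X_def nn_integral_eq_integral)
    finally have intA2: "(\<integral>\<^sup>+l. A2 l \<partial>lborel) = ennreal (s * X / p)" .
    have "(\<integral>\<^sup>+l. B l \<partial>lborel) = (\<integral>\<^sup>+x. ennreal (max 0 (u x) powr (p / 2) / (p / 2) * \<bar>?w x\<bar>) \<partial>lborel)"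
      unfolding B_def by (rule layer_cake) (use pf in auto)
    also have "\<dots> = (\<integral>\<^sup>+x. ennreal (2 / p) * ennreal (max 0 (u x) powr (p / 2) * \<bar>?w x\<bar>) \<partial>lborel)"
      using pf by (intro nn_integral_cong) (simp add: field_simps flip: ennreal_mult)
    also have "\<dots> = ennreal (2 / p) * ennreal Y"
      using intY' by (subst nn_integral_cmult) (auto simp: Y_def nn_integral_eq_integral)
    also have "\<dots> = ennreal (2 / p * Y)" by (rule ennreal_mult[symmetric]) (use pf Y0 in auto)
    finally have intB: "(\<integral>\<^sup>+l. B l \<partial>lborel) = ennreal (2 / p * Y)" .
    have "A2 l \<le> ennreal (s / 2) * A l + ennreal (c / 2) * B l" for l
    proof (cases "0 < l")
      case True
      have set2: "{x. l < u x / 2} = {x. 2 * l < u x}" by auto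
      have "A2 l = ennreal (l powr (p - 1) * m (2 * l))"
      proof -
        have "0 < 2 * l" using True by simp
        from em[OF this] show ?thesis
          unfolding A2_def set2 using True m0 by (simp add: ennreal_mult del: mult_1_right)
      qed
      also have "\<dots> \<le> ennreal (s / 2 * (l powr (p - 1) * m l) + c / 2 * (l powr (p / 2 - 1) * W l))"
        using key[OF True] by (intro ennreal_leI) (simp add: field_simps)
      also have "\<dots> = ennreal (s / 2) * A l + ennreal (c / 2) * B l"
      proof -
        have "A l = ennreal (l powr (p - 1) * m l)"
          unfolding A_def em[OF True] using True m0 by (simp add: ennreal_mult)
        moreover have "B l = ennreal (l powr (p / 2 - 1) * W l)"
          unfolding B_def eW[OF True] using True W0 by (simp add: ennreal_mult)
        ultimately show ?thesis
          using s c0 m0 W0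
          by (simp only: ennreal_mult[symmetric] ennreal_plus[symmetric] mult_nonneg_nonneg powr_ge_zero
              divide_nonneg_nonneg less_imp_le zero_le_numeral)
      qed
      finally show ?thesis .
    qed (simp add: A2_def)
    then have "(\<integral>\<^sup>+l. A2 l \<partial>lborel) \<le> (\<integral>\<^sup>+l. ennreal (s / 2) * A l + ennreal (c / 2) * B l \<partial>lborel)"
      by (intro nn_integral_mono) auto
    also have "\<dots> = ennreal (s / 2) * ennreal (X / p) + ennreal (c / 2) * ennreal (2 / p * Y)"
      by (simp add: nn_integral_add nn_integral_cmult intA intB)
    also have "\<dots> = ennreal (s / 2 * (X / p) + c / 2 * (2 / p * Y))"
    proof -
      have "0 \<le> s / 2" "0 \<le> X / p" "0 \<le> c / 2" "0 \<le> 2 / p * Y" using s c0 X0 Y0 pf(1) by auto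
      then show ?thesis by (simp only: ennreal_mult[symmetric] ennreal_plus[symmetric] mult_nonneg_nonneg)
    qed
    finally have "s * X / p \<le> s / 2 * (X / p) + c / 2 * (2 / p * Y)"
      unfolding intA2 using s c0 X0 Y0 pf by (subst (asm) ennreal_le_iff) auto
    then have "s * X \<le> 2 * c * Y" using pf by (simp add: field_simps)
    then have "X \<le> C' * X powr \<theta> * Y"
      using s by (simp add: C'_def c_def power2_eq_square field_simps)
    also have "\<dots> \<le> C' * X powr \<theta> * (sqrt X * sqrt (\<integral>x. (?w x)\<^sup>2 \<partial>lborel))"
      using C' by (intro mult_left_mono YX) auto
    finally have XX: "X \<le> X powr (\<theta> + 1 / 2) * (C' * sqrt (\<integral>x. (?w x)\<^sup>2 \<partial>lborel))"
      using X0 by (simp add: powr_add powr_half_sqrt mult_ac)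
    show ?thesis
    proof (cases "X = 0")
      case True
      then show ?thesis using C' pf unfolding X_def by (simp add: Bochner_Integration.integral_nonneg)
    next
      case False
      then have X: "0 < X" using X0 by simp
      \<comment> \<open>The exponents \<theta> + 1/2 and 1/p add up to 1, so cancelling the common
        power leaves X to the power 1/p.\<close>
      have "X powr (\<theta> + 1 / 2) * X powr (1 / p) = X powr 1"
        unfolding powr_add[symmetric] using pf(2) by simp
      also have "\<dots> \<le> X powr (\<theta> + 1 / 2) * (C' * sqrt (\<integral>x. (?w x)\<^sup>2 \<partial>lborel))"
        using XX X by simp
      finally show ?thesis using X unfolding X_def[symmetric] by simp
    qed
  qed
  then show thesis using that C' by blast
qed

section \<open>Linearity of the operator and the inequality for all test functions\<close>

abbreviation (input) Lp_power :: "real \<Rightarrow> ('a::euclidean_space \<Rightarrow> real) \<Rightarrow> real" where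
  "Lp_power p f \<equiv> \<integral>x. \<bar>f x\<bar> powr p \<partial>lborel"

lemma has_derivative_lincomb:
  fixes f g :: "'a::real_normed_vector \<Rightarrow> real"
  assumes "(f has_derivative f') F" "(g has_derivative g') F"
  shows "((\<lambda>x. a * f x + b * g x) has_derivative (\<lambda>h. a * f' h + b * g' h)) F"
  by (intro has_derivative_add has_derivative_mult_right assms)

lemma dir_deriv_lincomb:
  assumes "u differentiable (at x)" "v differentiable (at x)"
  shows "dir_deriv (\<lambda>x. a * u x + b * v x) h x = a * dir_deriv u h x + b * dir_deriv v h x"
  using assms by (intro dir_deriv_eq has_derivative_lincomb) (auto simp: frechet_derivative_works)

text \<open>At nonzero x all coefficients are differentiable and the rule is linearity of the
  derivative. At the origin the field may fail to be differentiable, and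
  \<open>frechet_derivative\<close> is then an arbitrary value that need not depend linearly on
  u.\<close>

lemma wdiv_lincomb:
  fixes u v :: "'a::euclidean_space \<Rightarrow> real"
  assumes u: "Ck_on 2 (- {0}) u" and v: "Ck_on 2 (- {0}) v" and x: "x \<noteq> 0"
  shows "wdiv \<alpha> (\<lambda>x. a * u x + b * v x) x = a * wdiv \<alpha> u x + b * wdiv \<alpha> v x"
proof -
  note u2 = u[unfolded numeral_2_eq_2] and v2 = v[unfolded numeral_2_eq_2]
  let ?c = "\<lambda>u e y. norm y powr \<alpha> * dir_deriv u e y"
  have uv: "Ck_on (Suc (Suc 0)) (- {0}) (\<lambda>x. a * u x + b * v x)"
    by (intro Ck_on_add Ck_on_scale u2 v2) auto
  have "dir_deriv (?c (\<lambda>x. a * u x + b * v x) e) e x = a * dir_deriv (?c u e) e x + b * dir_deriv (?c v e) e x" for e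
  proof -
    have cu: "?c u e differentiable (at x)" and cv: "?c v e differentiable (at x)"
      using Ck_on_weighted_partial[OF u2] Ck_on_weighted_partial[OF v2] x by auto
    have "((\<lambda>y. a * ?c u e y + b * ?c v e y) has_derivative
        (\<lambda>h. a * dir_deriv (?c u e) h x + b * dir_deriv (?c v e) h x)) (at x)"
      using cu cv by (intro has_derivative_lincomb) (simp_all only: frechet_derivative_works)
    then have "(?c (\<lambda>x. a * u x + b * v x) e has_derivative
        (\<lambda>h. a * dir_deriv (?c u e) h x + b * dir_deriv (?c v e) h x)) (at x)"
    proof (rule has_derivative_transform_within_open)
      fix y :: 'a assume "y \<in> - {0}"
      then show "a * ?c u e y + b * ?c v e y = ?c (\<lambda>x. a * u x + b * v x) e y"
        using u2 v2 by (subst dir_deriv_lincomb) (auto simp: algebra_simps)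
    qed (use x in auto)
    then show ?thesis by (rule dir_deriv_eq)
  qed
  then show ?thesis
    by (simp add: wdiv_eq[OF uv x] wdiv_eq[OF u2 x] wdiv_eq[OF v2 x] sum.distrib sum_distrib_left)
qed

lemma wdiv_lincomb_AE:
  assumes "u \<in> test_space \<alpha>" "v \<in> test_space \<alpha>"
  shows "AE x in lborel. wdiv \<alpha> (\<lambda>x. a * u x + b * v x) x = a * wdiv \<alpha> u x + b * wdiv \<alpha> v x"
  using AE_lborel_singleton[of 0]
proof eventually_elim
  case (elim x)
  then show ?case using assms by (intro wdiv_lincomb) (auto simp: test_space_iff intro: Ck_on_subset)
qed

lemma test_space_lincomb:
  assumes u: "u \<in> test_space \<alpha>" and v: "v \<in> test_space \<alpha>"
  shows "(\<lambda>x. a * u x + b * v x) \<in> test_space \<alpha>"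
proof -
  note [measurable] = borel_measurable_test_space[OF u] borel_measurable_test_space[OF v]
  have ck: "Ck_on k UNIV (\<lambda>x. a * u x + b * v x)" for k
    using u v by (intro Ck_on_add Ck_on_scale) (auto simp: test_space_iff)
  obtain R S where R: "0 < R" "\<And>x. R \<le> norm x \<Longrightarrow> u x = 0" and S: "\<And>x. S \<le> norm x \<Longrightarrow> v x = 0"
    using u v by (auto simp: test_space_iff)
  have bd: "\<exists>R>0. \<forall>x. R \<le> norm x \<longrightarrow> a * u x + b * v x = 0"
    using R S by (intro exI[of _ "max R S"]) auto
  have m: "wdiv \<alpha> (\<lambda>x. a * u x + b * v x) \<in> borel_measurable borel"
    by (rule borel_measurable_wdiv[OF Ck_on_subset[OF ck]]) simp
  have "integrable lborel (\<lambda>x. (wdiv \<alpha> (\<lambda>x. a * u x + b * v x) x)\<^sup>2)"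
  proof (rule Bochner_Integration.integrable_bound)
    show "integrable lborel (\<lambda>x. 2 * a\<^sup>2 * (wdiv \<alpha> u x)\<^sup>2 + 2 * b\<^sup>2 * (wdiv \<alpha> v x)\<^sup>2)"
      using u v by (intro Bochner_Integration.integrable_add integrable_mult_right) (auto simp: test_space_iff)
    from wdiv_lincomb_AE[OF u v, of a b] show "AE x in lborel. norm ((wdiv \<alpha> (\<lambda>x. a * u x + b * v x) x)\<^sup>2)
        \<le> norm (2 * a\<^sup>2 * (wdiv \<alpha> u x)\<^sup>2 + 2 * b\<^sup>2 * (wdiv \<alpha> v x)\<^sup>2)"
    proof eventually_elim
      case (elim x)
      have "(s + t)\<^sup>2 \<le> 2 * s\<^sup>2 + 2 * t\<^sup>2" for s t :: real
        using zero_le_power2[of "s - t"] by (simp add: power2_sum power2_diff)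
      from this[of "a * wdiv \<alpha> u x" "b * wdiv \<alpha> v x"] show ?case
        unfolding elim by (simp add: power_mult_distrib)
    qed
  qed (use m in measurable)
  then show ?thesis using ck bd by (simp add: test_space_iff)
qed

text \<open>The p-th power of |u| is the sum of those of the positive parts of u and of -u, which
  have the same energy. The two summands give 2 to the power 2/p, and squaring the root form gives
  C^2.\<close>

lemma sobolev_test_space:
  fixes \<alpha> p :: real
  assumes dim: "5 \<le> DIM('a::euclidean_space)" and \<alpha>: "0 < \<alpha>" "\<alpha> < 2" and p: "p = crit_exp DIM('a) \<alpha>"
  obtains C where "0 < C"
    "\<And>u :: 'a \<Rightarrow> real. u \<in> test_space \<alpha> \<Longrightarrow> integrable lborel (\<lambda>x. \<bar>u x\<bar> powr p)"
    "\<And>u :: 'a \<Rightarrow> real. u \<in> test_space \<alpha> \<Longrightarrow>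
       Lp_power p u powr (2 / p) \<le> C * div_energy \<alpha> u"
proof -
  note pf = crit_exp_facts[OF dim \<alpha> p]
  obtain C where C: "0 < C" and pos: "\<And>u :: 'a \<Rightarrow> real. u \<in> test_space \<alpha> \<Longrightarrow>
       (\<integral>x. max 0 (u x) powr p \<partial>lborel) powr (1 / p) \<le> C * sqrt (div_energy \<alpha> u)"
    by (rule sobolev_positive_part[OF dim \<alpha> p]) (rule that; blast)
  define C' where "C' = 2 powr (2 / p) * C\<^sup>2"
  have int_max: "integrable lborel (\<lambda>x. max 0 (u x) powr p)" if u: "u \<in> test_space \<alpha>" for u :: "'a \<Rightarrow> real"
  proof -
    obtain R where R: "\<And>x. R \<le> norm x \<Longrightarrow> u x = 0" using u by (auto simp: test_space_iff)
    have "continuous_on UNIV u" using u Ck_on_imp_continuous_on by (auto simp: test_space_iff)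
    then show ?thesis
      using pf R by (intro integrable_continuous_bounded_support[of _ R] continuous_on_powr' continuous_intros) auto
  qed
  have split: "\<bar>t\<bar> powr p = max 0 t powr p + max 0 (- t) powr p" for t :: real
    by (cases "0 \<le> t") (auto simp: max_def)
  have neg: "(\<lambda>x. - u x) \<in> test_space \<alpha>" if "u \<in> test_space \<alpha>" for u :: "'a \<Rightarrow> real"
    using test_space_lincomb[OF that that, of "-1" 0] by simp
  show thesis
  proof (rule that[of C'])
    show "0 < C'" using C by (simp add: C'_def)
    fix u :: "'a \<Rightarrow> real" assume u: "u \<in> test_space \<alpha>"
    show "integrable lborel (\<lambda>x. \<bar>u x\<bar> powr p)"
      unfolding split by (intro Bochner_Integration.integrable_add int_max u neg)
    let ?w = "div_energy \<alpha> u"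
    have w0: "0 \<le> ?w" by simp
    from wdiv_lincomb_AE[OF u u, of "-1" 0] have wneg: "div_energy \<alpha> (\<lambda>x. - u x) = ?w"
      using borel_measurable_test_space[OF u] borel_measurable_test_space[OF neg[OF u]]
      by (intro integral_cong_AE) auto
    have root: "X \<le> (C * sqrt ?w) powr p" if "0 \<le> X" "X powr (1 / p) \<le> C * sqrt ?w" for X
    proof -
      have "X = (X powr (1 / p)) powr p" using that(1) pf(1) by (simp add: powr_powr)
      also have "\<dots> \<le> (C * sqrt ?w) powr p" using that pf by (intro powr_mono2) auto
      finally show ?thesis .
    qed
    have "(\<integral>x. max 0 (u x) powr p \<partial>lborel) \<le> (C * sqrt ?w) powr p"
      by (intro root pos u) simp
    moreover have "(\<integral>x. max 0 (- u x) powr p \<partial>lborel) \<le> (C * sqrt ?w) powr p"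
    proof (rule root)
      show "(\<integral>x. max 0 (- u x) powr p \<partial>lborel) powr (1 / p) \<le> C * sqrt ?w"
        unfolding wneg[symmetric]
        by (rule pos[OF neg[OF u]])
    qed simp
    ultimately have "Lp_power p u \<le> 2 * (C * sqrt ?w) powr p"
      unfolding split using int_max[OF u] int_max[OF neg[OF u]] by simp
    then have "Lp_power p u powr (2 / p) \<le> (2 * (C * sqrt ?w) powr p) powr (2 / p)"
      using pf by (intro powr_mono2) auto
    also have "\<dots> = 2 powr (2 / p) * (C * sqrt ?w) powr 2"
      using pf by (simp add: powr_mult powr_powr)
    also have "(C * sqrt ?w) powr 2 = C\<^sup>2 * ?w"
      using C w0 by (simp add: powr_numeral power_mult_distrib)
    finally show "Lp_power p u powr (2 / p) \<le> C' * ?w" by (simp add: C'_def mult.assoc)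
  qed
qed

section \<open>Closability\<close>

lemma L2_sum_bound:
  fixes f g :: "'a \<Rightarrow> real"
  assumes [measurable]: "f \<in> borel_measurable M" "g \<in> borel_measurable M"
    and f: "integrable M (\<lambda>x. (f x)\<^sup>2)" and g: "integrable M (\<lambda>x. (g x)\<^sup>2)"
  shows "integrable M (\<lambda>x. (f x + g x)\<^sup>2)"
    and "(\<integral>x. (f x + g x)\<^sup>2 \<partial>M) \<le> 2 * (\<integral>x. (f x)\<^sup>2 \<partial>M) + 2 * (\<integral>x. (g x)\<^sup>2 \<partial>M)"
proof -
  have b: "(s + t)\<^sup>2 \<le> 2 * s\<^sup>2 + 2 * t\<^sup>2" for s t :: real
    using zero_le_power2[of "s - t"] by (simp add: power2_sum power2_diff)
  have i: "integrable M (\<lambda>x. 2 * (f x)\<^sup>2 + 2 * (g x)\<^sup>2)"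
    by (intro Bochner_Integration.integrable_add integrable_mult_right f g)
  show j: "integrable M (\<lambda>x. (f x + g x)\<^sup>2)"
    by (rule Bochner_Integration.integrable_bound[OF i]) (use b in \<open>auto simp: abs_of_nonneg\<close>)
  have "(\<integral>x. (f x + g x)\<^sup>2 \<partial>M) \<le> (\<integral>x. 2 * (f x)\<^sup>2 + 2 * (g x)\<^sup>2 \<partial>M)"
    by (rule integral_mono[OF j i b])
  also have "\<dots> = 2 * (\<integral>x. (f x)\<^sup>2 \<partial>M) + 2 * (\<integral>x. (g x)\<^sup>2 \<partial>M)"
    using f g by simp
  finally show "(\<integral>x. (f x + g x)\<^sup>2 \<partial>M) \<le> 2 * (\<integral>x. (f x)\<^sup>2 \<partial>M) + 2 * (\<integral>x. (g x)\<^sup>2 \<partial>M)" .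
qed

lemma L2_diff_bound:
  fixes f g :: "'a \<Rightarrow> real"
  assumes "f \<in> borel_measurable M" "g \<in> borel_measurable M"
    and "integrable M (\<lambda>x. (f x)\<^sup>2)" "integrable M (\<lambda>x. (g x)\<^sup>2)"
  shows "integrable M (\<lambda>x. (f x - g x)\<^sup>2)"
    and "(\<integral>x. (f x - g x)\<^sup>2 \<partial>M) \<le> 2 * (\<integral>x. (f x)\<^sup>2 \<partial>M) + 2 * (\<integral>x. (g x)\<^sup>2 \<partial>M)"
  using L2_sum_bound[of f M "\<lambda>x. - g x"] assms by simp_all

lemma Cauchy_Schwarz_integral_abs:
  fixes f g :: "'a \<Rightarrow> real"
  assumes "f \<in> borel_measurable M" "g \<in> borel_measurable M"
    and "integrable M (\<lambda>x. (f x)\<^sup>2)" "integrable M (\<lambda>x. (g x)\<^sup>2)"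
  shows "\<bar>\<integral>x. f x * g x \<partial>M\<bar> \<le> sqrt (\<integral>x. (f x)\<^sup>2 \<partial>M) * sqrt (\<integral>x. (g x)\<^sup>2 \<partial>M)"
  by (rule order_trans[OF integral_abs_bound Cauchy_Schwarz_integral_le(1)[OF assms]])

text \<open>For fixed m the pairing of \<open>w n\<close> with \<open>w m\<close> tends to 0, since
  the \<open>z m j\<close> approximate \<open>w m\<close> and the norms of \<open>w n\<close> stay
  bounded. The squared norm of \<open>w m\<close> is its pairing with \<open>w m\<close> -
  \<open>w n\<close>, small by the Cauchy property, plus its pairing with \<open>w n\<close>. The
  limit in L^2 is never named.\<close>

lemma L2_Cauchy_weakly_null:
  fixes w :: "nat \<Rightarrow> 'a \<Rightarrow> real" and z :: "nat \<Rightarrow> nat \<Rightarrow> 'a \<Rightarrow> real"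
  assumes w[measurable]: "\<And>n. w n \<in> borel_measurable M" and z[measurable]: "\<And>m j. z m j \<in> borel_measurable M"
    and w2: "\<And>n. integrable M (\<lambda>x. (w n x)\<^sup>2)" and z2: "\<And>m j. integrable M (\<lambda>x. (z m j x)\<^sup>2)"
    and cauchy: "\<And>e. 0 < e \<Longrightarrow> \<exists>N. \<forall>m\<ge>N. \<forall>n\<ge>N. (\<integral>x. (w m x - w n x)\<^sup>2 \<partial>M) < e"
    and null: "\<And>m j. (\<lambda>n. \<integral>x. w n x * z m j x \<partial>M) \<longlonglongrightarrow> 0"
    and appr: "\<And>m. (\<lambda>j. \<integral>x. (w m x - z m j x)\<^sup>2 \<partial>M) \<longlonglongrightarrow> 0"
  shows "(\<lambda>n. \<integral>x. (w n x)\<^sup>2 \<partial>M) \<longlonglongrightarrow> 0"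
proof -
  let ?n = "\<lambda>f. sqrt (\<integral>x. (f x)\<^sup>2 \<partial>M)"
  obtain N where N: "\<And>m n. N \<le> m \<Longrightarrow> N \<le> n \<Longrightarrow> (\<integral>x. (w m x - w n x)\<^sup>2 \<partial>M) < 1"
    using cauchy[of 1] by auto
  \<comment> \<open>A bound for the norms from index N on, where the squared distance to
    \<open>w N\<close> is below 1.\<close>
  define K where "K = sqrt (2 + 2 * (\<integral>x. (w N x)\<^sup>2 \<partial>M))"
  have K0: "0 < K" unfolding K_def by (simp add: add_pos_nonneg)
  have K: "?n (w n) \<le> K" if "N \<le> n" for n
  proof -
    have "(\<integral>x. (w n x)\<^sup>2 \<partial>M) = (\<integral>x. ((w n x - w N x) + w N x)\<^sup>2 \<partial>M)" by simp
    also have "\<dots> \<le> 2 * (\<integral>x. (w n x - w N x)\<^sup>2 \<partial>M) + 2 * (\<integral>x. (w N x)\<^sup>2 \<partial>M)"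
      by (intro L2_sum_bound(2) L2_diff_bound(1) w2) measurable
    finally show ?thesis using N[OF that, of N] unfolding K_def by (intro real_sqrt_le_mono) simp
  qed
  have wm: "(\<lambda>n. \<integral>x. w n x * w m x \<partial>M) \<longlonglongrightarrow> 0" for m
  proof (rule LIMSEQ_I)
    fix e :: real assume e: "0 < e"
    have "(\<lambda>j. K * ?n (\<lambda>x. w m x - z m j x)) \<longlonglongrightarrow> K * sqrt 0"
      by (intro tendsto_intros appr)
    then have "eventually (\<lambda>j. K * ?n (\<lambda>x. w m x - z m j x) < e / 2) sequentially"
      using e by (intro order_tendstoD) auto
    then obtain j where j: "K * ?n (\<lambda>x. w m x - z m j x) < e / 2"
      by (auto simp: eventually_sequentially)
    obtain N1 where N1: "\<And>n. N1 \<le> n \<Longrightarrow> \<bar>\<integral>x. w n x * z m j x \<partial>M\<bar> < e / 2"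
      using LIMSEQ_D[OF null[of m j], of "e / 2"] e by auto
    show "\<exists>no. \<forall>n\<ge>no. norm ((\<integral>x. w n x * w m x \<partial>M) - 0) < e"
    proof (intro exI allI impI)
      fix n assume n: "max N N1 \<le> n"
      have d2: "integrable M (\<lambda>x. (w m x - z m j x)\<^sup>2)" by (intro L2_diff_bound(1) w2 z2) measurable
      have "(\<integral>x. w n x * w m x \<partial>M) = (\<integral>x. w n x * z m j x + w n x * (w m x - z m j x) \<partial>M)"
        by (simp add: algebra_simps)
      also have "\<dots> = (\<integral>x. w n x * z m j x \<partial>M) + (\<integral>x. w n x * (w m x - z m j x) \<partial>M)"
        by (intro Bochner_Integration.integral_add Cauchy_Schwarz_integral_le(2) w2 z2 d2) measurable
      also have "\<bar>\<dots>\<bar> \<le> \<bar>\<integral>x. w n x * z m j x \<partial>M\<bar> + \<bar>\<integral>x. w n x * (w m x - z m j x) \<partial>M\<bar>"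
        by (rule abs_triangle_ineq)
      also have "\<dots> < e / 2 + e / 2"
      proof (rule add_strict_mono)
        show "\<bar>\<integral>x. w n x * z m j x \<partial>M\<bar> < e / 2" using N1 n by simp
        have "\<bar>\<integral>x. w n x * (w m x - z m j x) \<partial>M\<bar> \<le> ?n (w n) * ?n (\<lambda>x. w m x - z m j x)"
          by (intro Cauchy_Schwarz_integral_abs w2 d2) measurable
        also have "\<dots> \<le> K * ?n (\<lambda>x. w m x - z m j x)"
          using K n by (intro mult_right_mono) auto
        finally show "\<bar>\<integral>x. w n x * (w m x - z m j x) \<partial>M\<bar> < e / 2" using j by simp
      qed
      finally show "norm ((\<integral>x. w n x * w m x \<partial>M) - 0) < e" by simp
    qed
  qed
  show ?thesis
  proof (rule LIMSEQ_I)
    fix e :: real assume e: "0 < e"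
    have "0 < (e / (2 * K))\<^sup>2" using e K0 by simp
    then obtain N1 where N1: "\<And>m n. N1 \<le> m \<Longrightarrow> N1 \<le> n \<Longrightarrow> (\<integral>x. (w m x - w n x)\<^sup>2 \<partial>M) < (e / (2 * K))\<^sup>2"
      using cauchy by blast
    show "\<exists>no. \<forall>m\<ge>no. norm ((\<integral>x. (w m x)\<^sup>2 \<partial>M) - 0) < e"
    proof (intro exI allI impI)
      fix m assume m: "max N N1 \<le> m"
      obtain N2 where N2: "\<And>n. N2 \<le> n \<Longrightarrow> \<bar>\<integral>x. w n x * w m x \<partial>M\<bar> < e / 2"
        using LIMSEQ_D[OF wm[of m], of "e / 2"] e by auto
      \<comment> \<open>The index n is chosen after m because N2 depends on m.\<close>
      define n where "n = max N1 N2"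
      have d2: "integrable M (\<lambda>x. (w m x - w n x)\<^sup>2)" by (intro L2_diff_bound(1) w2) measurable
      have "(\<integral>x. (w m x)\<^sup>2 \<partial>M) = (\<integral>x. w m x * (w m x - w n x) + w n x * w m x \<partial>M)"
        by (simp add: power2_eq_square algebra_simps)
      also have "\<dots> = (\<integral>x. w m x * (w m x - w n x) \<partial>M) + (\<integral>x. w n x * w m x \<partial>M)"
        by (intro Bochner_Integration.integral_add Cauchy_Schwarz_integral_le(2) w2 d2) measurable
      also have "\<dots> < e / 2 + e / 2"
      proof (rule add_strict_mono)
        show "(\<integral>x. w n x * w m x \<partial>M) < e / 2" using N2[of n] by (simp add: n_def)
        have "\<bar>\<integral>x. w m x * (w m x - w n x) \<partial>M\<bar> \<le> ?n (w m) * ?n (\<lambda>x. w m x - w n x)"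
          by (intro Cauchy_Schwarz_integral_abs w2 d2) measurable
        also have "\<dots> \<le> K * ?n (\<lambda>x. w m x - w n x)"
          using K m by (intro mult_right_mono) auto
        also have "?n (\<lambda>x. w m x - w n x) < e / (2 * K)"
          using N1[of m n] m e K0 by (intro real_less_lsqrt) (auto simp: n_def)
        then have "K * ?n (\<lambda>x. w m x - w n x) < e / 2" using K0 by (simp add: field_simps)
        finally show "(\<integral>x. w m x * (w m x - w n x) \<partial>M) < e / 2" by linarith
      qed
      finally show "norm ((\<integral>x. (w m x)\<^sup>2 \<partial>M) - 0) < e" by simp
    qed
  qed
qed

text \<open>If t exceeds s, then t^(1-p) is at most s^(1-p). Integrated over a ball this bounds an
  L^1 norm by a small multiple of the volume plus a multiple of the integral of the p-th
  power.\<close>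

lemma le_add_powr:
  fixes s t p :: real
  assumes "0 < s" "0 \<le> t" "1 \<le> p"
  shows "t \<le> s + s powr (1 - p) * t powr p"
proof (cases "t \<le> s")
  case False
  have "t = t powr (1 - p) * t powr p" using False assms by (simp flip: powr_add)
  also have "\<dots> \<le> s powr (1 - p) * t powr p"
    using False assms by (intro mult_right_mono powr_mono2') auto
  finally show ?thesis using assms by simp
next
  case True
  then show ?thesis by (simp add: add_increasing2)
qed

lemma Lp_null_imp_weakly_null:
  fixes f :: "nat \<Rightarrow> 'a::euclidean_space \<Rightarrow> real"
  assumes [measurable]: "\<And>n. f n \<in> borel_measurable borel" "h \<in> borel_measurable borel" and p: "1 \<le> p"
    and f: "\<And>n. integrable lborel (\<lambda>x. \<bar>f n x\<bar> powr p)" "(\<lambda>n. Lp_power p (f n)) \<longlonglongrightarrow> 0"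
    and h: "\<And>x. \<bar>h x\<bar> \<le> M" "\<And>x. R < norm x \<Longrightarrow> h x = 0"
  shows "(\<lambda>n. \<integral>x. f n x * h x \<partial>lborel) \<longlonglongrightarrow> 0"
proof (rule LIMSEQ_I)
  fix e :: real assume e: "0 < e"
  have M: "0 \<le> M" using h(1)[of 0] by linarith
  let ?B = "cball (0::'a) R"
  define b where "b = measure lborel ?B"
  have b: "0 \<le> b" by (simp add: b_def)
  \<comment> \<open>Makes M * s * b smaller than e / 2, where the added 1 covers M * b = 0. Once s
    is fixed, the term with the p-th power is small for large n.\<close>
  define s where "s = e / (2 * (M * b + 1))"
  have s: "0 < s" unfolding s_def using e M b by (intro divide_pos_pos) (auto simp: add_nonneg_pos)
  have sb: "M * s * b < e / 2 + 0"
  proof -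
    have "M * b < M * b + 1" by simp
    then have "M * b / (M * b + 1) < 1" using M b by (simp add: add_nonneg_pos)
    then have "e / 2 * (M * b / (M * b + 1)) < e / 2 * 1" using e by (intro mult_strict_left_mono) auto
    then show ?thesis by (simp add: s_def field_simps)
  qed
  have "(\<lambda>n. M * s powr (1 - p) * Lp_power p (f n)) \<longlonglongrightarrow> M * s powr (1 - p) * 0"
    by (intro tendsto_intros f)
  then have "eventually (\<lambda>n. M * s powr (1 - p) * Lp_power p (f n) < e / 2) sequentially"
    using e by (intro order_tendstoD) auto
  then obtain N where N: "\<And>n. N \<le> n \<Longrightarrow> M * s powr (1 - p) * Lp_power p (f n) < e / 2"
    by (auto simp: eventually_sequentially)
  show "\<exists>no. \<forall>n\<ge>no. norm ((\<integral>x. f n x * h x \<partial>lborel) - 0) < e"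
  proof (intro exI allI impI)
    fix n assume n: "N \<le> n"
    let ?g = "\<lambda>x. M * s * indicator ?B x + M * s powr (1 - p) * \<bar>f n x\<bar> powr p"
    have ig: "integrable lborel ?g"
      by (intro Bochner_Integration.integrable_add integrable_mult_right integrable_indicator_cball f)
    have bound: "\<bar>f n x * h x\<bar> \<le> ?g x" for x
    proof (cases "norm x \<le> R")
      case True
      have "\<bar>f n x * h x\<bar> \<le> (s + s powr (1 - p) * \<bar>f n x\<bar> powr p) * M"
        unfolding abs_mult using le_add_powr[OF s _ p, of "\<bar>f n x\<bar>"] h(1)[of x] s by (intro mult_mono) auto
      then show ?thesis using True by (simp add: algebra_simps)
    next
      case False
      then show ?thesis using h(2)[of x] M s by simp
    qed
    have ifh: "integrable lborel (\<lambda>x. f n x * h x)"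
      by (rule Bochner_Integration.integrable_bound[OF ig])
        (measurable, intro AE_I2, unfold real_norm_def, rule order_trans[OF bound abs_ge_self])
    have "\<bar>\<integral>x. f n x * h x \<partial>lborel\<bar> \<le> (\<integral>x. \<bar>f n x * h x\<bar> \<partial>lborel)" by (rule integral_abs_bound)
    also have "\<dots> \<le> (\<integral>x. ?g x \<partial>lborel)"
      by (rule integral_mono[OF integrable_abs[OF ifh] ig bound])
    also have "\<dots> = M * s * b + M * s powr (1 - p) * Lp_power p (f n)"
      using f(1) integrable_indicator_cball[of "0::'a" R]
      by (subst Bochner_Integration.integral_add) (auto simp: b_def)
    also have "\<dots> < e" using sb N[OF n] by simp
    finally show "norm ((\<integral>x. f n x * h x \<partial>lborel) - 0) < e" by simp
  qed
qed

lemma continuous_if_vanishing_near_0: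
  fixes f :: "'a::euclidean_space \<Rightarrow> real"
  assumes "continuous_on (- {0}) f" "0 < \<epsilon>" "\<And>x. norm x < \<epsilon> \<Longrightarrow> f x = 0"
  shows "continuous_on UNIV f"
proof -
  have "continuous_on (ball 0 \<epsilon>) f"
    by (rule continuous_on_eq[OF continuous_on_const[of _ 0]]) (use assms(3) in auto)
  then have "continuous_on (- {0} \<union> ball 0 \<epsilon>) f"
    by (intro continuous_on_open_Un assms(1)) auto
  moreover have "- {0} \<union> ball (0::'a) \<epsilon> = UNIV" using assms(2) by auto
  ultimately show ?thesis by simp
qed

text \<open>Integration by parts is applied twice with u and \<zeta> exchanged, and the weighted
  pairing of the gradients cancels. Vanishing of \<zeta> near 0 serves both applications. Class C^2
  is the right demand because \<zeta> will contain the factor \<open>cutoff\<close>.\<close>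

lemma wdiv_symmetric:
  fixes u \<zeta> :: "'a::euclidean_space \<Rightarrow> real"
  assumes u: "u \<in> test_space \<alpha>" and \<zeta>: "Ck_on 2 UNIV \<zeta>"
    and \<epsilon>: "0 < \<epsilon>" "\<And>x. norm x < \<epsilon> \<Longrightarrow> \<zeta> x = 0" and R: "\<And>x. R \<le> norm x \<Longrightarrow> \<zeta> x = 0"
  shows "(\<integral>x. wdiv \<alpha> u x * \<zeta> x \<partial>lborel) = (\<integral>x. u x * wdiv \<alpha> \<zeta> x \<partial>lborel)"
proof -
  obtain Ru where Ru: "\<And>x. Ru \<le> norm x \<Longrightarrow> u x = 0" using u by (auto simp: test_space_iff)
  have u2: "Ck_on 2 UNIV u" and w2: "integrable lborel (\<lambda>x. (wdiv \<alpha> u x)\<^sup>2)"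
    using u by (auto simp: test_space_iff)
  note \<zeta>' = \<zeta>[unfolded numeral_2_eq_2] and u' = u2[unfolded numeral_2_eq_2]
  let ?S = "\<lambda>x. norm x powr \<alpha> * (\<Sum>b\<in>Basis. dir_deriv \<zeta> b x * dir_deriv u b x)"
  let ?S' = "\<lambda>x. norm x powr \<alpha> * (\<Sum>b\<in>Basis. dir_deriv u b x * dir_deriv \<zeta> b x)"
  have dz: "dir_deriv \<zeta> b x = 0" if "norm x < \<epsilon>" for b x
    by (rule dir_deriv_eq_0_on_open[OF open_ball[of 0 \<epsilon>]]) (use \<epsilon>(2) that in auto)
  have dz': "dir_deriv \<zeta> b x = 0" if "R + 1 \<le> norm x" for b x
    by (rule dir_deriv_eq_0_outside[of R]) (use R that in auto)
  have intS: "integrable lborel ?S"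
  proof (rule integrable_continuous_bounded_support)
    show "continuous_on UNIV ?S"
    proof (rule continuous_if_vanishing_near_0[OF _ \<epsilon>(1)])
      show "continuous_on (- {0}) ?S"
        by (intro continuous_on_mult continuous_on_sum Ck_on_imp_continuous_on[OF Ck_on_norm_powr[of 0]]
            continuous_on_subset[OF Ck_on_1_dir_deriv_continuous[OF \<zeta>']]
            continuous_on_subset[OF Ck_on_1_dir_deriv_continuous[OF u']]) auto
    qed (use dz in simp)
    show "?S x = 0" if "R + 1 \<le> norm x" for x using dz'[OF that] by simp
  qed
  have contz: "continuous_on UNIV \<zeta>" using Ck_on_imp_continuous_on[OF \<zeta>] .
  have contu: "continuous_on UNIV u" using Ck_on_imp_continuous_on[OF u2] .
  have intz: "integrable lborel (\<lambda>x. \<zeta> x * wdiv \<alpha> u x)"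
  proof -
    obtain M where "\<And>x. \<bar>\<zeta> x\<bar> \<le> M"
      using bounded_continuous_bounded_support[OF contz R] by blast
    then show ?thesis
      using R by (intro integrable_bounded_support_mult_L2[OF borel_measurable_continuous_onI[OF contz]
          borel_measurable_test_space(2)[OF u] w2, where R = R]) auto
  qed
  have intu: "integrable lborel (\<lambda>x. u x * wdiv \<alpha> \<zeta> x)"
  proof (rule integrable_continuous_bounded_support)
    show "continuous_on UNIV (\<lambda>x. u x * wdiv \<alpha> \<zeta> x)"
    proof (rule continuous_if_vanishing_near_0[OF _ \<epsilon>(1)])
      show "continuous_on (- {0}) (\<lambda>x. u x * wdiv \<alpha> \<zeta> x)"
        by (intro continuous_on_mult continuous_on_subset[OF contu]
            Ck_on_imp_continuous_on[OF Ck_on_wdiv[OF Ck_on_subset[OF \<zeta>']]]) auto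
      show "u x * wdiv \<alpha> \<zeta> x = 0" if "norm x < \<epsilon>" for x
        using wdiv_eq_0_on_open[OF open_ball[of 0 \<epsilon>], of \<zeta> x] \<epsilon>(2) that by simp
    qed
    show "u x * wdiv \<alpha> \<zeta> x = 0" if "Ru \<le> norm x" for x using Ru[OF that] by simp
  qed
  have "(\<integral>x. \<zeta> x * wdiv \<alpha> u x + ?S x \<partial>lborel) = 0"
    by (rule integral_div_eq_0[where \<epsilon> = \<epsilon> and R = R])
      (use \<epsilon> R in \<open>auto intro: Ck_on_subset[OF u2] Ck_on_subset[OF Ck_on_mono[OF \<zeta>]] simp del: Ck_on.simps One_nat_def\<close>)
  moreover have "(\<integral>x. u x * wdiv \<alpha> \<zeta> x + ?S' x \<partial>lborel) = 0"
    by (rule integral_div_eq_0[where \<epsilon> = \<epsilon> and R = Ru])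
      (use \<epsilon>(1) dz Ru in \<open>auto intro: Ck_on_subset[OF \<zeta>] Ck_on_subset[OF Ck_on_mono[OF u2]] simp del: Ck_on.simps One_nat_def\<close>)
  moreover have "?S' x = ?S x" for x by (simp add: mult.commute[of "dir_deriv u _ _"])
  ultimately have "(\<integral>x. \<zeta> x * wdiv \<alpha> u x \<partial>lborel) = (\<integral>x. u x * wdiv \<alpha> \<zeta> x \<partial>lborel)"
    using intS intz intu by simp
  then show ?thesis by (simp only: mult.commute[of "wdiv \<alpha> u _"])
qed

lemma wdiv_closable:
  fixes \<eta> :: "nat \<Rightarrow> 'a::euclidean_space \<Rightarrow> real"
  assumes \<eta>: "\<And>n. \<eta> n \<in> test_space \<alpha>" and p: "1 \<le> p"
    and \<eta>p: "\<And>n. integrable lborel (\<lambda>x. \<bar>\<eta> n x\<bar> powr p)" "(\<lambda>n. Lp_power p (\<eta> n)) \<longlonglongrightarrow> 0"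
    and cauchy: "\<And>e. 0 < e \<Longrightarrow> \<exists>N. \<forall>m\<ge>N. \<forall>n\<ge>N. (\<integral>x. (wdiv \<alpha> (\<eta> m) x - wdiv \<alpha> (\<eta> n) x)\<^sup>2 \<partial>lborel) < e"
  shows "(\<lambda>n. \<integral>x. (wdiv \<alpha> (\<eta> n) x)\<^sup>2 \<partial>lborel) \<longlonglongrightarrow> 0"
proof (rule L2_Cauchy_weakly_null)
  let ?\<delta> = "\<lambda>j. inverse (real (Suc j))"
  let ?w = "\<lambda>m. wdiv \<alpha> (\<eta> m)"
  let ?z = "\<lambda>m j x. cutoff (?\<delta> j) x * ?w m x"
  have \<delta>: "0 < ?\<delta> j" for j by simp
  have w2: "integrable lborel (\<lambda>x. (?w n x)\<^sup>2)" for n using \<eta>[of n] by (simp add: test_space_iff)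
  note [measurable] = borel_measurable_test_space[OF \<eta>]
  have [measurable]: "cutoff d \<in> borel_measurable (borel :: 'a measure)" for d
    by (rule borel_measurable_continuous_onI[OF Ck_on_imp_continuous_on[OF Ck_on_cutoff]])
  show "?w n \<in> borel_measurable lborel" "?z m j \<in> borel_measurable lborel" for n m j by measurable
  show "integrable lborel (\<lambda>x. (?w n x)\<^sup>2)" for n by (rule w2)
  have zw: "(?z m j x)\<^sup>2 \<le> (?w m x)\<^sup>2" "(?w m x - ?z m j x)\<^sup>2 \<le> (?w m x)\<^sup>2" for m j x
  proof -
    have b: "(c * t)\<^sup>2 \<le> t\<^sup>2" if "0 \<le> c" "c \<le> 1" for c t :: real
      using that mult_right_mono[OF power_le_one[OF that, of 2], of "t\<^sup>2"] by (simp add: power_mult_distrib)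
    show "(?z m j x)\<^sup>2 \<le> (?w m x)\<^sup>2" by (intro b cutoff_bounds)
    have "((1 - cutoff (?\<delta> j) x) * ?w m x)\<^sup>2 \<le> (?w m x)\<^sup>2"
      using cutoff_bounds[of "?\<delta> j" x] by (intro b) auto
    then show "(?w m x - ?z m j x)\<^sup>2 \<le> (?w m x)\<^sup>2" by (simp add: algebra_simps)
  qed
  show "integrable lborel (\<lambda>x. (?z m j x)\<^sup>2)" for m j
    by (rule Bochner_Integration.integrable_bound[OF w2[of m]]) (use zw(1) in \<open>auto simp: abs_of_nonneg\<close>)
  show "\<exists>N. \<forall>m\<ge>N. \<forall>n\<ge>N. (\<integral>x. (?w m x - ?w n x)\<^sup>2 \<partial>lborel) < e" if "0 < e" for e
    by (rule cauchy[OF that])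
  show "(\<lambda>j. \<integral>x. (?w m x - ?z m j x)\<^sup>2 \<partial>lborel) \<longlonglongrightarrow> 0" for m
  proof -
    have "(\<lambda>j. \<integral>x. (?w m x - ?z m j x)\<^sup>2 \<partial>lborel) \<longlonglongrightarrow> (\<integral>x. 0 \<partial>(lborel :: 'a measure))"
    proof (rule integral_dominated_convergence[where w = "\<lambda>x. (?w m x)\<^sup>2"])
      show "AE x in lborel. (\<lambda>j. (?w m x - ?z m j x)\<^sup>2) \<longlonglongrightarrow> 0"
        using AE_lborel_singleton[of "0::'a"]
      proof eventually_elim
        case (elim x)
        have "(\<lambda>j. (?w m x - ?z m j x)\<^sup>2) \<longlonglongrightarrow> (?w m x - 1 * ?w m x)\<^sup>2"
          by (intro tendsto_intros cutoff_tendsto_1 elim)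
        then show ?case by simp
      qed
    qed (use zw(2) w2 in \<open>auto simp: abs_of_nonneg\<close>)
    then show ?thesis by simp
  qed
  show "(\<lambda>n. \<integral>x. ?w n x * ?z m j x \<partial>lborel) \<longlonglongrightarrow> 0" for m j
  proof -
    let ?\<zeta> = "?z m j"
    have inside: "?\<zeta> x = 0" if "norm x < ?\<delta> j" for x
      using cutoff_eq_0[OF \<delta>, of x j] that by simp
    obtain R where R: "\<And>x. R \<le> norm x \<Longrightarrow> \<eta> m x = 0" using \<eta>[of m] by (auto simp: test_space_iff)
    have outside: "?\<zeta> x = 0" if "R + 1 \<le> norm x" for x
      using wdiv_eq_0_on_open[OF open_norm_greater[of R], of "\<eta> m" x] R that by simp
    have ck: "Ck_on 2 UNIV ?\<zeta>"
    proof -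
      \<comment> \<open>Of the four orders two are used up by \<open>wdiv\<close>, and two remain so
        that \<open>wdiv\<close> can be applied to the truncated image again.\<close>
      have "Ck_on (Suc (Suc 2)) (- {0}) (\<eta> m)"
        using \<eta>[of m] Ck_on_subset unfolding test_space_iff by blast
      then have "Ck_on 2 (- {0}) ?\<zeta>"
        by (intro Ck_on_mult Ck_on_wdiv Ck_on_subset[OF Ck_on_cutoff]) auto
      moreover have "Ck_on 2 (ball 0 (?\<delta> j)) ?\<zeta>"
        by (rule Ck_on_cong[OF _ Ck_on_const[of _ _ 0]]) (use inside in auto)
      ultimately have "Ck_on 2 (- {0} \<union> ball 0 (?\<delta> j)) ?\<zeta>" by (intro Ck_on_Un) auto
      moreover have "- {0} \<union> ball (0::'a) (?\<delta> j) = UNIV" using \<delta>[of j] by auto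
      ultimately show ?thesis by simp
    qed
    \<comment> \<open>Continuity together with compact support makes this function bounded, so
      pairing it with a sequence that is null in L^p gives a null sequence.\<close>
    have wz_cont: "continuous_on UNIV (wdiv \<alpha> ?\<zeta>)"
    proof (rule continuous_if_vanishing_near_0[OF _ \<delta>[of j]])
      show "continuous_on (- {0}) (wdiv \<alpha> ?\<zeta>)"
        by (rule Ck_on_imp_continuous_on[OF Ck_on_wdiv[OF Ck_on_subset[OF ck[unfolded numeral_2_eq_2]]]]) auto
      show "wdiv \<alpha> ?\<zeta> x = 0" if "norm x < ?\<delta> j" for x
        by (rule wdiv_eq_0_on_open[OF open_ball[of 0 "?\<delta> j"]]) (use inside that in auto)
    qed
    have wz_out: "wdiv \<alpha> ?\<zeta> x = 0" if "R + 1 < norm x" for x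
      by (rule wdiv_eq_0_on_open[OF open_norm_greater[of "R + 1"]]) (use outside that in auto)
    have "wdiv \<alpha> ?\<zeta> x = 0" if "R + 2 \<le> norm x" for x
      by (rule wz_out) (use that in linarith)
    from bounded_continuous_bounded_support[OF wz_cont this]
    obtain M where M: "\<And>x. \<bar>wdiv \<alpha> ?\<zeta> x\<bar> \<le> M" by blast
    have "(\<lambda>n. \<integral>x. \<eta> n x * wdiv \<alpha> ?\<zeta> x \<partial>lborel) \<longlonglongrightarrow> 0"
      by (rule Lp_null_imp_weakly_null[OF _ borel_measurable_continuous_onI[OF wz_cont] p \<eta>p M wz_out]) measurable
    moreover have "(\<integral>x. ?w n x * ?\<zeta> x \<partial>lborel) = (\<integral>x. \<eta> n x * wdiv \<alpha> ?\<zeta> x \<partial>lborel)" for n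
      by (rule wdiv_symmetric[OF \<eta> ck \<delta>[of j] inside outside])
    ultimately show ?thesis by simp
  qed
qed

section \<open>Completeness of \<open>L\<^sup>p\<close> and the embedding\<close>

text \<open>The modulus of a + b is at most twice the larger of |a| and |b|. The factor only affects
  constants, so this stands in for Minkowski's inequality.\<close>

lemma abs_powr_add_le:
  fixes a b p :: real
  assumes "0 \<le> p"
  shows "\<bar>a + b\<bar> powr p \<le> 2 powr p * (\<bar>a\<bar> powr p + \<bar>b\<bar> powr p)"
proof -
  have "\<bar>a + b\<bar> powr p \<le> (2 * max \<bar>a\<bar> \<bar>b\<bar>) powr p"
    using assms by (intro powr_mono2) auto
  also have "\<dots> = 2 powr p * max \<bar>a\<bar> \<bar>b\<bar> powr p"
    by (simp add: powr_mult le_max_iff_disj)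
  also have "\<dots> \<le> 2 powr p * (\<bar>a\<bar> powr p + \<bar>b\<bar> powr p)"
    by (intro mult_left_mono) (auto simp: max_def)
  finally show ?thesis .
qed

lemma Lp_I:
  "f \<in> borel_measurable borel \<Longrightarrow> integrable lborel (\<lambda>x. \<bar>f x\<bar> powr p) \<Longrightarrow> f \<in> Lp p"
  by (simp add: Lp_def)

lemma Lp_D:
  assumes "f \<in> Lp p"
  shows "f \<in> borel_measurable borel" "integrable lborel (\<lambda>x. \<bar>f x\<bar> powr p)"
  using assms by (simp_all add: Lp_def)

lemma Lp_add:
  assumes f: "f \<in> Lp p" and g: "g \<in> Lp p" and p: "0 \<le> p"
  shows "(\<lambda>x. f x + g x) \<in> Lp p"
    and "Lp_power p (\<lambda>x. f x + g x)
       \<le> 2 powr p * (Lp_power p f + Lp_power p g)"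
proof -
  note [measurable] = Lp_D(1)[OF f] Lp_D(1)[OF g]
  have i: "integrable lborel (\<lambda>x. 2 powr p * (\<bar>f x\<bar> powr p + \<bar>g x\<bar> powr p))"
    by (intro integrable_mult_right Bochner_Integration.integrable_add Lp_D f g)
  have j: "integrable lborel (\<lambda>x. \<bar>f x + g x\<bar> powr p)"
    by (rule Bochner_Integration.integrable_bound[OF i])
      (measurable, use abs_powr_add_le[OF p] in \<open>auto intro!: AE_I2 simp: abs_of_nonneg\<close>)
  show "(\<lambda>x. f x + g x) \<in> Lp p" by (rule Lp_I[OF _ j]) measurable
  have "Lp_power p (\<lambda>x. f x + g x) \<le> (\<integral>x. 2 powr p * (\<bar>f x\<bar> powr p + \<bar>g x\<bar> powr p) \<partial>lborel)"
    by (rule integral_mono[OF j i abs_powr_add_le[OF p]])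
  then show "Lp_power p (\<lambda>x. f x + g x)
       \<le> 2 powr p * (Lp_power p f + Lp_power p g)"
    using Lp_D(2)[OF f] Lp_D(2)[OF g] by simp
qed

lemma Lp_scale: "f \<in> Lp p \<Longrightarrow> (\<lambda>x. c * f x) \<in> Lp p"
  by (auto simp: Lp_def abs_mult powr_mult)

lemma Lp_diff:
  assumes "f \<in> Lp p" "g \<in> Lp p" "0 \<le> p"
  shows "(\<lambda>x. f x - g x) \<in> Lp p"
  using Lp_add(1)[OF assms(1) Lp_scale[OF assms(2), of "-1"] assms(3)] by simp

text \<open>Membership is part of the notion because the Bochner integral of a nonintegrable
  function is 0, so vanishing integrals alone would say nothing.\<close>

definition Lp_null :: "real \<Rightarrow> (nat \<Rightarrow> 'a::euclidean_space \<Rightarrow> real) \<Rightarrow> bool" where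
  "Lp_null p h \<longleftrightarrow> (\<forall>n. h n \<in> Lp p) \<and> (\<lambda>n. Lp_power p (h n)) \<longlonglongrightarrow> 0"

definition Lp_Cauchy :: "real \<Rightarrow> (nat \<Rightarrow> 'a::euclidean_space \<Rightarrow> real) \<Rightarrow> bool" where
  "Lp_Cauchy p f \<longleftrightarrow>
     (\<forall>e>0. \<exists>N. \<forall>m\<ge>N. \<forall>n\<ge>N. Lp_power p (\<lambda>x. f m x - f n x) < e)"

lemma Lp_null_add:
  assumes "Lp_null p f" "Lp_null p g" "0 \<le> p"
  shows "Lp_null p (\<lambda>n x. f n x + g n x)"
proof -
  let ?b = "\<lambda>n. 2 powr p * (Lp_power p (f n) + Lp_power p (g n))"
  have "?b \<longlonglongrightarrow> 2 powr p * (0 + 0)"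
    using assms unfolding Lp_null_def by (intro tendsto_intros) auto
  then have lim: "?b \<longlonglongrightarrow> 0" by simp
  have "Lp_power p (\<lambda>x. f n x + g n x) \<le> ?b n" for n
    by (rule Lp_add(2)) (use assms in \<open>auto simp: Lp_null_def\<close>)
  then have "\<forall>\<^sub>F n in sequentially. norm (Lp_power p (\<lambda>x. f n x + g n x)) \<le> ?b n"
    by (intro always_eventually) simp
  from Lim_null_comparison[OF this lim]
  have "(\<lambda>n. Lp_power p (\<lambda>x. f n x + g n x)) \<longlonglongrightarrow> 0" .
  moreover have "(\<lambda>x. f n x + g n x) \<in> Lp p" for n
    by (rule Lp_add(1)) (use assms in \<open>auto simp: Lp_null_def\<close>)
  ultimately show ?thesis by (simp add: Lp_null_def)
qed

lemma Lp_null_scale: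
  assumes "Lp_null p f"
  shows "Lp_null p (\<lambda>n x. c * f n x)"
proof -
  have "(\<lambda>n. \<bar>c\<bar> powr p * Lp_power p (f n)) \<longlonglongrightarrow> \<bar>c\<bar> powr p * 0"
    using assms unfolding Lp_null_def by (intro tendsto_intros) auto
  moreover have "Lp_power p (\<lambda>x. c * f n x) = \<bar>c\<bar> powr p * Lp_power p (f n)" for n
    by (simp add: abs_mult powr_mult)
  ultimately show ?thesis using assms by (simp add: Lp_null_def Lp_scale del: abs_mult)
qed

lemma Lp_null_diff:
  "Lp_null p f \<Longrightarrow> Lp_null p g \<Longrightarrow> 0 \<le> p \<Longrightarrow> Lp_null p (\<lambda>n x. f n x - g n x)"
  using Lp_null_add[OF _ Lp_null_scale, of p f g "-1"] by simp

lemma Lp_null_zero: "Lp_null p (\<lambda>n x. 0)"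
  by (simp add: Lp_null_def Lp_def)

lemma Lp_null_cong_AE:
  assumes f: "Lp_null p f" and g: "\<And>n. g n \<in> borel_measurable borel"
    and eq: "\<And>n. AE x in lborel. f n x = g n x"
  shows "Lp_null p g"
proof -
  have fm: "f n \<in> borel_measurable borel" "integrable lborel (\<lambda>x. \<bar>f n x\<bar> powr p)" for n
    by (rule Lp_D[of _ p], use f in \<open>simp add: Lp_null_def\<close>)+
  have ae: "AE x in lborel. \<bar>f n x\<bar> powr p = \<bar>g n x\<bar> powr p" for n
    using eq[of n] by eventually_elim simp
  note [measurable] = fm(1) g
  have "g n \<in> Lp p" for n
    by (rule Lp_I[OF g], rule integrable_cong_AE_imp[OF fm(2)[of n]]) (use ae in auto)
  moreover have "Lp_power p (f n) = Lp_power p (g n)" for n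
    by (rule integral_cong_AE) (use ae in auto)
  ultimately show ?thesis using f by (simp add: Lp_null_def)
qed

text \<open>A constant sequence of reals tends to 0 only if it is 0. Uniqueness of limits reduces to
  this case, as the difference of two limits is a constant null sequence.\<close>

lemma Lp_null_const_imp_AE:
  assumes "Lp_null p (\<lambda>n. h)"
  shows "AE x in lborel. h x = 0"
proof -
  have h: "h \<in> Lp p" and "(\<lambda>n::nat. Lp_power p h) \<longlonglongrightarrow> 0"
    using assms by (auto simp: Lp_null_def)
  then have "Lp_power p h = 0" by (simp add: LIMSEQ_const_iff)
  then have "AE x in lborel. \<bar>h x\<bar> powr p = 0"
    using integral_nonneg_eq_0_iff_AE[OF Lp_D(2)[OF h]] by simp
  then show ?thesis by eventually_elim simp
qed

text \<open>Riesz-Fischer: a fast subsequence converges almost everywhere, and Fatou's lemma turns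
  the Cauchy property into convergence to the pointwise limit.\<close>

lemma Lp_complete:
  fixes f :: "nat \<Rightarrow> 'a::euclidean_space \<Rightarrow> real"
  assumes f: "\<And>n. f n \<in> Lp p" and p: "1 \<le> p" and cauchy: "Lp_Cauchy p f"
  obtains g where "g \<in> Lp p" "Lp_null p (\<lambda>n x. f n x - g x)"
proof -
  have p0: "0 \<le> p" "0 < p" using p by auto
  note [measurable] = Lp_D(1)[OF f]
  have diff: "integrable lborel (\<lambda>x. \<bar>f m x - f n x\<bar> powr p)" for m n
    using Lp_D(2)[OF Lp_diff[OF f f p0(1)]] .
  \<comment> \<open>The second factor makes the \<open>k\<close>-th increment pointwise \<open>O(2\<^sup>-\<^sup>k)\<close>, so Minkowski's inequality is not needed.\<close>
  define \<epsilon> where "\<epsilon> k = (1/2) ^ k * (1/2) powr (p * real k)" for k :: nat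
  have \<epsilon>: "0 < \<epsilon> k" for k by (simp add: \<epsilon>_def)
  have "\<forall>k. \<exists>N. \<forall>m\<ge>N. \<forall>n\<ge>N. Lp_power p (\<lambda>x. f m x - f n x) < \<epsilon> k"
    using cauchy \<epsilon> unfolding Lp_Cauchy_def by blast
  then obtain N where N: "\<And>k m n. N k \<le> m \<Longrightarrow> N k \<le> n \<Longrightarrow> Lp_power p (\<lambda>x. f m x - f n x) < \<epsilon> k"
    by metis
  \<comment> \<open>Summing all thresholds up to k gives nondecreasing indices that lie beyond both
    \<open>N k\<close> and k.\<close>
  define r where "r k = k + (\<Sum>i\<le>k. N i)" for k
  have rN: "N k \<le> r k" for k
    using member_le_sum[of k "{..k}" N] by (simp add: r_def)
  have rk: "k \<le> r k" "r k \<le> r (Suc k)" for k by (simp_all add: r_def)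
  define d where "d k x = f (r (Suc k)) x - f (r k) x" for k x
  have [measurable]: "d k \<in> borel_measurable borel" for k unfolding d_def[abs_def] by measurable
  let ?c = "\<lambda>k::nat. 2 powr (p * real k)"
  have "(\<integral>\<^sup>+x. ennreal (?c k * \<bar>d k x\<bar> powr p) \<partial>lborel) \<le> ennreal ((1/2) ^ k)" for k
  proof -
    have "(\<integral>\<^sup>+x. ennreal (?c k * \<bar>d k x\<bar> powr p) \<partial>lborel) = ennreal (?c k * Lp_power p (d k))"
      using diff by (subst nn_integral_eq_integral) (auto simp: d_def)
    also have "\<dots> \<le> ennreal (?c k * \<epsilon> k)"
      using N[of k "r (Suc k)" "r k"] rN[of k] rk(2)[of k]
      by (intro ennreal_leI mult_left_mono) (auto simp: d_def)
    also have "?c k * \<epsilon> k = (1/2) ^ k"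
      by (simp add: \<epsilon>_def powr_divide)
    finally show ?thesis .
  qed
  then have "(\<Sum>k. \<integral>\<^sup>+x. ennreal (?c k * \<bar>d k x\<bar> powr p) \<partial>lborel) \<le> (\<Sum>k. ennreal ((1/2) ^ k))"
    by (intro suminf_le) auto
  also have "\<dots> = ennreal (1 / (1 - 1/2))"
    by (intro suminf_ennreal_eq geometric_sums) auto
  also have "(\<Sum>k. \<integral>\<^sup>+x. ennreal (?c k * \<bar>d k x\<bar> powr p) \<partial>lborel)
      = (\<integral>\<^sup>+x. (\<Sum>k. ennreal (?c k * \<bar>d k x\<bar> powr p)) \<partial>lborel)"
    by (rule nn_integral_suminf[symmetric]) measurable
  finally have "(\<integral>\<^sup>+x. (\<Sum>k. ennreal (?c k * \<bar>d k x\<bar> powr p)) \<partial>lborel) \<le> ennreal 2" by simp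
  then have "(\<integral>\<^sup>+x. (\<Sum>k. ennreal (?c k * \<bar>d k x\<bar> powr p)) \<partial>lborel) \<noteq> \<infinity>"
    using ennreal_less_top[of 2] by (metis infinity_ennreal_def leD)
  then have "AE x in lborel. (\<Sum>k. ennreal (?c k * \<bar>d k x\<bar> powr p)) \<noteq> \<infinity>"
    by (rule nn_integral_noteq_infinite[rotated]) measurable
  then have conv: "AE x in lborel. convergent (\<lambda>k. f (r k) x)"
  proof eventually_elim
    case (elim x)
    define H where "H k = ennreal (?c k * \<bar>d k x\<bar> powr p)" for k
    have "suminf H \<noteq> \<infinity>" using elim unfolding H_def[abs_def] .
    then obtain B where B: "suminf H = ennreal B" "0 \<le> B"
      by (cases "suminf H") auto
    have bd: "\<bar>d k x\<bar> \<le> B powr (1 / p) * (1/2) ^ k" for k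
    proof -
      have "H k \<le> ennreal B" unfolding B(1)[symmetric] using sum_le_suminf[of H "{k}"] by simp
      then have "?c k * \<bar>d k x\<bar> powr p \<le> B" unfolding H_def using B(2) by (subst (asm) ennreal_le_iff) auto
      then have "(?c k * \<bar>d k x\<bar> powr p) powr (1 / p) \<le> B powr (1 / p)"
        using p by (intro powr_mono2) auto
      also have "(?c k * \<bar>d k x\<bar> powr p) powr (1 / p) = 2 ^ k * \<bar>d k x\<bar>"
        using p0 by (simp add: powr_mult powr_powr powr_realpow)
      finally show ?thesis by (simp add: field_simps power_divide)
    qed
    have "summable (\<lambda>k. d k x)"
      by (rule summable_comparison_test'[where g = "\<lambda>k. B powr (1 / p) * (1/2) ^ k"])
        (use bd in \<open>auto intro!: summable_mult summable_geometric\<close>)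
    then have "convergent (\<lambda>n. \<Sum>k<n. d k x)" by (simp add: summable_iff_convergent)
    moreover have "(\<Sum>k<n. d k x) = f (r n) x - f (r 0) x" for n
      using sum_lessThan_telescope[of "\<lambda>k. f (r k) x" n] by (simp add: d_def)
    ultimately have "convergent (\<lambda>n. f (r n) x - f (r 0) x + f (r 0) x)"
      by (intro convergent_add convergent_const) simp
    then show ?case by simp
  qed
  \<comment> \<open>Where the subsequence diverges \<open>lim\<close> has an unspecified value, but
    this set is null by \<open>conv\<close>.\<close>
  define g where "g x = lim (\<lambda>k. f (r k) x)" for x
  have g[measurable]: "g \<in> borel_measurable borel"
    unfolding g_def[abs_def] by (rule borel_measurable_lim_metric) measurable
  have fatou: "(\<integral>\<^sup>+x. ennreal (\<bar>f n x - g x\<bar> powr p) \<partial>lborel) \<le> ennreal e"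
    if M: "\<And>m. M \<le> m \<Longrightarrow> Lp_power p (\<lambda>x. f n x - f m x) < e" for n M e
  proof -
    have "(\<integral>\<^sup>+x. ennreal (\<bar>f n x - g x\<bar> powr p) \<partial>lborel)
        = (\<integral>\<^sup>+x. liminf (\<lambda>k. ennreal (\<bar>f n x - f (r k) x\<bar> powr p)) \<partial>lborel)"
    proof (rule nn_integral_cong_AE)
      show "AE x in lborel. ennreal (\<bar>f n x - g x\<bar> powr p)
          = liminf (\<lambda>k. ennreal (\<bar>f n x - f (r k) x\<bar> powr p))"
        using conv
      proof eventually_elim
        case (elim x)
        then have "(\<lambda>k. f (r k) x) \<longlonglongrightarrow> g x" by (simp add: g_def convergent_LIMSEQ_iff)
        then have "(\<lambda>k. \<bar>f n x - f (r k) x\<bar> powr p) \<longlonglongrightarrow> \<bar>f n x - g x\<bar> powr p"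
          using p0 by (intro tendsto_powr' tendsto_intros) auto
        then have "(\<lambda>k. ennreal (\<bar>f n x - f (r k) x\<bar> powr p)) \<longlonglongrightarrow> ennreal (\<bar>f n x - g x\<bar> powr p)"
          by (rule tendsto_ennrealI)
        then show ?case by (rule lim_imp_Liminf[symmetric, rotated]) simp
      qed
    qed
    also have "\<dots> \<le> liminf (\<lambda>k. \<integral>\<^sup>+x. ennreal (\<bar>f n x - f (r k) x\<bar> powr p) \<partial>lborel)"
      by (rule nn_integral_liminf) measurable
    also have "\<dots> \<le> ennreal e"
    proof (rule Liminf_le)
      show "\<forall>\<^sub>F k in sequentially. (\<integral>\<^sup>+x. ennreal (\<bar>f n x - f (r k) x\<bar> powr p) \<partial>lborel) \<le> ennreal e"
        using eventually_ge_at_top[of M]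
      proof eventually_elim
        case (elim k)
        then have "M \<le> r k" using rk(1)[of k] by simp
        then show ?case
          using M[of "r k"] diff by (subst nn_integral_eq_integral) (simp_all add: ennreal_leI)
      qed
    qed simp
    finally show ?thesis .
  qed
  \<comment> \<open>Finite distance from one member of the sequence is enough to place g in
    L^p.\<close>
  obtain N1 where N1: "\<And>m n. N1 \<le> m \<Longrightarrow> N1 \<le> n \<Longrightarrow> Lp_power p (\<lambda>x. f m x - f n x) < 1"
    using cauchy unfolding Lp_Cauchy_def by (meson zero_less_one)
  have "(\<integral>\<^sup>+x. ennreal (\<bar>f N1 x - g x\<bar> powr p) \<partial>lborel) \<le> ennreal 1"
    by (rule fatou[of N1]) (use N1 in auto)
  then have "integrable lborel (\<lambda>x. \<bar>f N1 x - g x\<bar> powr p)"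
    by (intro integrableI_bounded) (auto intro: order.strict_trans1)
  then have "(\<lambda>x. f N1 x - g x) \<in> Lp p" by (intro Lp_I) auto
  from Lp_diff[OF f[of N1] this p0(1)] have gL: "g \<in> Lp p" by simp
  have fg: "(\<lambda>x. f n x - g x) \<in> Lp p" for n by (rule Lp_diff[OF f gL p0(1)])
  have "(\<lambda>n. Lp_power p (\<lambda>x. f n x - g x)) \<longlonglongrightarrow> 0"
  proof (rule LIMSEQ_I)
    fix e :: real assume e: "0 < e"
    then obtain M where M: "\<And>m n. M \<le> m \<Longrightarrow> M \<le> n \<Longrightarrow> Lp_power p (\<lambda>x. f m x - f n x) < e / 2"
      using cauchy unfolding Lp_Cauchy_def by (meson half_gt_zero)
    have "norm (Lp_power p (\<lambda>x. f n x - g x) - 0) < e" if n: "M \<le> n" for n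
    proof -
      have "ennreal (Lp_power p (\<lambda>x. f n x - g x)) = (\<integral>\<^sup>+x. ennreal (\<bar>f n x - g x\<bar> powr p) \<partial>lborel)"
        using Lp_D(2)[OF fg] by (simp add: nn_integral_eq_integral)
      also have "\<dots> \<le> ennreal (e / 2)"
        by (rule fatou[of M]) (use M n in auto)
      finally have "Lp_power p (\<lambda>x. f n x - g x) \<le> e / 2"
        using e by (subst (asm) ennreal_le_iff) auto
      then show ?thesis using e by simp
    qed
    then show "\<exists>no. \<forall>n\<ge>no. norm (Lp_power p (\<lambda>x. f n x - g x) - 0) < e" by blast
  qed
  then show thesis using that[of g] gL fg by (simp add: Lp_null_def)
qed

lemma abs_powr_2: "\<bar>t::real\<bar> powr 2 = t\<^sup>2"
  by (simp add: powr_numeral)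

lemma Lp_Cauchy_diff:
  assumes f: "\<And>n. f n \<in> Lp p" "Lp_Cauchy p f" and g: "\<And>n. g n \<in> Lp p" "Lp_Cauchy p g" and p: "0 \<le> p"
  shows "Lp_Cauchy p (\<lambda>n x. f n x - g n x)"
  unfolding Lp_Cauchy_def
proof (intro allI impI)
  fix e :: real assume "0 < e"
  then have e': "0 < e / (2 * 2 powr p)" by simp
  obtain N1 where N1: "\<And>m n. N1 \<le> m \<Longrightarrow> N1 \<le> n \<Longrightarrow> Lp_power p (\<lambda>x. f m x - f n x) < e / (2 * 2 powr p)"
    using f(2) e' unfolding Lp_Cauchy_def by meson
  obtain N2 where N2: "\<And>m n. N2 \<le> m \<Longrightarrow> N2 \<le> n \<Longrightarrow> Lp_power p (\<lambda>x. g m x - g n x) < e / (2 * 2 powr p)"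
    using g(2) e' unfolding Lp_Cauchy_def by meson
  show "\<exists>N. \<forall>m\<ge>N. \<forall>n\<ge>N. Lp_power p (\<lambda>x. (f m x - g m x) - (f n x - g n x)) < e"
  proof (intro exI allI impI)
    fix m n assume mn: "max N1 N2 \<le> m" "max N1 N2 \<le> n"
    have "Lp_power p (\<lambda>x. (f m x - g m x) - (f n x - g n x))
        = Lp_power p (\<lambda>x. (f m x - f n x) + (g n x - g m x))"
      by (simp add: algebra_simps)
    also have "\<dots> \<le> 2 powr p * (Lp_power p (\<lambda>x. f m x - f n x) + Lp_power p (\<lambda>x. g n x - g m x))"
      by (intro Lp_add(2) Lp_diff f g p)
    also have "\<dots> < 2 powr p * (e / (2 * 2 powr p) + e / (2 * 2 powr p))"
      using N1[of m n] N2[of n m] mn by (intro mult_strict_left_mono add_strict_mono) auto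
    also have "\<dots> = e" by (simp add: field_simps)
    finally show "Lp_power p (\<lambda>x. (f m x - g m x) - (f n x - g n x)) < e" .
  qed
qed

text \<open>A single function that serves as limit for every sequence in A, and on classes the
  desired embedding. Allowing any set A makes it applicable to the values of \<open>D22_add\<close>
  and \<open>D22_scale\<close> without first showing that these are classes.\<close>

definition Lp_limit :: "real \<Rightarrow> (nat \<Rightarrow> 'a::euclidean_space \<Rightarrow> real) set \<Rightarrow> 'a \<Rightarrow> real" where
  "Lp_limit p A = (SOME f. f \<in> Lp p \<and> (\<forall>\<psi>\<in>A. Lp_null p (\<lambda>n x. \<psi> n x - f x)))"

lemma Lp_limit_spec:
  assumes "h \<in> Lp p" "\<And>\<psi>. \<psi> \<in> A \<Longrightarrow> Lp_null p (\<lambda>n x. \<psi> n x - h x)"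
  shows "Lp_limit p A \<in> Lp p" "\<psi> \<in> A \<Longrightarrow> Lp_null p (\<lambda>n x. \<psi> n x - Lp_limit p A x)"
proof -
  have "\<exists>f. f \<in> Lp p \<and> (\<forall>\<psi>\<in>A. Lp_null p (\<lambda>n x. \<psi> n x - f x))" using assms by blast
  from someI_ex[OF this]
  show "Lp_limit p A \<in> Lp p" "\<psi> \<in> A \<Longrightarrow> Lp_null p (\<lambda>n x. \<psi> n x - Lp_limit p A x)"
    by (simp_all add: Lp_limit_def)
qed

lemma Lp_limit_AE_eq:
  assumes h: "h \<in> Lp p" "\<And>\<psi>. \<psi> \<in> A \<Longrightarrow> Lp_null p (\<lambda>n x. \<psi> n x - h x)" and A: "\<phi> \<in> A" and p: "0 \<le> p"
  shows "AE x in lborel. Lp_limit p A x = h x"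
proof -
  have "Lp_null p (\<lambda>n x. (\<phi> n x - h x) - (\<phi> n x - Lp_limit p A x))"
    by (intro Lp_null_diff h(2)[OF A] Lp_limit_spec(2)[OF h A] p)
  then have "Lp_null p (\<lambda>n::nat. \<lambda>x. Lp_limit p A x - h x)" by simp
  from Lp_null_const_imp_AE[OF this] show ?thesis by simp
qed

section \<open>The completion expressed through images in L^2\<close>

lemma wdiv_in_L2: "u \<in> test_space \<alpha> \<Longrightarrow> wdiv \<alpha> u \<in> Lp 2"
  by (intro Lp_I borel_measurable_test_space) (auto simp: abs_powr_2 test_space_iff)

lemma test_space_diff:
  assumes "u \<in> test_space \<alpha>" "v \<in> test_space \<alpha>" shows "(\<lambda>x. u x - v x) \<in> test_space \<alpha>"
  using test_space_lincomb[OF assms, of 1 "-1"] by simp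

lemma test_space_scale:
  assumes "u \<in> test_space \<alpha>" shows "(\<lambda>x. c * u x) \<in> test_space \<alpha>"
  using test_space_lincomb[OF assms assms, of c 0] by simp

lemma wdiv_diff_AE:
  assumes "u \<in> test_space \<alpha>" "v \<in> test_space \<alpha>"
  shows "AE x in lborel. wdiv \<alpha> u x - wdiv \<alpha> v x = wdiv \<alpha> (\<lambda>x. u x - v x) x"
  using wdiv_lincomb_AE[OF assms, of 1 "-1"] by (simp add: eq_commute)

lemma wdiv_scale_AE:
  assumes "u \<in> test_space \<alpha>"
  shows "AE x in lborel. c * wdiv \<alpha> u x = wdiv \<alpha> (\<lambda>x. c * u x) x"
  using wdiv_lincomb_AE[OF assms assms, of c 0] by (simp add: eq_commute)

lemma integral_wdiv_diff:
  assumes "u \<in> test_space \<alpha>" "v \<in> test_space \<alpha>"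
  shows "div_energy \<alpha> (\<lambda>x. u x - v x) = Lp_power 2 (\<lambda>x. wdiv \<alpha> u x - wdiv \<alpha> v x)"
proof -
  note [measurable] = borel_measurable_test_space(2)[OF assms(1)] borel_measurable_test_space(2)[OF assms(2)]
    borel_measurable_test_space(2)[OF test_space_diff[OF assms]]
  show ?thesis
    unfolding abs_powr_2 using wdiv_diff_AE[OF assms] by (intro integral_cong_AE) auto
qed

lemma test_dist_eq:
  assumes "u \<in> test_space \<alpha>" "v \<in> test_space \<alpha>"
  shows "test_dist \<alpha> u v = sqrt (Lp_power 2 (\<lambda>x. wdiv \<alpha> u x - wdiv \<alpha> v x))"
  using integral_wdiv_diff[OF assms] by (simp add: test_dist_def test_inner_def power2_eq_square)

text \<open>By \<open>test_dist_eq\<close> the distance is that of the images in L^2, so questions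
  on the completion become statements about \<open>wdiv\<close>. The root is removed by passing
  between e and its square.\<close>

lemma cauchy_seqs_iff:
  "\<phi> \<in> cauchy_seqs \<alpha> \<longleftrightarrow> (\<forall>n. \<phi> n \<in> test_space \<alpha>) \<and> Lp_Cauchy 2 (\<lambda>n. wdiv \<alpha> (\<phi> n))"
proof -
  let ?I = "\<lambda>m n. Lp_power 2 (\<lambda>x. wdiv \<alpha> (\<phi> m) x - wdiv \<alpha> (\<phi> n) x)"
  have "(\<forall>e>0. \<exists>M. \<forall>m\<ge>M. \<forall>n\<ge>M. sqrt (?I m n) < e) \<longleftrightarrow> (\<forall>e>0. \<exists>M. \<forall>m\<ge>M. \<forall>n\<ge>M. ?I m n < e)" (is "?L \<longleftrightarrow> ?R")
  proof
    assume L: ?L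
    show ?R
    proof (intro allI impI)
      fix e :: real assume "0 < e"
      then show "\<exists>M. \<forall>m\<ge>M. \<forall>n\<ge>M. ?I m n < e" using L[rule_format, of "sqrt e"] by simp
    qed
  next
    assume R: ?R
    show ?L
    proof (intro allI impI)
      fix e :: real assume e: "0 < e"
      have "sqrt (?I m n) < e" if "?I m n < e\<^sup>2" for m n using real_sqrt_less_mono[OF that] e by simp
      then show "\<exists>M. \<forall>m\<ge>M. \<forall>n\<ge>M. sqrt (?I m n) < e" using R[rule_format, of "e\<^sup>2"] e by (meson zero_less_power)
    qed
  qed
  moreover have "\<phi> \<in> cauchy_seqs \<alpha> \<longleftrightarrow> (\<forall>n. \<phi> n \<in> test_space \<alpha>) \<and> ?L"
    unfolding cauchy_seqs_def mem_Collect_eq by (rule conj_cong[OF refl]) (simp only: test_dist_eq simp_thms)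
  ultimately show ?thesis by (simp only: Lp_Cauchy_def)
qed

lemma cauchy_rel_iff:
  "(\<phi>, \<psi>) \<in> cauchy_rel \<alpha> \<longleftrightarrow> \<phi> \<in> cauchy_seqs \<alpha> \<and> \<psi> \<in> cauchy_seqs \<alpha> \<and>
     Lp_null 2 (\<lambda>n x. wdiv \<alpha> (\<phi> n) x - wdiv \<alpha> (\<psi> n) x)"
proof (cases "\<phi> \<in> cauchy_seqs \<alpha> \<and> \<psi> \<in> cauchy_seqs \<alpha>")
  case True
  then have t: "\<phi> n \<in> test_space \<alpha>" "\<psi> n \<in> test_space \<alpha>" for n by (auto simp: cauchy_seqs_iff)
  let ?I = "\<lambda>n. Lp_power 2 (\<lambda>x. wdiv \<alpha> (\<phi> n) x - wdiv \<alpha> (\<psi> n) x)"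
  have "(\<lambda>n. sqrt (?I n)) \<longlonglongrightarrow> 0 \<longleftrightarrow> ?I \<longlonglongrightarrow> 0"
  proof
    assume "(\<lambda>n. sqrt (?I n)) \<longlonglongrightarrow> 0"
    from tendsto_power[OF this, of 2] show "?I \<longlonglongrightarrow> 0" by simp
  next
    assume "?I \<longlonglongrightarrow> 0"
    from tendsto_real_sqrt[OF this] show "(\<lambda>n. sqrt (?I n)) \<longlonglongrightarrow> 0" by simp
  qed
  moreover have "(\<lambda>x. wdiv \<alpha> (\<phi> n) x - wdiv \<alpha> (\<psi> n) x) \<in> Lp 2" for n
    by (intro Lp_diff wdiv_in_L2 t) simp
  ultimately show ?thesis using True t by (simp add: cauchy_rel_def Lp_null_def test_dist_eq)
qed (auto simp: cauchy_rel_def)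

lemma equiv_cauchy_rel: "equiv (cauchy_seqs \<alpha>) (cauchy_rel \<alpha>)"
proof (rule equivI)
  show "cauchy_rel \<alpha> \<subseteq> cauchy_seqs \<alpha> \<times> cauchy_seqs \<alpha>" by (auto simp: cauchy_rel_def)
  show "refl_on (cauchy_seqs \<alpha>) (cauchy_rel \<alpha>)"
    by (auto simp: refl_on_def cauchy_rel_iff Lp_null_zero)
  show "sym (cauchy_rel \<alpha>)"
  proof (rule symI)
    fix \<phi> \<psi> assume "(\<phi>, \<psi>) \<in> cauchy_rel \<alpha>"
    then show "(\<psi>, \<phi>) \<in> cauchy_rel \<alpha>"
      using Lp_null_scale[of 2 "\<lambda>n x. wdiv \<alpha> (\<phi> n) x - wdiv \<alpha> (\<psi> n) x" "-1"] by (simp add: cauchy_rel_iff)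
  qed
  show "trans (cauchy_rel \<alpha>)"
  proof (rule transI)
    fix \<phi> \<psi> \<xi> assume "(\<phi>, \<psi>) \<in> cauchy_rel \<alpha>" "(\<psi>, \<xi>) \<in> cauchy_rel \<alpha>"
    then show "(\<phi>, \<xi>) \<in> cauchy_rel \<alpha>"
      using Lp_null_add[of 2 "\<lambda>n x. wdiv \<alpha> (\<phi> n) x - wdiv \<alpha> (\<psi> n) x" "\<lambda>n x. wdiv \<alpha> (\<psi> n) x - wdiv \<alpha> (\<xi> n) x"]
      by (simp add: cauchy_rel_iff)
  qed
qed

lemma const_in_cauchy_seqs: "u \<in> test_space \<alpha> \<Longrightarrow> (\<lambda>n. u) \<in> cauchy_seqs \<alpha>"
  by (auto simp: cauchy_seqs_iff Lp_Cauchy_def)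

lemma Lp_Cauchy_cong_AE:
  assumes "Lp_Cauchy p f" "\<And>n. f n \<in> borel_measurable borel" "\<And>n. g n \<in> borel_measurable borel"
    and eq: "\<And>n. AE x in lborel. f n x = g n x"
  shows "Lp_Cauchy p g"
proof -
  note [measurable] = assms(2,3)
  have "Lp_power p (\<lambda>x. f m x - f n x) = Lp_power p (\<lambda>x. g m x - g n x)" for m n
    using eq[of m] eq[of n] by (intro integral_cong_AE) auto
  then show ?thesis using assms(1) by (simp add: Lp_Cauchy_def)
qed

lemma cauchy_seqs_diff:
  assumes "\<phi> \<in> cauchy_seqs \<alpha>" "\<psi> \<in> cauchy_seqs \<alpha>"
  shows "(\<lambda>n x. \<phi> n x - \<psi> n x) \<in> cauchy_seqs \<alpha>"
proof -
  have t: "\<phi> n \<in> test_space \<alpha>" "\<psi> n \<in> test_space \<alpha>" for n using assms by (auto simp: cauchy_seqs_iff)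
  have "Lp_Cauchy 2 (\<lambda>n x. wdiv \<alpha> (\<phi> n) x - wdiv \<alpha> (\<psi> n) x)"
    using assms t by (intro Lp_Cauchy_diff wdiv_in_L2) (auto simp: cauchy_seqs_iff)
  then have "Lp_Cauchy 2 (\<lambda>n. wdiv \<alpha> (\<lambda>x. \<phi> n x - \<psi> n x))"
    by (rule Lp_Cauchy_cong_AE)
      (auto intro!: wdiv_diff_AE t borel_measurable_diff borel_measurable_test_space(2) test_space_diff)
  then show ?thesis using t by (simp add: cauchy_seqs_iff test_space_diff)
qed

lemma cauchy_seqs_scale:
  assumes "\<phi> \<in> cauchy_seqs \<alpha>"
  shows "(\<lambda>n x. c * \<phi> n x) \<in> cauchy_seqs \<alpha>"
proof -
  have t: "\<phi> n \<in> test_space \<alpha>" for n using assms by (auto simp: cauchy_seqs_iff)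
  note [measurable] = borel_measurable_test_space(2)[OF t]
  have "Lp_Cauchy 2 (\<lambda>n x. c * wdiv \<alpha> (\<phi> n) x)"
    unfolding Lp_Cauchy_def
  proof (intro allI impI)
    fix e :: real assume e: "0 < e"
    \<comment> \<open>The added 1 covers c = 0.\<close>
    have "0 < e / (c\<^sup>2 + 1)" using e by (simp add: add_nonneg_pos)
    then obtain N where N: "\<And>m n. N \<le> m \<Longrightarrow> N \<le> n \<Longrightarrow>
        Lp_power 2 (\<lambda>x. wdiv \<alpha> (\<phi> m) x - wdiv \<alpha> (\<phi> n) x) < e / (c\<^sup>2 + 1)"
      using assms unfolding cauchy_seqs_iff Lp_Cauchy_def by meson
    show "\<exists>N. \<forall>m\<ge>N. \<forall>n\<ge>N. Lp_power 2 (\<lambda>x. c * wdiv \<alpha> (\<phi> m) x - c * wdiv \<alpha> (\<phi> n) x) < e"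
    proof (intro exI allI impI)
      fix m n assume mn: "N \<le> m" "N \<le> n"
      let ?I = "\<integral>x. (wdiv \<alpha> (\<phi> m) x - wdiv \<alpha> (\<phi> n) x)\<^sup>2 \<partial>lborel"
      have "Lp_power 2 (\<lambda>x. c * wdiv \<alpha> (\<phi> m) x - c * wdiv \<alpha> (\<phi> n) x) = c\<^sup>2 * ?I"
        by (simp add: abs_powr_2 power_mult_distrib flip: right_diff_distrib)
      also have "\<dots> \<le> (c\<^sup>2 + 1) * ?I" by (intro mult_right_mono) auto
      also have "\<dots> < (c\<^sup>2 + 1) * (e / (c\<^sup>2 + 1))"
        using N[OF mn] by (intro mult_strict_left_mono) (auto simp: abs_powr_2 add_nonneg_pos)
      also have "\<dots> = e" using add_nonneg_pos[of "c\<^sup>2" 1] by simp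
      finally show "Lp_power 2 (\<lambda>x. c * wdiv \<alpha> (\<phi> m) x - c * wdiv \<alpha> (\<phi> n) x) < e" .
    qed
  qed
  then have "Lp_Cauchy 2 (\<lambda>n. wdiv \<alpha> (\<lambda>x. c * \<phi> n x))"
    by (rule Lp_Cauchy_cong_AE)
      (auto intro: wdiv_scale_AE t borel_measurable_test_space(2)[OF test_space_scale[OF t]])
  then show ?thesis using t by (simp add: cauchy_seqs_iff test_space_scale)
qed

lemma cauchy_seqs_add:
  assumes "\<phi> \<in> cauchy_seqs \<alpha>" "\<psi> \<in> cauchy_seqs \<alpha>"
  shows "(\<lambda>n x. \<phi> n x + \<psi> n x) \<in> cauchy_seqs \<alpha>"
  using cauchy_seqs_diff[OF assms(1) cauchy_seqs_scale[OF assms(2), of "-1"]] by simp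

lemma D22_memberD:
  assumes "U \<in> D22 \<alpha>" "\<phi> \<in> U"
  shows "\<phi> \<in> cauchy_seqs \<alpha>" "\<phi> n \<in> test_space \<alpha>"
proof -
  show "\<phi> \<in> cauchy_seqs \<alpha>"
    using assms by (auto simp: D22_def quotient_def cauchy_rel_def)
  then show "\<phi> n \<in> test_space \<alpha>" by (simp add: cauchy_seqs_iff)
qed

lemma D22_relD: "U \<in> D22 \<alpha> \<Longrightarrow> \<phi> \<in> U \<Longrightarrow> \<psi> \<in> U \<Longrightarrow> (\<phi>, \<psi>) \<in> cauchy_rel \<alpha>"
  unfolding D22_def using quotient_eq_iff[OF equiv_cauchy_rel] by metis

lemma D22_nonempty: "U \<in> D22 \<alpha> \<Longrightarrow> \<exists>\<phi>. \<phi> \<in> U"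
  unfolding D22_def using in_quotient_imp_non_empty[OF equiv_cauchy_rel] by blast

text \<open>Completeness of L^2 gives a limit for one representative, and equivalence carries it to
  all others. Hence the choice in \<open>D22_div\<close> has a witness and inherits its
  properties.\<close>

lemma D22_div_spec:
  assumes U: "U \<in> D22 \<alpha>"
  shows "D22_div \<alpha> U \<in> Lp 2" "\<phi> \<in> U \<Longrightarrow> Lp_null 2 (\<lambda>n x. wdiv \<alpha> (\<phi> n) x - D22_div \<alpha> U x)"
proof -
  obtain \<phi>0 where \<phi>0: "\<phi>0 \<in> U" using D22_nonempty[OF U] by blast
  obtain g where g: "g \<in> Lp 2" "Lp_null 2 (\<lambda>n x. wdiv \<alpha> (\<phi>0 n) x - g x)"
    by (rule Lp_complete[of "\<lambda>n. wdiv \<alpha> (\<phi>0 n)" 2])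
      (use D22_memberD[OF U \<phi>0] in \<open>auto simp: wdiv_in_L2 cauchy_seqs_iff\<close>)
  have "Lp_null 2 (\<lambda>n x. wdiv \<alpha> (\<psi> n) x - g x)" if "\<psi> \<in> U" for \<psi>
  proof -
    have "Lp_null 2 (\<lambda>n x. wdiv \<alpha> (\<psi> n) x - wdiv \<alpha> (\<phi>0 n) x)"
      using D22_relD[OF U that \<phi>0] by (simp add: cauchy_rel_iff)
    from Lp_null_add[OF this g(2)] show ?thesis by simp
  qed
  then have "\<exists>g. g \<in> Lp 2 \<and> (\<forall>\<phi>\<in>U. (\<lambda>n. \<integral>x. \<bar>wdiv \<alpha> (\<phi> n) x - g x\<bar>\<^sup>2 \<partial>lborel) \<longlonglongrightarrow> 0)"
    using g(1) by (auto simp: Lp_null_def abs_powr_2)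
  from someI_ex[OF this, folded D22_div_def]
  have s: "D22_div \<alpha> U \<in> Lp 2"
    "\<And>\<phi>. \<phi> \<in> U \<Longrightarrow> (\<lambda>n. \<integral>x. \<bar>wdiv \<alpha> (\<phi> n) x - D22_div \<alpha> U x\<bar>\<^sup>2 \<partial>lborel) \<longlonglongrightarrow> 0" by auto
  show "D22_div \<alpha> U \<in> Lp 2" by (rule s(1))
  show "Lp_null 2 (\<lambda>n x. wdiv \<alpha> (\<phi> n) x - D22_div \<alpha> U x)" if "\<phi> \<in> U"
    using s(2)[OF that] Lp_diff[OF wdiv_in_L2[OF D22_memberD(2)[OF U that]] s(1)]
    by (simp add: Lp_null_def abs_powr_2)
qed

text \<open>By \<open>sob\<close>, sequences that are Cauchy for the energy are Cauchy in L^p, and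
  equivalent ones have the same limit there. So T can take limits, the inequality survives with a
  worse constant, and injectivity is \<open>wdiv_closable\<close>.\<close>

lemma embedding_of_sobolev:
  fixes \<alpha> p C :: real
  assumes p: "2 < p" and C: "0 < C"
    and int: "\<And>u :: 'a::euclidean_space \<Rightarrow> real. u \<in> test_space \<alpha> \<Longrightarrow> integrable lborel (\<lambda>x. \<bar>u x\<bar> powr p)"
    and sob: "\<And>u :: 'a \<Rightarrow> real. u \<in> test_space \<alpha> \<Longrightarrow>
       Lp_power p u powr (2 / p) \<le> C * div_energy \<alpha> u"
  shows "\<exists>T :: (nat \<Rightarrow> 'a \<Rightarrow> real) set \<Rightarrow> 'a \<Rightarrow> real. linear_embedding \<alpha> p T \<and>
    (\<exists>S>0. \<forall>U\<in>D22 \<alpha>. (\<integral>x. \<bar>D22_div \<alpha> U x\<bar>\<^sup>2 \<partial>lborel)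
         \<ge> S * Lp_power p (\<lambda>x. T U x) powr (2 / p))"
proof -
  have p0: "0 \<le> p" "1 \<le> p" "0 < p" using p by auto
  have inLp: "u \<in> Lp p" if "u \<in> test_space \<alpha>" for u :: "'a \<Rightarrow> real"
    by (intro Lp_I borel_measurable_test_space(1)[OF that] int that)
  have sob': "Lp_power p u \<le> (C * div_energy \<alpha> u) powr (p / 2)"
    if "u \<in> test_space \<alpha>" for u :: "'a \<Rightarrow> real"
  proof -
    have "Lp_power p u = (Lp_power p u powr (2 / p)) powr (p / 2)"
      using p0 by (simp add: powr_powr)
    also have "\<dots> \<le> (C * div_energy \<alpha> u) powr (p / 2)"
      using sob[OF that] p0 by (intro powr_mono2) auto
    finally show ?thesis .
  qed
  have sobd: "Lp_power p (\<lambda>x. u x - v x)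
      \<le> (C * Lp_power 2 (\<lambda>x. wdiv \<alpha> u x - wdiv \<alpha> v x)) powr (p / 2)"
    if "u \<in> test_space \<alpha>" "v \<in> test_space \<alpha>" for u v :: "'a \<Rightarrow> real"
    using sob'[OF test_space_diff[OF that]] by (simp add: integral_wdiv_diff[OF that])
  have rel_null: "Lp_null p (\<lambda>n x. \<phi> n x - \<psi> n x)" if "(\<phi>, \<psi>) \<in> cauchy_rel \<alpha>" for \<phi> \<psi> :: "nat \<Rightarrow> 'a \<Rightarrow> real"
  proof -
    have t: "\<phi> n \<in> test_space \<alpha>" "\<psi> n \<in> test_space \<alpha>" for n
      using that by (auto simp: cauchy_rel_iff cauchy_seqs_iff)
    let ?b = "\<lambda>n. (C * Lp_power 2 (\<lambda>x. wdiv \<alpha> (\<phi> n) x - wdiv \<alpha> (\<psi> n) x)) powr (p / 2)"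
    have "?b \<longlonglongrightarrow> (C * 0) powr (p / 2)"
      using that p0 C unfolding cauchy_rel_iff Lp_null_def by (intro tendsto_powr' tendsto_intros) auto
    then have b: "?b \<longlonglongrightarrow> 0" by simp
    have "\<forall>\<^sub>F n in sequentially. norm (Lp_power p (\<lambda>x. \<phi> n x - \<psi> n x)) \<le> ?b n"
      using sobd[OF t] by (intro always_eventually) simp
    from Lim_null_comparison[OF this b] show ?thesis
      using Lp_diff[OF inLp[OF t(1)] inLp[OF t(2)] p0(1)] by (simp add: Lp_null_def)
  qed
  have cs_Cauchy: "Lp_Cauchy p \<phi>" if cs: "\<phi> \<in> cauchy_seqs \<alpha>" for \<phi> :: "nat \<Rightarrow> 'a \<Rightarrow> real"
    unfolding Lp_Cauchy_def
  proof (intro allI impI)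
    fix e :: real assume e: "0 < e"
    have t: "\<phi> n \<in> test_space \<alpha>" for n using that by (auto simp: cauchy_seqs_iff)
    have "0 < e powr (2 / p) / C" using e C by simp
    then obtain N where N: "\<And>m n. N \<le> m \<Longrightarrow> N \<le> n \<Longrightarrow>
        Lp_power 2 (\<lambda>x. wdiv \<alpha> (\<phi> m) x - wdiv \<alpha> (\<phi> n) x) < e powr (2 / p) / C"
      using cs unfolding cauchy_seqs_iff Lp_Cauchy_def by meson
    show "\<exists>N. \<forall>m\<ge>N. \<forall>n\<ge>N. Lp_power p (\<lambda>x. \<phi> m x - \<phi> n x) < e"
    proof (intro exI allI impI)
      fix m n assume mn: "N \<le> m" "N \<le> n"
      have "Lp_power p (\<lambda>x. \<phi> m x - \<phi> n x)
          \<le> (C * Lp_power 2 (\<lambda>x. wdiv \<alpha> (\<phi> m) x - wdiv \<alpha> (\<phi> n) x)) powr (p / 2)"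
        by (rule sobd[OF t t])
      also have "\<dots> < (e powr (2 / p)) powr (p / 2)"
        using N[OF mn] C p0 by (intro powr_less_mono2) (auto simp: field_simps)
      also have "\<dots> = e" using e p0 by (simp add: powr_powr)
      finally show "Lp_power p (\<lambda>x. \<phi> m x - \<phi> n x) < e" .
    qed
  qed
  let ?T = "Lp_limit p :: (nat \<Rightarrow> 'a \<Rightarrow> real) set \<Rightarrow> 'a \<Rightarrow> real"
  have T: "?T U \<in> Lp p" "\<phi> \<in> U \<Longrightarrow> Lp_null p (\<lambda>n x. \<phi> n x - ?T U x)" if U: "U \<in> D22 \<alpha>" for U \<phi>
  proof -
    obtain \<phi>0 where \<phi>0: "\<phi>0 \<in> U" using D22_nonempty[OF U] by blast
    obtain g where g: "g \<in> Lp p" "Lp_null p (\<lambda>n x. \<phi>0 n x - g x)"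
      by (rule Lp_complete[of \<phi>0 p]) (use D22_memberD[OF U \<phi>0] p0 in \<open>auto simp: inLp cs_Cauchy\<close>)
    have n: "Lp_null p (\<lambda>n x. \<psi> n x - g x)" if "\<psi> \<in> U" for \<psi>
      using Lp_null_add[OF rel_null[OF D22_relD[OF U that \<phi>0]] g(2) p0(1)] by simp
    show "?T U \<in> Lp p" "\<phi> \<in> U \<Longrightarrow> Lp_null p (\<lambda>n x. \<phi> n x - ?T U x)"
      using Lp_limit_spec[OF g(1) n] by blast+
  qed
  \<comment> \<open>Identifies the value of T on sets such as \<open>D22_add \<alpha> U V\<close>,
    where the available information is that each member is equivalent to some sequence with limit
    h.\<close>
  have T_class: "AE x in lborel. ?T A x = h x"
    if h: "h \<in> Lp p" and A: "\<phi>0 \<in> A" "\<And>\<xi>. \<xi> \<in> A \<Longrightarrow> \<exists>\<phi>. (\<phi>, \<xi>) \<in> cauchy_rel \<alpha> \<and> Lp_null p (\<lambda>n x. \<phi> n x - h x)"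
    for A \<phi>0 h
  proof (rule Lp_limit_AE_eq[OF h _ A(1) p0(1)])
    fix \<xi> assume "\<xi> \<in> A"
    then obtain \<phi> where \<phi>: "(\<phi>, \<xi>) \<in> cauchy_rel \<alpha>" "Lp_null p (\<lambda>n x. \<phi> n x - h x)" using A(2) by blast
    from Lp_null_diff[OF \<phi>(2) rel_null[OF \<phi>(1)] p0(1)] show "Lp_null p (\<lambda>n x. \<xi> n x - h x)" by simp
  qed
  have refl: "(\<phi>, \<phi>) \<in> cauchy_rel \<alpha>" if "\<phi> \<in> cauchy_seqs \<alpha>" for \<phi> :: "nat \<Rightarrow> 'a \<Rightarrow> real"
    using that by (simp add: cauchy_rel_iff Lp_null_zero)
  have "linear_embedding \<alpha> p ?T"
    unfolding linear_embedding_def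
  proof (intro conjI ballI allI impI)
    show "?T U \<in> Lp p" if "U \<in> D22 \<alpha>" for U by (rule T(1)[OF that])
  next
    fix u :: "'a \<Rightarrow> real" assume u: "u \<in> test_space \<alpha>"
    show "AE x in lborel. ?T (D22_of \<alpha> u) x = u x"
    proof (rule T_class[OF inLp[OF u]])
      show "(\<lambda>n. u) \<in> D22_of \<alpha> u" using refl[OF const_in_cauchy_seqs[OF u]] by (simp add: D22_of_def)
      show "\<exists>\<phi>. (\<phi>, \<xi>) \<in> cauchy_rel \<alpha> \<and> Lp_null p (\<lambda>n x. \<phi> n x - u x)" if "\<xi> \<in> D22_of \<alpha> u" for \<xi>
        using that by (intro exI[of _ "\<lambda>n. u"]) (auto simp: D22_of_def Lp_null_zero)
    qed
  next
    fix U V :: "(nat \<Rightarrow> 'a \<Rightarrow> real) set" assume U: "U \<in> D22 \<alpha>" and V: "V \<in> D22 \<alpha>"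
    obtain \<phi>0 \<psi>0 where 0: "\<phi>0 \<in> U" "\<psi>0 \<in> V" using D22_nonempty[OF U] D22_nonempty[OF V] by blast
    show "AE x in lborel. ?T (D22_add \<alpha> U V) x = ?T U x + ?T V x"
    proof (rule T_class[OF Lp_add(1)[OF T(1)[OF U] T(1)[OF V] p0(1)]])
      show "(\<lambda>n x. \<phi>0 n x + \<psi>0 n x) \<in> D22_add \<alpha> U V"
        using refl[OF cauchy_seqs_add[OF D22_memberD(1)[OF U 0(1)] D22_memberD(1)[OF V 0(2)]]] 0
        by (auto simp: D22_add_def)
      fix \<xi> assume "\<xi> \<in> D22_add \<alpha> U V"
      then obtain \<phi> \<psi> where \<phi>: "\<phi> \<in> U" "\<psi> \<in> V" "((\<lambda>n x. \<phi> n x + \<psi> n x), \<xi>) \<in> cauchy_rel \<alpha>"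
        by (auto simp: D22_add_def)
      have "Lp_null p (\<lambda>n x. (\<phi> n x - ?T U x) + (\<psi> n x - ?T V x))"
        by (intro Lp_null_add T(2)[OF U \<phi>(1)] T(2)[OF V \<phi>(2)] p0(1))
      also have "(\<lambda>n x. (\<phi> n x - ?T U x) + (\<psi> n x - ?T V x)) = (\<lambda>n x. (\<phi> n x + \<psi> n x) - (?T U x + ?T V x))"
        by (simp add: algebra_simps)
      finally show "\<exists>\<phi>. (\<phi>, \<xi>) \<in> cauchy_rel \<alpha> \<and> Lp_null p (\<lambda>n x. \<phi> n x - (?T U x + ?T V x))"
        using \<phi>(3) by blast
    qed
  next
    fix c :: real and U :: "(nat \<Rightarrow> 'a \<Rightarrow> real) set" assume U: "U \<in> D22 \<alpha>"
    obtain \<phi>0 where 0: "\<phi>0 \<in> U" using D22_nonempty[OF U] by blast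
    show "AE x in lborel. ?T (D22_scale \<alpha> c U) x = c * ?T U x"
    proof (rule T_class[OF Lp_scale[OF T(1)[OF U]]])
      show "(\<lambda>n x. c * \<phi>0 n x) \<in> D22_scale \<alpha> c U"
        using refl[OF cauchy_seqs_scale[OF D22_memberD(1)[OF U 0]]] 0 by (auto simp: D22_scale_def)
      fix \<xi> assume "\<xi> \<in> D22_scale \<alpha> c U"
      then obtain \<phi> where \<phi>: "\<phi> \<in> U" "((\<lambda>n x. c * \<phi> n x), \<xi>) \<in> cauchy_rel \<alpha>"
        by (auto simp: D22_scale_def)
      have "Lp_null p (\<lambda>n x. c * (\<phi> n x - ?T U x))"
        by (intro Lp_null_scale T(2)[OF U \<phi>(1)])
      then have "Lp_null p (\<lambda>n x. c * \<phi> n x - c * ?T U x)" by (simp only: right_diff_distrib)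
      then show "\<exists>\<phi>. (\<phi>, \<xi>) \<in> cauchy_rel \<alpha> \<and> Lp_null p (\<lambda>n x. \<phi> n x - c * ?T U x)"
        using \<phi>(2) by blast
    qed
  next
    fix U V :: "(nat \<Rightarrow> 'a \<Rightarrow> real) set" assume U: "U \<in> D22 \<alpha>" and V: "V \<in> D22 \<alpha>" and eq: "AE x in lborel. ?T U x = ?T V x"
    obtain \<phi> \<psi> where 0: "\<phi> \<in> U" "\<psi> \<in> V" using D22_nonempty[OF U] D22_nonempty[OF V] by blast
    \<comment> \<open>Both representatives have the same limit in L^p, so the difference is null
      there while its images are Cauchy in L^2. Closability makes the images null, which is
      equivalence of the representatives.\<close>
    define \<eta> where "\<eta> n x = \<phi> n x - \<psi> n x" for n x
    have t: "\<phi> n \<in> test_space \<alpha>" "\<psi> n \<in> test_space \<alpha>" for n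
      using D22_memberD(2)[OF U 0(1)] D22_memberD(2)[OF V 0(2)] by auto
    have \<eta>cs: "\<eta> \<in> cauchy_seqs \<alpha>"
      using cauchy_seqs_diff[OF D22_memberD(1)[OF U 0(1)] D22_memberD(1)[OF V 0(2)]]
      by (simp add: \<eta>_def[abs_def])
    then have \<eta>t: "\<eta> n \<in> test_space \<alpha>" for n by (simp add: cauchy_seqs_iff)
    note [measurable] = borel_measurable_test_space(1)[OF \<eta>t] Lp_D(1)[OF T(1)[OF U]] Lp_D(1)[OF T(1)[OF V]]
    have "Lp_null p (\<lambda>n x. (\<phi> n x - ?T U x) - (\<psi> n x - ?T V x))"
      by (intro Lp_null_diff T(2)[OF U 0(1)] T(2)[OF V 0(2)] p0(1))
    then have "Lp_null p \<eta>"
    proof (rule Lp_null_cong_AE)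
      show "\<eta> n \<in> borel_measurable borel" for n by measurable
      show "AE x in lborel. (\<phi> n x - ?T U x) - (\<psi> n x - ?T V x) = \<eta> n x" for n
        using eq by eventually_elim (simp add: \<eta>_def)
    qed
    then have "(\<lambda>n. \<integral>x. (wdiv \<alpha> (\<eta> n) x)\<^sup>2 \<partial>lborel) \<longlonglongrightarrow> 0"
      using \<eta>cs p0 Lp_D(2)[OF inLp[OF \<eta>t]]
      by (intro wdiv_closable[OF \<eta>t p0(2)]) (auto simp: Lp_null_def cauchy_seqs_iff Lp_Cauchy_def abs_powr_2)
    then have "(\<lambda>n. Lp_power 2 (\<lambda>x. wdiv \<alpha> (\<phi> n) x - wdiv \<alpha> (\<psi> n) x)) \<longlonglongrightarrow> 0"
      by (simp add: \<eta>_def[abs_def] integral_wdiv_diff[OF t])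
    then have "(\<phi>, \<psi>) \<in> cauchy_rel \<alpha>"
      using D22_memberD(1)[OF U 0(1)] D22_memberD(1)[OF V 0(2)] Lp_diff[OF wdiv_in_L2[OF t(1)] wdiv_in_L2[OF t(2)]]
      by (simp add: cauchy_rel_iff Lp_null_def)
    then show "U = V"
      using quotient_eqI[OF equiv_cauchy_rel U[unfolded D22_def] V[unfolded D22_def] 0] by blast
  qed
  moreover have "\<exists>S>0. \<forall>U\<in>D22 \<alpha>. (\<integral>x. \<bar>D22_div \<alpha> U x\<bar>\<^sup>2 \<partial>lborel)
         \<ge> S * Lp_power p (?T U) powr (2 / p)"
  proof (intro exI conjI ballI)
    \<comment> \<open>16 = 4 * 4: one factor is 2^p to the power 2/p from \<open>Lp_add\<close> in
      L^p, the other is 2^2 from \<open>Lp_add\<close> in L^2.\<close>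
    show "0 < 1 / (16 * C)" using C by simp
    fix U :: "(nat \<Rightarrow> 'a \<Rightarrow> real) set" assume U: "U \<in> D22 \<alpha>"
    obtain \<phi> where \<phi>: "\<phi> \<in> U" using D22_nonempty[OF U] by blast
    have t: "\<phi> n \<in> test_space \<alpha>" for n by (rule D22_memberD(2)[OF U \<phi>])
    let ?G = "D22_div \<alpha> U"
    define X where "X = Lp_power p (?T U)"
    define g where "g = Lp_power 2 ?G"
    define a where "a n = Lp_power p (\<lambda>x. \<phi> n x - ?T U x)" for n
    define b where "b n = Lp_power 2 (\<lambda>x. wdiv \<alpha> (\<phi> n) x - ?G x)" for n
    have X0: "0 \<le> X" and g0: "0 \<le> g" by (simp_all add: X_def g_def)
    have a: "a \<longlonglongrightarrow> 0" using T(2)[OF U \<phi>] by (simp add: Lp_null_def a_def[abs_def])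
    have b: "b \<longlonglongrightarrow> 0" using D22_div_spec(2)[OF U \<phi>] by (simp add: Lp_null_def b_def[abs_def])
    \<comment> \<open>T U is compared with a representative and \<open>D22_div \<alpha> U\<close>
      with its image. Both errors tend to 0, so the inequality for test functions passes to the
      limit.\<close>
    have bound: "X \<le> 2 powr p * ((C * (4 * (b n + g))) powr (p / 2) + a n)" for n
    proof -
      have "X = Lp_power p (\<lambda>x. \<phi> n x + (-1) * (\<phi> n x - ?T U x))" by (simp add: X_def)
      also have "\<dots> \<le> 2 powr p * (Lp_power p (\<phi> n) + Lp_power p (\<lambda>x. (-1) * (\<phi> n x - ?T U x)))"
        by (intro Lp_add(2) Lp_scale Lp_diff inLp t T(1)[OF U] p0(1))
      also have "Lp_power p (\<lambda>x. (-1) * (\<phi> n x - ?T U x)) = a n"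
        unfolding a_def abs_mult by simp
      also have "Lp_power p (\<phi> n) \<le> (C * div_energy \<alpha> (\<phi> n)) powr (p / 2)"
        by (rule sob'[OF t])
      also have "\<dots> \<le> (C * (4 * (b n + g))) powr (p / 2)"
      proof (intro powr_mono2 mult_left_mono)
        have "div_energy \<alpha> (\<phi> n) = Lp_power 2 (\<lambda>x. (wdiv \<alpha> (\<phi> n) x - ?G x) + ?G x)"
          by (simp add: abs_powr_2)
        also have "\<dots> \<le> 2 powr 2 * (Lp_power 2 (\<lambda>x. wdiv \<alpha> (\<phi> n) x - ?G x) + Lp_power 2 ?G)"
          by (intro Lp_add(2) Lp_diff wdiv_in_L2 t D22_div_spec(1)[OF U]) auto
        finally show "div_energy \<alpha> (\<phi> n) \<le> 4 * (b n + g)"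
          by (simp add: b_def g_def powr_numeral)
      qed (use C p0 in auto)
      finally show ?thesis by simp
    qed
    have "(\<lambda>n. 2 powr p * ((C * (4 * (b n + g))) powr (p / 2) + a n)) \<longlonglongrightarrow> 2 powr p * ((C * (4 * (0 + g))) powr (p / 2) + 0)"
      using p0 C g0 by (intro tendsto_intros tendsto_powr' a b) (auto simp: b_def)
    then have "X \<le> 2 powr p * ((C * (4 * (0 + g))) powr (p / 2) + 0)"
      by (rule LIMSEQ_le_const) (use bound in auto)
    then have "X powr (2 / p) \<le> (2 powr p * (C * (4 * g)) powr (p / 2)) powr (2 / p)"
      using X0 p0 by (intro powr_mono2) auto
    also have "\<dots> = 2 powr 2 * (C * (4 * g)) powr 1"
      using p0 by (simp add: powr_mult powr_powr abs_mult)
    also have "\<dots> = 16 * C * g" using C g0 by (simp add: powr_numeral)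
    finally have "1 / (16 * C) * X powr (2 / p) \<le> g" using C by (simp add: field_simps)
    then show "1 / (16 * C) * Lp_power p (?T U) powr (2 / p) \<le> (\<integral>x. \<bar>?G x\<bar>\<^sup>2 \<partial>lborel)"
      by (simp add: X_def g_def abs_powr_2)
  qed
  ultimately show ?thesis by blast
qed

theorem mainTheorem5:
  fixes \<alpha> p :: real
  assumes "CARD('n::finite) \<ge> 5"
    and "0 < \<alpha>" and "\<alpha> < 2"
    and "p = crit_exp CARD('n) \<alpha>"
  shows "\<exists>T :: (nat \<Rightarrow> real ^ 'n \<Rightarrow> real) set \<Rightarrow> real ^ 'n \<Rightarrow> real.
    linear_embedding \<alpha> p T \<and>
    (\<exists>S>0. \<forall>U\<in>D22 \<alpha>.
       (\<integral>x. \<bar>D22_div \<alpha> U x\<bar>\<^sup>2 \<partial>lborel)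
         \<ge> S * (\<integral>x. \<bar>T U x\<bar> powr p \<partial>lborel) powr (2 / p))"
proof -
  have dim: "5 \<le> DIM(real ^ 'n)" "p = crit_exp DIM(real ^ 'n) \<alpha>" using assms by simp_all
  show ?thesis
  proof (rule sobolev_test_space[OF dim(1) assms(2,3) dim(2)])
    fix C :: real
    assume "0 < C" "\<And>u :: real ^ 'n \<Rightarrow> real. u \<in> test_space \<alpha> \<Longrightarrow> integrable lborel (\<lambda>x. \<bar>u x\<bar> powr p)"
      "\<And>u :: real ^ 'n \<Rightarrow> real. u \<in> test_space \<alpha> \<Longrightarrow>
        Lp_power p u powr (2 / p) \<le> C * div_energy \<alpha> u"
    then show ?thesis
      by (rule embedding_of_sobolev[OF crit_exp_facts(1)[OF assms]])
  qed
qed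
end
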